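(* Let $\mathcal{C}=\{\ell_1,\dots,\ell_n\}$ ($n\ge3$) be an arrangement of distinct lines in $\mathbb{C}^2$, no two parallel, with no restriction on the multiplicities of its nodes. Let $\ell_0\in\mathcal{C}$ and $\mathcal{C}'=\mathcal{C}\setminus\{\ell_0\}$. If $a_j$ denotes the number of nodes of multiplicity $j$ lying on $\ell_0$ (counted in $\mathcal{C}$), then $$\delta(\mathcal{C})=\delta(\mathcal{C}')+3a_4+\sum_{j\ge5}(j-2)a_j .$$ In particular $\delta(\mathcal{C})=\delta(\mathcal{C}')$ whenever $\ell_0$ meets no node of multiplicity $\ge4$.
   Context: A node is a point of $\mathbb{C}^2$ lying on at least two lines of the arrangement; its multiplicity is the number of lines through it. For a line arrangement $\mathcal{A}=\{\ell_1,\dots,\ell_m\}$ with complement $\mathcal{M}(\mathcal{A})=\mathbb{C}^2\setminus\bigcup_i\ell_i$, the defect is $$\delta(\mathcal{A}):=\dim OS^2(\mathcal{A})-\dim H^2(\mathcal{M}(\mathcal{A});\mathbb{C}),$$ where $OS(\mathcal{A})=E/I$ is the following simplified Orlik–Solomon type algebra. $E=\bigwedge_{\mathbb{C}}\langle e_1,\dots,e_m\rangle$; $\partial:E\to E$ is the linear map of degree $-1$ with $\partial(1)=0$, $\partial(e_i)=1$ and $\partial(\alpha\wedge\beta)=\partial(\alpha)\wedge\beta+(-1)^p\alpha\wedge\partial(\beta)$ for $\alpha$ of degree $p$; $I$ is the two-sided homogeneous ideal generated by the elements $\partial(e_{i_1}\wedge\dots\wedge e_{i_k})$, one for each node of multiplicity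 $k\ge3$, where $\ell_{i_1},\dots,\ell_{i_k}$ are all the lines through the node. $OS^2$ is the degree-two part. *)

theory Defs
  imports "HOL-Homology.Homology" "HOL-Algebra.QuotRing" "Jordan_Normal_Form.VS_Connect"
begin

section \<open>Lines in the complex plane\<close>

type_synonym cplane = "complex \<times> complex"

definition complex_line :: "cplane set \<Rightarrow> bool" where
  "complex_line l \<longleftrightarrow> (\<exists>a b c. (a, b) \<noteq> (0, 0) \<and> l = {(x, y). a * x + b * y = c})"

definition parallel_lines :: "cplane set \<Rightarrow> cplane set \<Rightarrow> bool" where
  "parallel_lines l l' \<longleftrightarrow> (\<exists>v. l' = (\<lambda>p. p + v) ` l)"

definition multiplicity_at :: "cplane set set \<Rightarrow> cplane \<Rightarrow> nat" where
  "multiplicity_at A p = card {l \<in> A. p \<in> l}"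

definition is_node :: "cplane set set \<Rightarrow> cplane \<Rightarrow> bool" where
  "is_node A p \<longleftrightarrow> multiplicity_at A p \<ge> 2"

definition num_nodes_on :: "cplane set set \<Rightarrow> cplane set \<Rightarrow> nat \<Rightarrow> nat" where
  "num_nodes_on A l j = card {p \<in> l. is_node A p \<and> multiplicity_at A p = j}"

definition arr_complement :: "cplane set set \<Rightarrow> cplane topology" where
  "arr_complement A = top_of_set (UNIV - \<Union>A)"


section \<open>Quotients of complex vector spaces\<close>

abbreviation complex_field :: "complex ring" where
  "complex_field \<equiv> class_ring"

text \<open>The quotient by a subspace, carried by the additive cosets. If the module record also
  carries a ring structure for which the subspace is a two-sided ideal, then the ring part is that
  of the factor ring \<^const>\<open>FactRing\<close>.\<close>

definition quot_module :: "('a, 'b, 'c) module_scheme \<Rightarrow> 'b set \<Rightarrow> ('a, 'b set) module" where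
  "quot_module M W =
    \<lparr>carrier = a_rcosets\<^bsub>M\<^esub> W, mult = rcoset_mult M W, one = W +>\<^bsub>M\<^esub> \<one>\<^bsub>M\<^esub>,
     zero = W, add = set_add M,
     smult = (\<lambda>c A. \<Union>x\<in>A. W +>\<^bsub>M\<^esub> (c \<odot>\<^bsub>M\<^esub> x))\<rparr>"


section \<open>Singular cohomology with complex coefficients\<close>

text \<open>A cochain is an additive map from singular chains to the complex numbers, given by
  its values on singular simplices; it is set to zero off the singular simplices so that equal
  cochains are equal functions.\<close>

type_synonym 'a cochain = "((nat \<Rightarrow> real) \<Rightarrow> 'a) \<Rightarrow> complex"

definition cochain_set :: "nat \<Rightarrow> 'a topology \<Rightarrow> 'a cochain set" where
  "cochain_set p X = {\<phi>. \<forall>\<sigma>. \<not> singular_simplex p X \<sigma> \<longrightarrow> \<phi> \<sigma> = 0}"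

definition cochain_eval :: "'a cochain \<Rightarrow> 'a chain \<Rightarrow> complex" where
  "cochain_eval \<phi> c = (\<Sum>\<sigma>\<in>Poly_Mapping.keys c. of_int (Poly_Mapping.lookup c \<sigma>) * \<phi> \<sigma>)"

definition coboundary :: "nat \<Rightarrow> 'a topology \<Rightarrow> 'a cochain \<Rightarrow> 'a cochain" where
  "coboundary p X \<phi> = (\<lambda>\<sigma>. if singular_simplex (Suc p) X \<sigma>
      then cochain_eval \<phi> (chain_boundary (Suc p) (frag_of \<sigma>)) else 0)"

definition cocycle_set :: "nat \<Rightarrow> 'a topology \<Rightarrow> 'a cochain set" where
  "cocycle_set p X = {\<phi> \<in> cochain_set p X. coboundary p X \<phi> = (\<lambda>_. 0)}"

definition coboundary_set :: "nat \<Rightarrow> 'a topology \<Rightarrow> 'a cochain set" where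
  "coboundary_set p X =
    (case p of 0 \<Rightarrow> {\<lambda>_. 0} | Suc q \<Rightarrow> coboundary q X ` cochain_set q X)"

text \<open>The multiplicative fields of the record play no role in a module.\<close>

definition cocycle_space :: "nat \<Rightarrow> 'a topology \<Rightarrow> (complex, 'a cochain) module" where
  "cocycle_space p X =
    \<lparr>carrier = cocycle_set p X, mult = undefined, one = undefined, zero = (\<lambda>_. 0),
     add = (\<lambda>\<phi> \<psi> \<sigma>. \<phi> \<sigma> + \<psi> \<sigma>), smult = (\<lambda>c \<phi> \<sigma>. c * \<phi> \<sigma>)\<rparr>"

definition cohomology_space :: "nat \<Rightarrow> 'a topology \<Rightarrow> (complex, 'a cochain set) module" where
  "cohomology_space p X = quot_module (cocycle_space p X) (coboundary_set p X)"


section \<open>The exterior algebra\<close>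

text \<open>The exterior algebra on generators \<open>e\<^sub>i\<close>, \<open>i < m\<close>, in coordinates: \<open>\<alpha> S\<close> is the coefficient of
  the monomial \<open>e\<^sub>S\<close>, the wedge product of the \<open>e\<^sub>i\<close>, \<open>i \<in> S\<close>, in increasing order. Sorting
  the product of \<open>e\<^sub>S\<close> and \<open>e\<^sub>T\<close> for disjoint \<open>S\<close> and \<open>T\<close> takes as many transpositions as there are
  pairs \<open>(i, j) \<in> S \<times> T\<close> with \<open>j < i\<close>.\<close>

type_synonym ext = "nat set \<Rightarrow> complex"

definition shuffle_sign :: "nat set \<Rightarrow> nat set \<Rightarrow> complex" where
  "shuffle_sign S T = (-1) ^ card {(i, j). i \<in> S \<and> j \<in> T \<and> j < i}"

definition wedge :: "ext \<Rightarrow> ext \<Rightarrow> ext" where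
  "wedge \<alpha> \<beta> = (\<lambda>U. \<Sum>S\<in>Pow U. shuffle_sign S (U - S) * \<alpha> S * \<beta> (U - S))"

definition ext_mono :: "nat set \<Rightarrow> ext" where
  "ext_mono S = (\<lambda>U. if U = S then 1 else 0)"

abbreviation ext_gen :: "nat \<Rightarrow> ext" where
  "ext_gen i \<equiv> ext_mono {i}"

definition ext_alg :: "nat \<Rightarrow> (complex, ext) module" where
  "ext_alg m =
    \<lparr>carrier = {\<alpha>. \<forall>S. \<not> S \<subseteq> {..<m} \<longrightarrow> \<alpha> S = 0}, mult = wedge, one = ext_mono {},
     zero = (\<lambda>_. 0), add = (\<lambda>\<alpha> \<beta> S. \<alpha> S + \<beta> S), smult = (\<lambda>c \<alpha> S. c * \<alpha> S)\<rparr>"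

definition ext_degree :: "nat \<Rightarrow> nat \<Rightarrow> ext set" where
  "ext_degree m p = {\<alpha> \<in> carrier (ext_alg m). \<forall>S. card S \<noteq> p \<longrightarrow> \<alpha> S = 0}"

definition wedge_list :: "ext list \<Rightarrow> ext" where
  "wedge_list as = foldr wedge as (ext_mono {})"

text \<open>The linear map sending \<open>e\<^sub>S\<close> to the sum over \<open>i \<in> S\<close> of the monomials
  \<open>e\<^bsub>S - {i}\<^esub>\<close> with sign given by the parity of the number of \<open>j \<in> S\<close> with \<open>j < i\<close>. The facts
  \<open>ext_boundary_one\<close>, \<open>ext_boundary_gen\<close> and \<open>ext_boundary_wedge\<close> below characterise it as an
  antiderivation.\<close>

definition ext_boundary :: "nat \<Rightarrow> ext \<Rightarrow> ext" where
  "ext_boundary m \<alpha> = (\<lambda>U. \<Sum>i\<in>{..<m} - U. (-1) ^ card {j \<in> U. j < i} * \<alpha> (insert i U))"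


section \<open>The simplified Orlik--Solomon algebra and the defect\<close>

text \<open>An arrangement is given with an enumeration of its lines, the line \<open>ls ! i\<close> belonging to the
  generator \<open>e\<^sub>i\<close>.\<close>

definition lines_through :: "cplane set list \<Rightarrow> cplane \<Rightarrow> nat list" where
  "lines_through ls p = filter (\<lambda>i. p \<in> ls ! i) [0..<length ls]"

definition OS_relations :: "cplane set list \<Rightarrow> ext set" where
  "OS_relations ls =
    {ext_boundary (length ls) (wedge_list (map ext_gen (lines_through ls p))) | p.
       is_node (set ls) p \<and> multiplicity_at (set ls) p \<ge> 3}"

definition OS_ideal :: "cplane set list \<Rightarrow> ext set" where
  "OS_ideal ls = genideal (ext_alg (length ls)) (OS_relations ls)"

definition OS_alg :: "cplane set list \<Rightarrow> (complex, ext set) module" where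
  "OS_alg ls = quot_module (ext_alg (length ls)) (OS_ideal ls)"

definition OS_part :: "cplane set list \<Rightarrow> nat \<Rightarrow> (complex, ext set) module" where
  "OS_part ls p = (OS_alg ls)\<lparr>carrier :=
    (\<lambda>\<alpha>. OS_ideal ls +>\<^bsub>ext_alg (length ls)\<^esub> \<alpha>) ` ext_degree (length ls) p\<rparr>"

definition defect :: "cplane set list \<Rightarrow> int" where
  "defect ls =
    int (vectorspace.dim complex_field (OS_part ls 2))
    - int (vectorspace.dim complex_field (cohomology_space 2 (arr_complement (set ls))))"


section \<open>Well-formedness of the constructions\<close>

subsection \<open>Quotient spaces\<close>

lemma quot_module_vectorspace:
  assumes V: "vectorspace K V" and W: "submodule K W V"
  shows "vectorspace K (quot_module V W)"
    and "zero (quot_module V W) = W +>\<^bsub>V\<^esub> \<zero>\<^bsub>V\<^esub>"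
    and "\<And>x. x \<in> carrier V \<Longrightarrow> W +>\<^bsub>V\<^esub> x \<in> carrier (quot_module V W)"
    and "\<And>x y. x \<in> carrier V \<Longrightarrow> y \<in> carrier V \<Longrightarrow>
      (W +>\<^bsub>V\<^esub> x) \<oplus>\<^bsub>quot_module V W\<^esub> (W +>\<^bsub>V\<^esub> y) = W +>\<^bsub>V\<^esub> (x \<oplus>\<^bsub>V\<^esub> y)"
    and "\<And>c x. c \<in> carrier K \<Longrightarrow> x \<in> carrier V \<Longrightarrow>
      c \<odot>\<^bsub>quot_module V W\<^esub> (W +>\<^bsub>V\<^esub> x) = W +>\<^bsub>V\<^esub> (c \<odot>\<^bsub>V\<^esub> x)"
proof -
  interpret V: vectorspace K V by fact
  have Wc: "W \<subseteq> carrier V" and W0: "\<zero>\<^bsub>V\<^esub> \<in> W"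
    and Wadd: "\<And>x y. x \<in> W \<Longrightarrow> y \<in> W \<Longrightarrow> x \<oplus>\<^bsub>V\<^esub> y \<in> W"
    and Wsm: "\<And>c x. c \<in> carrier K \<Longrightarrow> x \<in> W \<Longrightarrow> c \<odot>\<^bsub>V\<^esub> x \<in> W"
    using W by (auto simp: submodule_def)
  have sub: "additive_subgroup W V"
  proof (intro additive_subgroup.intro subgroup.intro)
    fix x assume x: "x \<in> W"
    have "\<ominus>\<^bsub>V\<^esub> x = (\<ominus>\<^bsub>K\<^esub> \<one>\<^bsub>K\<^esub>) \<odot>\<^bsub>V\<^esub> x"
      using x Wc V.smult_l_minus[of "\<one>\<^bsub>K\<^esub>" x] by auto
    then have "\<ominus>\<^bsub>V\<^esub> x \<in> W" using Wsm x by auto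
    then show "inv\<^bsub>add_monoid V\<^esub> x \<in> W" by (simp add: a_inv_def)
  qed (use Wc W0 Wadd in auto)
  interpret Wn: abelian_subgroup W V
    by (rule abelian_subgroupI3[OF sub]) (rule V.M.abelian_group_axioms)
  let ?Q = "quot_module V W"
  have carr: "carrier ?Q = a_rcosets\<^bsub>V\<^esub> W" by (simp add: quot_module_def)
  have rep: "\<exists>x\<in>carrier V. A = W +>\<^bsub>V\<^esub> x" if "A \<in> carrier ?Q" for A
    using that by (auto simp: carr A_RCOSETS_def' a_r_coset_def')
  have inC: "W +>\<^bsub>V\<^esub> x \<in> carrier ?Q" if "x \<in> carrier V" for x
    unfolding carr by (rule V.M.a_rcosetsI[OF Wc that])
  have addc: "(W +>\<^bsub>V\<^esub> x) \<oplus>\<^bsub>?Q\<^esub> (W +>\<^bsub>V\<^esub> y) = W +>\<^bsub>V\<^esub> (x \<oplus>\<^bsub>V\<^esub> y)"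
    if "x \<in> carrier V" "y \<in> carrier V" for x y
    using Wn.a_rcos_sum that by (simp add: quot_module_def)
  have smc: "c \<odot>\<^bsub>?Q\<^esub> (W +>\<^bsub>V\<^esub> x) = W +>\<^bsub>V\<^esub> (c \<odot>\<^bsub>V\<^esub> x)"
    if c: "c \<in> carrier K" and x: "x \<in> carrier V" for c x
  proof -
    have "W +>\<^bsub>V\<^esub> (c \<odot>\<^bsub>V\<^esub> y) = W +>\<^bsub>V\<^esub> (c \<odot>\<^bsub>V\<^esub> x)" if y: "y \<in> W +>\<^bsub>V\<^esub> x" for y
    proof -
      from y obtain w where w: "w \<in> W" "y = w \<oplus>\<^bsub>V\<^esub> x"
        by (auto simp: a_r_coset_def')
      have "c \<odot>\<^bsub>V\<^esub> y = (c \<odot>\<^bsub>V\<^esub> w) \<oplus>\<^bsub>V\<^esub> (c \<odot>\<^bsub>V\<^esub> x)"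
        using w x c Wc V.smult_r_distr by auto
      moreover have "c \<odot>\<^bsub>V\<^esub> w \<in> W" using Wsm c w by auto
      ultimately have "c \<odot>\<^bsub>V\<^esub> y \<in> W +>\<^bsub>V\<^esub> (c \<odot>\<^bsub>V\<^esub> x)"
        by (auto simp: a_r_coset_def')
      then show ?thesis
        using Wn.a_repr_independence'[OF _ V.smult_closed[OF c x]] by metis
    qed
    moreover have "W +>\<^bsub>V\<^esub> x \<noteq> {}" using Wn.a_rcos_self[OF x] by blast
    ultimately have "(\<Union>y\<in>W +>\<^bsub>V\<^esub> x. W +>\<^bsub>V\<^esub> (c \<odot>\<^bsub>V\<^esub> y)) = W +>\<^bsub>V\<^esub> (c \<odot>\<^bsub>V\<^esub> x)"
      by blast
    then show ?thesis by (simp add: quot_module_def)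
  qed
  have zer: "\<zero>\<^bsub>?Q\<^esub> = W +>\<^bsub>V\<^esub> \<zero>\<^bsub>V\<^esub>"
    using V.M.a_coset_add_zero[OF Wc] by (simp add: quot_module_def)
  have ab: "abelian_group ?Q"
  proof (rule abelian_groupI)
    fix A B assume "A \<in> carrier ?Q" "B \<in> carrier ?Q"
    then show "A \<oplus>\<^bsub>?Q\<^esub> B \<in> carrier ?Q" "A \<oplus>\<^bsub>?Q\<^esub> B = B \<oplus>\<^bsub>?Q\<^esub> A"
      using rep[of A] rep[of B] by (auto simp: addc inC V.M.a_comm)
  next
    show "\<zero>\<^bsub>?Q\<^esub> \<in> carrier ?Q" by (simp add: zer inC)
  next
    fix A B C assume "A \<in> carrier ?Q" "B \<in> carrier ?Q" "C \<in> carrier ?Q"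
    then show "(A \<oplus>\<^bsub>?Q\<^esub> B) \<oplus>\<^bsub>?Q\<^esub> C = A \<oplus>\<^bsub>?Q\<^esub> (B \<oplus>\<^bsub>?Q\<^esub> C)"
      using rep[of A] rep[of B] rep[of C] by (auto simp: addc V.M.a_assoc)
  next
    fix A assume A: "A \<in> carrier ?Q"
    then obtain x where x: "x \<in> carrier V" "A = W +>\<^bsub>V\<^esub> x" using rep by blast
    show "\<zero>\<^bsub>?Q\<^esub> \<oplus>\<^bsub>?Q\<^esub> A = A" by (simp add: zer x addc)
    show "\<exists>B\<in>carrier ?Q. B \<oplus>\<^bsub>?Q\<^esub> A = \<zero>\<^bsub>?Q\<^esub>"
      by (rule bexI[of _ "W +>\<^bsub>V\<^esub> (\<ominus>\<^bsub>V\<^esub> x)"]) (use x in \<open>auto simp: addc inC zer V.M.l_neg\<close>)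
  qed
  have "Module.module K ?Q"
  proof (rule moduleI)
    show "cring K" by (rule V.R.cring_axioms)
    show "abelian_group ?Q" by (rule ab)
  next
    fix a A assume "a \<in> carrier K" "A \<in> carrier ?Q"
    then show "a \<odot>\<^bsub>?Q\<^esub> A \<in> carrier ?Q" using rep smc inC by (metis V.smult_closed)
  next
    fix a b A assume "a \<in> carrier K" "b \<in> carrier K" "A \<in> carrier ?Q"
    then show "(a \<oplus>\<^bsub>K\<^esub> b) \<odot>\<^bsub>?Q\<^esub> A = a \<odot>\<^bsub>?Q\<^esub> A \<oplus>\<^bsub>?Q\<^esub> b \<odot>\<^bsub>?Q\<^esub> A"
      using rep[of A] by (auto simp: smc addc V.smult_l_distr)
  next
    fix a A B assume "a \<in> carrier K" "A \<in> carrier ?Q" "B \<in> carrier ?Q"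
    then show "a \<odot>\<^bsub>?Q\<^esub> (A \<oplus>\<^bsub>?Q\<^esub> B) = a \<odot>\<^bsub>?Q\<^esub> A \<oplus>\<^bsub>?Q\<^esub> a \<odot>\<^bsub>?Q\<^esub> B"
      using rep[of A] rep[of B] by (auto simp: smc addc V.smult_r_distr)
  next
    fix a b A assume "a \<in> carrier K" "b \<in> carrier K" "A \<in> carrier ?Q"
    then show "(a \<otimes>\<^bsub>K\<^esub> b) \<odot>\<^bsub>?Q\<^esub> A = a \<odot>\<^bsub>?Q\<^esub> (b \<odot>\<^bsub>?Q\<^esub> A)"
      using rep[of A] by (auto simp: smc V.smult_assoc1)
  next
    fix A assume "A \<in> carrier ?Q"
    then show "\<one>\<^bsub>K\<^esub> \<odot>\<^bsub>?Q\<^esub> A = A" using rep[of A] by (auto simp: smc)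
  qed
  then show "vectorspace K ?Q"
    by (simp add: vectorspace_def V.field_axioms)
  show "zero ?Q = W +>\<^bsub>V\<^esub> \<zero>\<^bsub>V\<^esub>" by (rule zer)
  show "\<And>x. x \<in> carrier V \<Longrightarrow> W +>\<^bsub>V\<^esub> x \<in> carrier ?Q" by (rule inC)
  show "\<And>x y. x \<in> carrier V \<Longrightarrow> y \<in> carrier V \<Longrightarrow>
      (W +>\<^bsub>V\<^esub> x) \<oplus>\<^bsub>?Q\<^esub> (W +>\<^bsub>V\<^esub> y) = W +>\<^bsub>V\<^esub> (x \<oplus>\<^bsub>V\<^esub> y)" by (rule addc)
  show "\<And>c x. c \<in> carrier K \<Longrightarrow> x \<in> carrier V \<Longrightarrow>
      c \<odot>\<^bsub>?Q\<^esub> (W +>\<^bsub>V\<^esub> x) = W +>\<^bsub>V\<^esub> (c \<odot>\<^bsub>V\<^esub> x)" by (rule smc)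
qed

subsection \<open>Singular cohomology\<close>

lemma cochain_eval_superset:
  assumes "finite A" "Poly_Mapping.keys c \<subseteq> A"
  shows "cochain_eval \<phi> c = (\<Sum>\<sigma>\<in>A. of_int (Poly_Mapping.lookup c \<sigma>) * \<phi> \<sigma>)"
  unfolding cochain_eval_def
  by (rule sum.mono_neutral_left) (use assms in \<open>auto simp: in_keys_iff\<close>)

lemma cochain_eval_0 [simp]: "cochain_eval \<phi> 0 = 0"
  by (simp add: cochain_eval_def)

lemma cochain_eval_add: "cochain_eval \<phi> (c + d) = cochain_eval \<phi> c + cochain_eval \<phi> d"
proof -
  let ?A = "Poly_Mapping.keys c \<union> Poly_Mapping.keys d"
  have "cochain_eval \<phi> x = (\<Sum>\<sigma>\<in>?A. of_int (Poly_Mapping.lookup x \<sigma>) * \<phi> \<sigma>)"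
    if "x \<in> {c, d, c + d}" for x
    by (rule cochain_eval_superset) (use that keys_add[of c d] in auto)
  then have "cochain_eval \<phi> c = (\<Sum>\<sigma>\<in>?A. of_int (Poly_Mapping.lookup c \<sigma>) * \<phi> \<sigma>)"
    "cochain_eval \<phi> d = (\<Sum>\<sigma>\<in>?A. of_int (Poly_Mapping.lookup d \<sigma>) * \<phi> \<sigma>)"
    "cochain_eval \<phi> (c + d) = (\<Sum>\<sigma>\<in>?A. of_int (Poly_Mapping.lookup (c + d) \<sigma>) * \<phi> \<sigma>)"
    by blast+
  then show ?thesis
    by (simp only: lookup_add of_int_add distrib_right sum.distrib)
qed

lemma cochain_eval_cmul: "cochain_eval \<phi> (frag_cmul k c) = of_int k * cochain_eval \<phi> c"
proof -
  have "cochain_eval \<phi> x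
      = (\<Sum>\<sigma>\<in>Poly_Mapping.keys c. of_int (Poly_Mapping.lookup x \<sigma>) * \<phi> \<sigma>)"
    if "x \<in> {c, frag_cmul k c}" for x
    by (rule cochain_eval_superset) (use that keys_cmul[of k c] in auto)
  then show ?thesis
    by (simp add: sum_distrib_left algebra_simps)
qed

lemma cochain_eval_sum: "cochain_eval \<phi> (sum f A) = (\<Sum>x\<in>A. cochain_eval \<phi> (f x))"
  by (induction A rule: infinite_finite_induct) (auto simp: cochain_eval_add)

lemma cochain_eval_boundary:
  "cochain_eval \<phi> (chain_boundary p c) =
     (\<Sum>\<sigma>\<in>Poly_Mapping.keys c. of_int (Poly_Mapping.lookup c \<sigma>)
        * cochain_eval \<phi> (chain_boundary p (frag_of \<sigma>)))"
  by (simp add: chain_boundary_def frag_extend_def cochain_eval_sum cochain_eval_cmul)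

lemma coboundary_coboundary:
  "coboundary (Suc p) X (coboundary p X \<phi>) = (\<lambda>_. 0)"
proof
  fix \<sigma>
  show "coboundary (Suc p) X (coboundary p X \<phi>) \<sigma> = 0"
  proof (cases "singular_simplex (Suc (Suc p)) X \<sigma>")
    case True
    let ?b = "chain_boundary (Suc (Suc p)) (frag_of \<sigma>)"
    have ch: "singular_chain (Suc (Suc p)) X (frag_of \<sigma>)"
      using True by (simp add: singular_chain_of)
    have "singular_chain (Suc p) X ?b"
      using singular_chain_boundary[OF ch] by simp
    then have "cochain_eval (coboundary p X \<phi>) ?b = cochain_eval \<phi> (chain_boundary (Suc p) ?b)"
      unfolding cochain_eval_boundary[of \<phi> "Suc p" ?b]
      unfolding cochain_eval_def[of "coboundary p X \<phi>"]
      by (intro sum.cong) (auto simp: coboundary_def singular_chain_def)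
    also have "chain_boundary (Suc p) ?b = 0"
      using chain_boundary_boundary_alt[OF ch] by simp
    finally show ?thesis using True by (simp add: coboundary_def)
  qed (simp add: coboundary_def)
qed

lemma cochain_eval_lin:
  "cochain_eval (\<lambda>\<sigma>. a * \<phi> \<sigma> + b * \<psi> \<sigma>) c = a * cochain_eval \<phi> c + b * cochain_eval \<psi> c"
  by (simp add: cochain_eval_def distrib_left sum.distrib sum_distrib_left mult.left_commute)

lemma coboundary_lin:
  "coboundary p X (\<lambda>\<sigma>. a * \<phi> \<sigma> + b * \<psi> \<sigma>)
     = (\<lambda>\<sigma>. a * coboundary p X \<phi> \<sigma> + b * coboundary p X \<psi> \<sigma>)"
  by (auto simp: fun_eq_iff coboundary_def cochain_eval_lin)

lemma coboundary_add:
  "coboundary p X (\<lambda>\<sigma>. \<phi> \<sigma> + \<psi> \<sigma>) = (\<lambda>\<sigma>. coboundary p X \<phi> \<sigma> + coboundary p X \<psi> \<sigma>)"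
  using coboundary_lin[of p X 1 \<phi> 1 \<psi>] by simp

lemma coboundary_scale:
  "coboundary p X (\<lambda>\<sigma>. a * \<phi> \<sigma>) = (\<lambda>\<sigma>. a * coboundary p X \<phi> \<sigma>)"
  using coboundary_lin[of p X a \<phi> 0 \<phi>] by simp

lemma coboundary_zero: "coboundary p X (\<lambda>_. 0) = (\<lambda>_. 0)"
  using coboundary_lin[of p X 0 undefined 0 undefined] by simp

lemma vectorspace_funI:
  fixes V :: "(complex, 'a \<Rightarrow> complex) module"
  assumes [simp]: "zero V = (\<lambda>_. 0)" "add V = (\<lambda>f g x. f x + g x)" "smult V = (\<lambda>c f x. c * f x)"
    and z: "(\<lambda>_. 0) \<in> carrier V"
    and a: "\<And>f g. f \<in> carrier V \<Longrightarrow> g \<in> carrier V \<Longrightarrow> (\<lambda>x. f x + g x) \<in> carrier V"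
    and s: "\<And>c f. f \<in> carrier V \<Longrightarrow> (\<lambda>x. c * f x) \<in> carrier V"
  shows "vectorspace complex_field V"
proof -
  have "\<exists>g\<in>carrier V. (\<lambda>x. g x + f x) = (\<lambda>_. 0)" if "f \<in> carrier V" for f
    by (rule bexI[of _ "\<lambda>x. (-1) * f x"]) (use s[OF that, of "-1"] in auto)
  then have ab: "abelian_group V"
    by (intro abelian_groupI) (use z a in \<open>auto simp: algebra_simps\<close>)
  have "field complex_field" by (rule class_field.field_axioms)
  then have cr: "cring complex_field" by (simp add: field_def domain_def)
  have "Module.module complex_field V"
    by (intro moduleI) (use ab s cr in \<open>auto simp: algebra_simps\<close>)
  then show ?thesis
    by (simp add: vectorspace_def class_field.field_axioms)
qed

lemma cocycle_space_vectorspace: "vectorspace complex_field (cocycle_space p X)"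
  by (rule vectorspace_funI)
    (auto simp: cocycle_space_def cocycle_set_def cochain_set_def
      coboundary_add coboundary_scale coboundary_zero)

lemma cohomology_space_vectorspace: "vectorspace complex_field (cohomology_space p X)"
  unfolding cohomology_space_def
proof (rule quot_module_vectorspace(1)[OF cocycle_space_vectorspace])
  interpret vectorspace complex_field "cocycle_space p X"
    by (rule cocycle_space_vectorspace)
  show "LinearCombinations.submodule complex_field (coboundary_set p X) (cocycle_space p X)"
  proof (cases p)
    case 0
    then show ?thesis
      using module_axioms
      by (auto simp: submodule_def cocycle_space_def coboundary_set_def cocycle_set_def
          cochain_set_def coboundary_zero)
  next
    case (Suc q)
    have "coboundary_set p X \<subseteq> cocycle_set p X"
      by (auto simp: Suc coboundary_set_def cocycle_set_def coboundary_coboundary cochain_set_def)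
        (simp add: coboundary_def)
    moreover have "(\<lambda>_. 0) \<in> coboundary_set p X"
      by (auto simp: Suc coboundary_set_def cochain_set_def coboundary_zero
          intro!: image_eqI[of _ _ "\<lambda>_. 0"])
    moreover have "(\<lambda>\<sigma>. \<phi> \<sigma> + \<psi> \<sigma>) \<in> coboundary_set p X"
      if "\<phi> \<in> coboundary_set p X" "\<psi> \<in> coboundary_set p X" for \<phi> \<psi>
    proof -
      from that obtain f g where "f \<in> cochain_set q X" "g \<in> cochain_set q X"
        "\<phi> = coboundary q X f" "\<psi> = coboundary q X g"
        by (auto simp: Suc coboundary_set_def)
      then show ?thesis
        by (auto simp: Suc coboundary_set_def cochain_set_def coboundary_add
            intro!: image_eqI[of _ _ "\<lambda>x. f x + g x"])
    qed
    moreover have "(\<lambda>\<sigma>. c * \<phi> \<sigma>) \<in> coboundary_set p X" if "\<phi> \<in> coboundary_set p X" for c \<phi>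
    proof -
      from that obtain f where "f \<in> cochain_set q X" "\<phi> = coboundary q X f"
        by (auto simp: Suc coboundary_set_def)
      then show ?thesis
        by (auto simp: Suc coboundary_set_def cochain_set_def coboundary_scale
            intro!: image_eqI[of _ _ "\<lambda>x. c * f x"])
    qed
    ultimately show ?thesis
      using module_axioms by (auto simp: submodule_def cocycle_space_def)
  qed
qed

subsection \<open>The exterior algebra and its antiderivation\<close>

lemma shuffle_sign_empty [simp]: "shuffle_sign {} T = 1" "shuffle_sign S {} = 1"
  by (simp_all add: shuffle_sign_def)

lemma shuffle_sign_sq: "shuffle_sign S T * shuffle_sign S T = 1"
  by (simp add: shuffle_sign_def power_add[symmetric] mult_2[symmetric] power_mult)

lemma shuffle_sign_Un_left:
  assumes "finite S" "finite S'" "finite T" "S \<inter> S' = {}"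
  shows "shuffle_sign (S \<union> S') T = shuffle_sign S T * shuffle_sign S' T"
proof -
  have eq: "{(i, j). i \<in> S \<union> S' \<and> j \<in> T \<and> j < i}
      = {(i, j). i \<in> S \<and> j \<in> T \<and> j < i} \<union> {(i, j). i \<in> S' \<and> j \<in> T \<and> j < i}" by auto
  have fin: "finite {(i, j). i \<in> A \<and> j \<in> T \<and> j < i}" if "finite A" for A
    by (rule finite_subset[of _ "A \<times> T"]) (use that assms in auto)
  show ?thesis
    unfolding shuffle_sign_def eq
    by (subst card_Un_disjoint) (use assms fin in \<open>auto simp: power_add\<close>)
qed

lemma shuffle_sign_Un_right:
  assumes "finite S" "finite T" "finite T'" "T \<inter> T' = {}"
  shows "shuffle_sign S (T \<union> T') = shuffle_sign S T * shuffle_sign S T'"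
proof -
  have eq: "{(i, j). i \<in> S \<and> j \<in> T \<union> T' \<and> j < i}
      = {(i, j). i \<in> S \<and> j \<in> T \<and> j < i} \<union> {(i, j). i \<in> S \<and> j \<in> T' \<and> j < i}" by auto
  have fin: "finite {(i, j). i \<in> S \<and> j \<in> A \<and> j < i}" if "finite A" for A
    by (rule finite_subset[of _ "S \<times> A"]) (use that assms in auto)
  show ?thesis
    unfolding shuffle_sign_def eq
    by (subst card_Un_disjoint) (use assms fin in \<open>auto simp: power_add\<close>)
qed

lemma wedge_infinite: "infinite U \<Longrightarrow> wedge \<alpha> \<beta> U = 0"
  by (simp add: wedge_def)

lemma wedge_assoc: "wedge (wedge \<alpha> \<beta>) \<gamma> = wedge \<alpha> (wedge \<beta> \<gamma>)"
proof
  fix U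
  show "wedge (wedge \<alpha> \<beta>) \<gamma> U = wedge \<alpha> (wedge \<beta> \<gamma>) U"
  proof (cases "finite U")
    case fU: True
    let ?s = shuffle_sign
    have "wedge (wedge \<alpha> \<beta>) \<gamma> U = (\<Sum>(S, T)\<in>Sigma (Pow U) Pow.
        ?s S (U - S) * ?s T (S - T) * \<alpha> T * \<beta> (S - T) * \<gamma> (U - S))"
      unfolding wedge_def sum_distrib_left sum_distrib_right
      by (subst sum.Sigma) (use fU in \<open>auto simp: algebra_simps intro: finite_subset\<close>)
    also have "\<dots> = (\<Sum>(T, R)\<in>Sigma (Pow U) (\<lambda>T. Pow (U - T)).
        ?s T (U - T) * ?s R (U - T - R) * \<alpha> T * \<beta> R * \<gamma> (U - T - R))"
    proof (rule sum.reindex_bij_witness[where i = "\<lambda>(T, R). (T \<union> R, T)"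
            and j = "\<lambda>(S, T). (T, S - T)"], goal_cases)
      case (5 ST)
      obtain S T where ST: "ST = (S, T)" "S \<subseteq> U" "T \<subseteq> S" using 5 by auto
      let ?R = "S - T" and ?Q = "U - S"
      have fin: "finite T" "finite ?R" "finite ?Q"
        using fU ST by (auto intro: finite_subset)
      have eqs: "T \<union> ?R = S" "?R \<union> ?Q = U - T" "U - T - ?R = ?Q" using ST by auto
      have "?s S ?Q = ?s T ?Q * ?s ?R ?Q"
        using shuffle_sign_Un_left[of T ?R ?Q] fin unfolding eqs by auto
      moreover have "?s T (U - T) = ?s T ?R * ?s T ?Q"
        using shuffle_sign_Un_right[of T ?R ?Q] fin unfolding eqs by auto
      ultimately show ?case
        by (simp add: ST(1) eqs(3))
    qed auto
    also have "\<dots> = wedge \<alpha> (wedge \<beta> \<gamma>) U"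
      unfolding wedge_def sum_distrib_left sum_distrib_right
      by (subst sum.Sigma) (use fU in \<open>auto simp: algebra_simps intro: finite_subset\<close>)
    finally show ?thesis .
  qed (simp add: wedge_infinite)
qed


lemma wedge_mono_empty_left: "\<alpha> U = 0 \<or> finite U \<Longrightarrow> wedge (ext_mono {}) \<alpha> U = \<alpha> U"
proof (cases "finite U")
  case True
  have "wedge (ext_mono {}) \<alpha> U = (\<Sum>S\<in>Pow U. if S = {} then \<alpha> U else 0)"
    unfolding wedge_def by (intro sum.cong) (auto simp: ext_mono_def)
  then show ?thesis using True by (simp add: sum.delta)
qed (simp add: wedge_infinite)

lemma wedge_mono_empty_right: "\<alpha> U = 0 \<or> finite U \<Longrightarrow> wedge \<alpha> (ext_mono {}) U = \<alpha> U"
proof (cases "finite U")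
  case True
  have "wedge \<alpha> (ext_mono {}) U = (\<Sum>S\<in>Pow U. if S = U then \<alpha> U else 0)"
    unfolding wedge_def by (intro sum.cong) (auto simp: ext_mono_def)
  then show ?thesis using True by (simp add: sum.delta)
qed (simp add: wedge_infinite)

lemma ext_alg_one_wedge:
  assumes "\<alpha> \<in> carrier (ext_alg m)"
  shows "wedge (ext_mono {}) \<alpha> = \<alpha>" "wedge \<alpha> (ext_mono {}) = \<alpha>"
proof -
  have "\<alpha> U = 0 \<or> finite U" for U
    using assms finite_subset[of U "{..<m}"] by (auto simp: ext_alg_def)
  then show "wedge (ext_mono {}) \<alpha> = \<alpha>" "wedge \<alpha> (ext_mono {}) = \<alpha>"
    by (auto intro!: ext wedge_mono_empty_left wedge_mono_empty_right)
qed

lemma wedge_add_left: "wedge (\<lambda>S. \<alpha> S + \<beta> S) \<gamma> = (\<lambda>S. wedge \<alpha> \<gamma> S + wedge \<beta> \<gamma> S)"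
  by (simp add: wedge_def distrib_left distrib_right sum.distrib)

lemma wedge_add_right: "wedge \<gamma> (\<lambda>S. \<alpha> S + \<beta> S) = (\<lambda>S. wedge \<gamma> \<alpha> S + wedge \<gamma> \<beta> S)"
  by (simp add: wedge_def distrib_left distrib_right sum.distrib)

lemma wedge_closed:
  assumes "\<alpha> \<in> carrier (ext_alg m)" "\<beta> \<in> carrier (ext_alg m)"
  shows "wedge \<alpha> \<beta> \<in> carrier (ext_alg m)"
proof -
  have "shuffle_sign S (U - S) * \<alpha> S * \<beta> (U - S) = 0" if "\<not> U \<subseteq> {..<m}" "S \<subseteq> U" for S U
  proof (cases "S \<subseteq> {..<m}")
    case True
    then have "\<not> U - S \<subseteq> {..<m}" using that by blast
    then show ?thesis using assms by (simp add: ext_alg_def)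
  qed (use assms in \<open>simp add: ext_alg_def\<close>)
  then have "wedge \<alpha> \<beta> U = 0" if "\<not> U \<subseteq> {..<m}" for U
    unfolding wedge_def using that by (intro sum.neutral) blast
  then show ?thesis by (simp add: ext_alg_def)
qed

lemma ext_alg_vectorspace: "vectorspace complex_field (ext_alg m)"
  by (rule vectorspace_funI) (auto simp: ext_alg_def)

lemma ext_alg_ring: "Ring.ring (ext_alg m)"
proof (rule ringI)
  interpret vectorspace complex_field "ext_alg m" by (rule ext_alg_vectorspace)
  show "abelian_group (ext_alg m)" by (rule M.abelian_group_axioms)
  show "Group.monoid (ext_alg m)"
  proof (rule monoidI)
    show "\<one>\<^bsub>ext_alg m\<^esub> \<in> carrier (ext_alg m)"
      by (auto simp: ext_alg_def ext_mono_def)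
  qed (use wedge_closed wedge_assoc ext_alg_one_wedge in \<open>auto simp: ext_alg_def\<close>)
qed (simp_all add: ext_alg_def wedge_add_left wedge_add_right)

lemma wedge_mono_gen:
  assumes "finite S" "\<forall>j\<in>S. i < j"
  shows "wedge (ext_gen i) (ext_mono S) = ext_mono (insert i S)"
proof
  fix U
  show "wedge (ext_gen i) (ext_mono S) U = ext_mono (insert i S) U"
  proof (cases "finite U")
    case True
    have ss: "shuffle_sign {i} S = 1"
    proof -
      have "\<not> j < i" if "j \<in> S" for j
        using bspec[OF assms(2) that] by simp
      then have "{(k, j). k \<in> {i} \<and> j \<in> S \<and> j < k} = {}" by blast
      then show ?thesis unfolding shuffle_sign_def by (metis card.empty power_0)
    qed
    have "wedge (ext_gen i) (ext_mono S) U
        = (\<Sum>R\<in>Pow U. if R = {i} then ext_mono (insert i S) U else 0)"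
      unfolding wedge_def
    proof (rule sum.cong)
      fix R assume "R \<in> Pow U"
      have "U - {i} = S \<longleftrightarrow> U = insert i S" if "R = {i}"
        using that \<open>R \<in> Pow U\<close> assms by blast
      moreover have "insert i S - {i} = S" using assms by blast
      ultimately show "shuffle_sign R (U - R) * ext_gen i R * ext_mono S (U - R)
          = (if R = {i} then ext_mono (insert i S) U else 0)"
        using ss by (simp add: ext_mono_def)
    qed simp
    also have "\<dots> = (if {i} \<in> Pow U then ext_mono (insert i S) U else 0)"
      using True by (simp add: sum.delta)
    also have "\<dots> = ext_mono (insert i S) U"
      by (auto simp: ext_mono_def)
    finally show ?thesis .
  next
    case False
    then have "U \<noteq> insert i S" using assms by auto
    with False show ?thesis by (auto simp: wedge_infinite ext_mono_def)
  qed
qed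

lemma wedge_list_gens:
  assumes "sorted_wrt (<) js"
  shows "wedge_list (map ext_gen js) = ext_mono (set js)"
  using assms by (induction js) (auto simp: wedge_list_def wedge_mono_gen)

lemma wedge_gen_self: "wedge (ext_gen i) (ext_gen i) = (\<lambda>_. 0)"
  unfolding wedge_def by (intro ext sum.neutral) (auto simp: ext_mono_def)

lemma wedge_gen_anticomm: "wedge (ext_gen j) (ext_gen i) = (\<lambda>S. - wedge (ext_gen i) (ext_gen j) S)"
proof -
  have *: "wedge (ext_gen j) (ext_gen i) = (\<lambda>S. - ext_mono {i, j} S)" if "i < j" for i j
  proof
    fix U
    have ss: "shuffle_sign {j} {i} = -1"
    proof -
      have "{(k, l). k \<in> {j} \<and> l \<in> {i} \<and> l < k} = {(j, i)}" using that by blast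
      then have "card {(k, l). k \<in> {j} \<and> l \<in> {i} \<and> l < k} = 1" by simp
      then show ?thesis unfolding shuffle_sign_def by (metis power_one_right)
    qed
    show "wedge (ext_gen j) (ext_gen i) U = - ext_mono {i, j} U"
    proof (cases "finite U")
      case True
      have "wedge (ext_gen j) (ext_gen i) U
          = (\<Sum>R\<in>Pow U. if R = {j} then - ext_mono {i, j} U else 0)"
        unfolding wedge_def
      proof (rule sum.cong)
        fix R assume "R \<in> Pow U"
        have "U - {j} = {i} \<longleftrightarrow> U = {i, j}" if "R = {j}"
          using that \<open>R \<in> Pow U\<close> \<open>i < j\<close> by blast
        moreover have "{i, j} - {j} = {i}" using \<open>i < j\<close> by blast
        ultimately show "shuffle_sign R (U - R) * ext_gen j R * ext_gen i (U - R)
            = (if R = {j} then - ext_mono {i, j} U else 0)"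
          using ss by (simp add: ext_mono_def)
      qed simp
      also have "\<dots> = (if {j} \<in> Pow U then - ext_mono {i, j} U else 0)"
        using True by (simp add: sum.delta)
      also have "\<dots> = - ext_mono {i, j} U"
        by (auto simp: ext_mono_def)
      finally show ?thesis .
    next
      case False
      then have "U \<noteq> {i, j}" by auto
      with False show ?thesis by (auto simp: wedge_infinite ext_mono_def)
    qed
  qed
  show ?thesis
  proof (cases i j rule: linorder_cases)
    case less
    then show ?thesis using *[OF less] wedge_mono_gen[of "{j}" i] by auto
  next
    case equal
    then show ?thesis by (simp add: wedge_gen_self)
  next
    case greater
    then show ?thesis using *[OF greater] wedge_mono_gen[of "{i}" j] by auto
  qed
qed

lemma ext_boundary_one: "ext_boundary m (ext_mono {}) = (\<lambda>_. 0)"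
  by (auto simp: ext_boundary_def ext_mono_def)

lemma ext_boundary_gen:
  assumes "i < m"
  shows "ext_boundary m (ext_gen i) = ext_mono {}"
proof
  fix U
  have "ext_boundary m (ext_gen i) U = (\<Sum>k\<in>{..<m} - U. if k = i then ext_mono {} U else 0)"
    unfolding ext_boundary_def by (intro sum.cong) (auto simp: ext_mono_def)
  also have "\<dots> = (if i \<in> {..<m} - U then ext_mono {} U else 0)"
    by (simp add: sum.delta)
  also have "\<dots> = ext_mono {} U"
    using assms by (auto simp: ext_mono_def)
  finally show "ext_boundary m (ext_gen i) U = ext_mono {} U" .
qed

lemma ext_boundary_lin:
  "ext_boundary m (\<lambda>S. a * \<alpha> S + b * \<beta> S)
     = (\<lambda>S. a * ext_boundary m \<alpha> S + b * ext_boundary m \<beta> S)"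
  by (simp add: ext_boundary_def distrib_left sum.distrib sum_distrib_left mult.left_commute)


lemma shuffle_sign_singleton: "shuffle_sign {i} U = (-1) ^ card {j \<in> U. j < i}"
proof -
  have "{(k, j). k \<in> {i} \<and> j \<in> U \<and> j < k} = Pair i ` {j \<in> U. j < i}" by auto
  then have "card {(k, j). k \<in> {i} \<and> j \<in> U \<and> j < k} = card (Pair i ` {j \<in> U. j < i})"
    by (rule arg_cong)
  also have "\<dots> = card {j \<in> U. j < i}" by (rule card_image) (simp add: inj_on_def)
  finally show ?thesis by (simp only: shuffle_sign_def)
qed

lemma shuffle_sign_swap:
  assumes "finite T" "i \<notin> T"
  shows "shuffle_sign {i} T * shuffle_sign T {i} = (-1) ^ card T"
proof -
  have "{(k, j). k \<in> T \<and> j \<in> {i} \<and> j < k} = (\<lambda>k. (k, i)) ` {j \<in> T. i < j}" by auto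
  then have "card {(k, j). k \<in> T \<and> j \<in> {i} \<and> j < k} = card ((\<lambda>k. (k, i)) ` {j \<in> T. i < j})"
    by (rule arg_cong)
  also have "\<dots> = card {j \<in> T. i < j}" by (rule card_image) (simp add: inj_on_def)
  finally have r: "shuffle_sign T {i} = (-1) ^ card {j \<in> T. i < j}" by (simp only: shuffle_sign_def)
  have "T = {j \<in> T. j < i} \<union> {j \<in> T. i < j}"
  proof -
    have "j < i \<or> i < j" if "j \<in> T" for j using assms(2) that by (cases i j rule: linorder_cases) auto
    then show ?thesis by blast
  qed
  then have "card T = card ({j \<in> T. j < i} \<union> {j \<in> T. i < j})" by (rule arg_cong)
  also have "\<dots> = card {j \<in> T. j < i} + card {j \<in> T. i < j}"
  proof (rule card_Un_disjoint)
    have "\<not> (j < i \<and> i < j)" for j by simp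
    then show "{j \<in> T. j < i} \<inter> {j \<in> T. i < j} = {}" by blast
  qed (simp_all only: finite_Collect_conjI assms(1) Collect_mem_eq simp_thms)
  finally show ?thesis unfolding r shuffle_sign_singleton by (simp only: power_add)
qed

lemma ext_boundary_wedge:
  assumes deg: "\<alpha> \<in> ext_degree m p"
  shows "ext_boundary m (wedge \<alpha> \<beta>)
    = (\<lambda>U. wedge (ext_boundary m \<alpha>) \<beta> U + (-1) ^ p * wedge \<alpha> (ext_boundary m \<beta>) U)"
proof
  fix U
  let ?s = shuffle_sign and ?N = "{..<m}"
  show "ext_boundary m (wedge \<alpha> \<beta>) U
    = wedge (ext_boundary m \<alpha>) \<beta> U + (-1) ^ p * wedge \<alpha> (ext_boundary m \<beta>) U"
  proof (cases "finite U")
    case False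
    then show ?thesis by (simp add: wedge_infinite ext_boundary_def)
  next
    case fU: True
    have fin: "finite T" if "T \<subseteq> U" for T using fU that by (rule finite_subset[rotated])
    have cardp: "card S = p" if "\<alpha> S \<noteq> 0" for S
      using deg that by (auto simp: ext_degree_def)
    define F where "F i T = ?s T (U - T) * ?s {i} T * \<alpha> (insert i T) * \<beta> (U - T)" for i T
    define G where "G i S = (-1) ^ p * ?s S (U - S) * ?s {i} (U - S) * \<alpha> S * \<beta> (insert i (U - S))"
      for i S
    have L1: "wedge (ext_boundary m \<alpha>) \<beta> U = (\<Sum>T\<in>Pow U. \<Sum>i\<in>?N - T. F i T)"
      by (simp add: wedge_def ext_boundary_def F_def shuffle_sign_singleton
          sum_distrib_left sum_distrib_right mult.assoc)
    have L2: "(-1) ^ p * wedge \<alpha> (ext_boundary m \<beta>) U = (\<Sum>S\<in>Pow U. \<Sum>i\<in>?N - (U - S). G i S)"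
      by (simp add: wedge_def ext_boundary_def G_def shuffle_sign_singleton
          sum_distrib_left sum_distrib_right mult.assoc mult.left_commute)
    have L3: "ext_boundary m (wedge \<alpha> \<beta>) U = (\<Sum>i\<in>?N - U. (\<Sum>T\<in>Pow U. F i T + G i T))"
    proof -
      have "?s {i} U * wedge \<alpha> \<beta> (insert i U) = (\<Sum>T\<in>Pow U. F i T + G i T)"
        if i: "i \<in> ?N - U" for i
      proof -
        let ?t = "\<lambda>S. ?s {i} U * (?s S (insert i U - S) * \<alpha> S * \<beta> (insert i U - S))"
        have inj: "inj_on (insert i) (Pow U)" using i by (auto simp: inj_on_def)
        have "?s {i} U * wedge \<alpha> \<beta> (insert i U) = (\<Sum>S\<in>Pow (insert i U). ?t S)"
          by (simp add: wedge_def sum_distrib_left)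
        also have "\<dots> = (\<Sum>S\<in>Pow U. ?t S) + (\<Sum>S\<in>insert i ` Pow U. ?t S)"
          unfolding Pow_insert by (rule sum.union_disjoint) (use fU i in auto)
        also have "(\<Sum>S\<in>insert i ` Pow U. ?t S) = (\<Sum>T\<in>Pow U. ?t (insert i T))"
          using sum.reindex[OF inj, of ?t] by (simp only: o_def)
        also have "(\<Sum>T\<in>Pow U. ?t (insert i T)) = (\<Sum>T\<in>Pow U. F i T)"
        proof (rule sum.cong)
          fix T assume T: "T \<in> Pow U"
          have e: "insert i U - insert i T = U - T" using i T by auto
          have d: "T \<union> (U - T) = U" using T by auto
          have a: "?s (insert i T) (U - T) = ?s {i} (U - T) * ?s T (U - T)"
            using shuffle_sign_Un_left[of "{i}" T "U - T"] fin T fU i by auto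
          have b: "?s {i} U = ?s {i} T * ?s {i} (U - T)"
            using shuffle_sign_Un_right[of "{i}" T "U - T", unfolded d] fin T fU by auto
          have c: "?s {i} (U - T) * ?s {i} (U - T) = 1" by (rule shuffle_sign_sq)
          have "?t (insert i T) = (?s {i} (U - T) * ?s {i} (U - T)) * F i T"
            unfolding e a b F_def by (simp only: ac_simps)
          then show "?t (insert i T) = F i T" by (simp only: c mult_1)
        qed simp
        also have "(\<Sum>S\<in>Pow U. ?t S) = (\<Sum>S\<in>Pow U. G i S)"
        proof (rule sum.cong)
          fix S assume S: "S \<in> Pow U"
          show "?t S = G i S"
          proof (cases "\<alpha> S = 0")
            case False
            have e: "insert i U - S = insert i (U - S)" using i S by auto
            have d: "S \<union> (U - S) = U" using S by auto
            have fS: "finite S" "finite (U - S)" and iS: "i \<notin> S" using S fin fU i by auto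
            have a: "?s S (insert i (U - S)) = ?s S {i} * ?s S (U - S)"
              using shuffle_sign_Un_right[of S "{i}" "U - S"] fS i by auto
            have b: "?s {i} U = ?s {i} S * ?s {i} (U - S)"
              using shuffle_sign_Un_right[of "{i}" S "U - S", unfolded d] fS by auto
            have c: "?s {i} S * ?s S {i} = (-1) ^ p"
              using shuffle_sign_swap[OF fS(1) iS] cardp[OF False] by simp
            have "?t S = (?s {i} S * ?s S {i}) * (?s S (U - S) * ?s {i} (U - S) * \<alpha> S * \<beta> (insert i (U - S)))"
              unfolding e a b by (simp only: ac_simps)
            then show ?thesis unfolding c G_def by (simp only: ac_simps)
          qed (simp add: G_def)
        qed simp
        finally show ?thesis by (simp add: sum.distrib)
      qed
      then show ?thesis
        by (simp add: ext_boundary_def shuffle_sign_singleton)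
    qed
    have cancel: "(\<Sum>T\<in>Pow U. \<Sum>i\<in>?N \<inter> (U - T). F i T) = - (\<Sum>S\<in>Pow U. \<Sum>i\<in>?N \<inter> S. G i S)"
    proof -
      have "(\<Sum>T\<in>Pow U. \<Sum>i\<in>?N \<inter> (U - T). F i T)
          = (\<Sum>(T, i)\<in>Sigma (Pow U) (\<lambda>T. ?N \<inter> (U - T)). F i T)"
        by (rule sum.Sigma) (use fU in auto)
      also have "\<dots> = (\<Sum>(S, i)\<in>Sigma (Pow U) (\<lambda>S. ?N \<inter> S). - G i S)"
      proof (rule sum.reindex_bij_witness[where i = "\<lambda>(S, i). (S - {i}, i)"
            and j = "\<lambda>(T, i). (insert i T, i)"], goal_cases)
        case (5 Ti)
        obtain T i where Ti: "Ti = (T, i)" "T \<subseteq> U" "i \<in> U" "i \<notin> T" using 5 by auto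
        have "G i (insert i T) = - F i T"
        proof (cases "\<alpha> (insert i T) = 0")
          case False
          define Q where "Q = U - insert i T"
          have Q: "U - T = insert i Q" "U - insert i T = Q" "insert i Q = U - T" "i \<notin> Q"
            using Ti by (auto simp: Q_def)
          have fT: "finite T" and fQ: "finite Q" using Ti fU fin by (auto simp: Q_def)
          have p: "p = Suc (card T)" using cardp[OF False] Ti fT by simp
          have a: "?s T (insert i Q) = ?s T {i} * ?s T Q"
            using shuffle_sign_Un_right[of T "{i}" Q] fT fQ Q(4) by auto
          have b: "?s (insert i T) Q = ?s {i} Q * ?s T Q"
            using shuffle_sign_Un_left[of "{i}" T Q] fT fQ Ti by auto
          have c: "?s {i} T * ?s T {i} = (-1) ^ card T"
            using shuffle_sign_swap[OF fT Ti(4)] .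
          have d: "?s {i} Q * ?s {i} Q = 1" by (rule shuffle_sign_sq)
          have "F i T = (?s {i} T * ?s T {i}) * (?s T Q * \<alpha> (insert i T) * \<beta> (insert i Q))"
            unfolding F_def Q(1) a by (simp only: ac_simps)
          moreover have "G i (insert i T)
              = (-1) ^ p * ((?s {i} Q * ?s {i} Q) * (?s T Q * \<alpha> (insert i T) * \<beta> (insert i Q)))"
            unfolding G_def Q(2) b by (simp only: ac_simps)
          ultimately show ?thesis by (simp add: c d p)
        qed (simp add: F_def G_def)
        then show ?case by (simp add: Ti(1))
      qed auto
      also have "\<dots> = (\<Sum>S\<in>Pow U. \<Sum>i\<in>?N \<inter> S. - G i S)"
        by (rule sum.Sigma[symmetric]) (use fU in auto)
      finally show ?thesis by (simp add: sum_negf)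
    qed
    have s1: "(\<Sum>i\<in>?N - T. F i T) = (\<Sum>i\<in>?N - U. F i T) + (\<Sum>i\<in>?N \<inter> (U - T). F i T)"
      if "T \<in> Pow U" for T
    proof -
      have "?N - T = (?N - U) \<union> (?N \<inter> (U - T))" using that by auto
      then show ?thesis by (simp only:) (rule sum.union_disjoint, auto)
    qed
    have s2: "(\<Sum>i\<in>?N - (U - S). G i S) = (\<Sum>i\<in>?N - U. G i S) + (\<Sum>i\<in>?N \<inter> S. G i S)"
      if "S \<in> Pow U" for S
    proof -
      have "?N - (U - S) = (?N - U) \<union> (?N \<inter> S)" using that by auto
      then show ?thesis by (simp only:) (rule sum.union_disjoint, use that in auto)
    qed
    have "wedge (ext_boundary m \<alpha>) \<beta> U + (-1) ^ p * wedge \<alpha> (ext_boundary m \<beta>) U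
        = (\<Sum>T\<in>Pow U. \<Sum>i\<in>?N - U. F i T) + (\<Sum>T\<in>Pow U. \<Sum>i\<in>?N - U. G i T)"
      unfolding L1 L2 using cancel by (simp add: s1 s2 sum.distrib)
    also have "\<dots> = ext_boundary m (wedge \<alpha> \<beta>) U"
      unfolding L3 by (simp add: sum.distrib) (metis (no_types) sum.swap)
    finally show ?thesis by simp
  qed
qed

lemma ext_boundary_closed:
  "\<alpha> \<in> carrier (ext_alg m) \<Longrightarrow> ext_boundary m \<alpha> \<in> carrier (ext_alg m)"
  by (auto simp: ext_alg_def ext_boundary_def intro!: sum.neutral)

subsection \<open>The Orlik--Solomon algebra\<close>

lemma OS_relations_closed: "OS_relations ls \<subseteq> carrier (ext_alg (length ls))"
proof -
  have "wedge_list (map ext_gen (lines_through ls p)) \<in> carrier (ext_alg (length ls))" for p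
  proof -
    have "sorted_wrt (<) (lines_through ls p)"
      unfolding lines_through_def by (rule sorted_wrt_filter) (rule sorted_wrt_upt)
    then have "wedge_list (map ext_gen (lines_through ls p)) = ext_mono (set (lines_through ls p))"
      by (rule wedge_list_gens)
    then show ?thesis by (auto simp: ext_alg_def ext_mono_def lines_through_def)
  qed
  then show ?thesis by (auto simp: OS_relations_def intro: ext_boundary_closed)
qed

lemma OS_ideal_ideal: "ideal (OS_ideal ls) (ext_alg (length ls))"
  unfolding OS_ideal_def by (rule ring.genideal_ideal[OF ext_alg_ring OS_relations_closed])

lemma OS_ideal_submodule:
  "LinearCombinations.submodule complex_field (OS_ideal ls) (ext_alg (length ls))"
proof -
  let ?E = "ext_alg (length ls)"
  interpret E: vectorspace complex_field ?E by (rule ext_alg_vectorspace)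
  interpret I: ideal "OS_ideal ls" ?E by (rule OS_ideal_ideal)
  have sm: "(\<lambda>S. c * \<alpha> S) \<in> OS_ideal ls" if a: "\<alpha> \<in> OS_ideal ls" for c \<alpha>
  proof -
    have "(\<lambda>S. c * ext_mono {} S) \<in> carrier ?E"
      by (auto simp: ext_alg_def ext_mono_def)
    then have "wedge (\<lambda>S. c * ext_mono {} S) \<alpha> \<in> OS_ideal ls"
      using I.I_l_closed[OF a] by (simp add: ext_alg_def)
    moreover have "wedge (\<lambda>S. c * ext_mono {} S) \<alpha> = (\<lambda>U. c * wedge (ext_mono {}) \<alpha> U)"
      by (simp add: wedge_def sum_distrib_left mult.assoc mult.left_commute)
    moreover have "wedge (ext_mono {}) \<alpha> = \<alpha>"
      using ext_alg_one_wedge(1) I.a_Hcarr[OF a] by blast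
    ultimately show ?thesis by simp
  qed
  show ?thesis
    unfolding submodule_def
    using E.module_axioms I.a_subset I.zero_closed I.a_closed sm
    by (auto simp: ext_alg_def)
qed

lemma OS_alg_vectorspace: "vectorspace complex_field (OS_alg ls)"
  unfolding OS_alg_def by (rule quot_module_vectorspace(1)[OF ext_alg_vectorspace OS_ideal_submodule])

lemma OS_part_vectorspace: "vectorspace complex_field (OS_part ls p)"
proof -
  let ?E = "ext_alg (length ls)" and ?I = "OS_ideal ls"
  let ?D = "ext_degree (length ls) p"
  note q = quot_module_vectorspace[OF ext_alg_vectorspace OS_ideal_submodule[of ls],
      folded OS_alg_def]
  interpret V: vectorspace complex_field "OS_alg ls" by (rule q(1))
  have DE: "x \<in> carrier ?E" if "x \<in> ?D" for x using that by (simp add: ext_degree_def)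
  have D: "\<zero>\<^bsub>?E\<^esub> \<in> ?D" "\<And>x y. x \<in> ?D \<Longrightarrow> y \<in> ?D \<Longrightarrow> x \<oplus>\<^bsub>?E\<^esub> y \<in> ?D"
    "\<And>c x. x \<in> ?D \<Longrightarrow> c \<odot>\<^bsub>?E\<^esub> x \<in> ?D"
    by (auto simp: ext_degree_def ext_alg_def)
  have "LinearCombinations.submodule complex_field ((\<lambda>\<alpha>. ?I +>\<^bsub>?E\<^esub> \<alpha>) ` ?D) (OS_alg ls)"
    unfolding submodule_def
    using V.module_axioms q(2-5) D DE by (auto intro!: image_eqI)
  then have "Module.module complex_field (OS_part ls p)"
    unfolding OS_part_def by (rule V.submodule_is_module)
  then show ?thesis
    by (simp add: vectorspace_def class_field.field_axioms)
qed

end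

theory Submission
  imports Defs "HOL-Library.Function_Algebras"
begin

text \<open>
  The defect is a difference of two dimensions, and each of them changes in an explicit way when
  the line \<open>\<ell>\<^sub>0\<close> is added to the other lines.

  In degree two the ideal is spanned by the relations of the triple points, because the relation of a
  node of multiplicity \<open>k\<close> has degree \<open>k - 1\<close>. These relations are linearly independent, since
  two nodes never share two lines. So \<open>OS\<^sup>2\<close> has dimension \<open>n choose 2\<close> minus the number of triple
  points (\<open>dim_OS_part\<close>). Adding \<open>\<ell>\<^sub>0\<close> raises the binomial coefficient by \<open>n - 1\<close>, which is the
  sum of \<open>m\<^sub>p - 1\<close> over the nodes \<open>p\<close> on \<open>\<ell>\<^sub>0\<close>, as every other line crosses \<open>\<ell>\<^sub>0\<close> exactly once;
  here \<open>m\<^sub>p\<close> is the multiplicity with \<open>\<ell>\<^sub>0\<close> included. The new line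
  turns nodes into triple points where \<open>m\<^sub>p = 3\<close> and destroys triple points where \<open>m\<^sub>p = 4\<close>.

  The second Betti number of the complement grows by the number of nodes on \<open>\<ell>\<^sub>0\<close>
  (\<open>dim_H2_add_line\<close>). Altogether a node on \<open>\<ell>\<^sub>0\<close> contributes \<open>m\<^sub>p - 2\<close> to the change of the defect,
  corrected by \<open>-1\<close> if \<open>m\<^sub>p = 3\<close> and by \<open>+1\<close> if \<open>m\<^sub>p = 4\<close>: nothing for \<open>m\<^sub>p \<le> 3\<close>, then \<open>3\<close>, and
  \<open>m\<^sub>p - 2\<close> from \<open>5\<close> on.

  For the Betti number, let \<open>M'\<close> be the complement of the other lines, let \<open>M = M' - \<ell>\<^sub>0\<close>, and let \<open>N\<close> be a
  tube around \<open>\<ell>\<^sub>0 \<inter> M'\<close>. With \<open>k\<close> nodes on \<open>\<ell>\<^sub>0\<close>, the tube is homotopy equivalent to the plane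
  without \<open>k\<close> points, and \<open>M \<inter> N\<close> to the product of that space with the punctured plane.
  The Mayer--Vietoris sequence of \<open>M' = M \<union> N\<close> is controlled by two facts. The classes of \<open>M\<close> and \<open>N\<close>
  together span \<open>H\<^sup>1(M \<inter> N)\<close>, because an equation of \<open>\<ell>\<^sub>0\<close> is a map from \<open>M\<close> to the punctured plane that winds
  once around \<open>\<ell>\<^sub>0\<close>. And \<open>H\<^sup>3(M') = 0\<close>, which the same sequence propagates
  from \<open>M'\<close> to \<open>M\<close>. What remains of the sequence gives \<open>dim H\<^sup>2(M) = dim H\<^sup>2(M') + k\<close>
  (\<open>HH_remove_line\<close>).

  Since the additive group of the complex numbers is divisible, singular cohomology is the space of
  homomorphisms from singular homology to the complex numbers (\<open>dim_cohomology_space\<close>). This is a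
  space of functions on cycles, with no quotient, so all dimensions can be computed by
  rank-nullity for linear maps between spaces of functions. Divisibility also yields the
  exactness of the Mayer--Vietoris sequence: the maps that it asks for are extended from
  subgroups of the groups of cycles (\<open>additive_extension\<close>).
\<close>

section \<open>Dimensions of spaces of complex functions\<close>

abbreviation cscale :: "complex \<Rightarrow> ('x \<Rightarrow> complex) \<Rightarrow> 'x \<Rightarrow> complex" where
  "cscale c f \<equiv> (\<lambda>x. c * f x)"

interpretation cfun: vector_space "cscale :: complex \<Rightarrow> ('x \<Rightarrow> complex) \<Rightarrow> 'x \<Rightarrow> complex"
  by standard (auto simp: fun_eq_iff algebra_simps)

interpretation cfun_pair: vector_space_pair
  "cscale :: complex \<Rightarrow> ('x \<Rightarrow> complex) \<Rightarrow> 'x \<Rightarrow> complex"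
  "cscale :: complex \<Rightarrow> ('y \<Rightarrow> complex) \<Rightarrow> 'y \<Rightarrow> complex"
  by standard

abbreviation clinear :: "(('x \<Rightarrow> complex) \<Rightarrow> ('y \<Rightarrow> complex)) \<Rightarrow> bool" where
  "clinear \<equiv> Vector_Spaces.linear cscale cscale"

lemma clinearI:
  assumes "\<And>f g. T (\<lambda>x. f x + g x) = (\<lambda>y. T f y + T g y)" "\<And>c f. T (\<lambda>x. c * f x) = (\<lambda>y. c * T f y)"
  shows "clinear T"
  unfolding Vector_Spaces.linear_iff
  using assms by (auto simp: plus_fun_def cfun.vector_space_axioms)

text \<open>A predicate instead of the function \<^const>\<open>cfun.dim\<close>, which assigns \<open>0\<close> to infinite dimensional
  spaces: finiteness is inferred along exact sequences together with the dimension.\<close>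

definition has_dim :: "('x \<Rightarrow> complex) set \<Rightarrow> nat \<Rightarrow> bool" where
  "has_dim S n \<longleftrightarrow> (\<exists>B. finite B \<and> cfun.independent B \<and> cfun.span B = S \<and> card B = n)"

lemma has_dim_subspace: "has_dim S n \<Longrightarrow> cfun.subspace S"
  using cfun.subspace_span by (auto simp: has_dim_def)

lemma has_dim_unique: "has_dim S m \<Longrightarrow> has_dim S n \<Longrightarrow> m = n"
  unfolding has_dim_def by (metis cfun.dim_eq_card)

lemma has_dim_le_subspace:
  assumes "cfun.subspace T" "T \<subseteq> cfun.span C" "finite C"
  shows "\<exists>m\<le>card C. has_dim T m"
proof -
  obtain B where B: "B \<subseteq> T" "cfun.independent B" "T \<subseteq> cfun.span B"
    using cfun.maximal_independent_subset by blast
  have "finite B \<and> card B \<le> card C"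
    using cfun.independent_span_bound[OF assms(3) B(2)] B(1) assms(2) by blast
  moreover have "cfun.span B = T" using cfun.span_subspace[OF B(1,3) assms(1)] .
  ultimately show ?thesis using B(2) by (auto simp: has_dim_def)
qed

lemma has_dim_mono:
  assumes "has_dim S n" "cfun.subspace T" "T \<subseteq> S"
  shows "\<exists>m\<le>n. has_dim T m"
  using has_dim_le_subspace[OF assms(2)] assms by (auto simp: has_dim_def)

lemma has_dim_0: "has_dim {\<lambda>_. 0} 0"
  unfolding has_dim_def by (intro exI[of _ "{}"]) (simp add: zero_fun_def cfun.independent_empty)

lemma has_dim_0_iff: "has_dim S 0 \<longleftrightarrow> S = {\<lambda>_. 0}"
proof
  show "has_dim S 0 \<Longrightarrow> S = {\<lambda>_. 0}" by (auto simp: has_dim_def zero_fun_def)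
qed (simp add: has_dim_0)

text \<open>A basis of the kernel and lifts of a basis of the image form a basis. Finiteness of the
  dimension of \<open>S\<close> is part of the conclusion; this direction propagates it along exact sequences.\<close>

lemma rank_nullity_kernel_image:
  fixes T :: "('x \<Rightarrow> complex) \<Rightarrow> ('y \<Rightarrow> complex)"
  assumes T: "clinear T" and S: "cfun.subspace S"
    and k: "has_dim {f \<in> S. T f = (\<lambda>_. 0)} k" and r: "has_dim (T ` S) r"
  shows "has_dim S (k + r)"
proof -
  obtain B where B: "finite B" "cfun.independent B" "cfun.span B = {f \<in> S. T f = (\<lambda>_. 0)}" "card B = k"
    using k by (auto simp: has_dim_def)
  obtain C where C: "finite C" "cfun.independent C" "cfun.span C = T ` S" "card C = r"
    using r by (auto simp: has_dim_def)
  obtain g where g: "range g \<subseteq> S" "clinear g" "\<And>v. v \<in> T ` S \<Longrightarrow> T (g v) = v"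
    using cfun_pair.linear_exists_right_inverse_on[OF T S] by blast
  interpret T: Vector_Spaces.linear cscale cscale T by (rule T)
  interpret g: Vector_Spaces.linear cscale cscale g by (rule g(2))
  have CT: "T (g c) = c" if "c \<in> C" for c using g(3) C(3) cfun.span_base[OF that] by auto
  have BT: "T b = 0" "b \<in> S" if "b \<in> B" for b
    using B(3) cfun.span_base[OF that] by (auto simp: zero_fun_def)
  have C0: "0 \<notin> C" using C(2) cfun.dependent_zero by blast
  have disj: "B \<inter> g ` C = {}" using BT CT C0 by fastforce
  have inj: "inj_on g C" using CT by (metis inj_onI)
  have indep: "cfun.independent (B \<union> g ` C)"
  proof (rule cfun.independent_if_scalars_zero)
    show "finite (B \<union> g ` C)" using B C by simp
    fix u x assume s: "(\<Sum>x\<in>B \<union> g ` C. cscale (u x) x) = 0" and x: "x \<in> B \<union> g ` C"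
    have e: "(\<Sum>x\<in>B \<union> g ` C. cscale (u x) x)
        = (\<Sum>x\<in>B. cscale (u x) x) + (\<Sum>c\<in>C. cscale (u (g c)) (g c))"
      by (subst sum.union_disjoint) (use B C disj inj in \<open>auto simp: sum.reindex\<close>)
    have "T (\<Sum>x\<in>B. cscale (u x) x) = (\<Sum>x\<in>B. cscale (u x) (T x))"
      by (simp only: T.sum T.scale)
    also have "\<dots> = 0" by (rule sum.neutral) (simp add: BT zero_fun_def)
    finally have "0 = T (\<Sum>c\<in>C. cscale (u (g c)) (g c))"
      using arg_cong[OF s[unfolded e], of T] by (simp only: T.add T.zero add_0_left)
    also have "\<dots> = (\<Sum>c\<in>C. cscale (u (g c)) c)"
      by (simp only: T.sum T.scale) (rule sum.cong, auto simp: CT)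
    finally have z: "(\<Sum>c\<in>C. cscale (u (g c)) c) = 0" by simp
    have uC: "u (g c) = 0" if "c \<in> C" for c
      using cfun.independentD[OF C(2) C(1) subset_refl z that] .
    then have "(\<Sum>c\<in>C. cscale (u (g c)) (g c)) = 0"
      by (intro sum.neutral) (simp add: zero_fun_def)
    then have "(\<Sum>x\<in>B. cscale (u x) x) = 0" using s unfolding e by simp
    then have "u b = 0" if "b \<in> B" for b
      using cfun.independentD[OF B(2) B(1) subset_refl _ that] by blast
    then show "u x = 0" using x uC by blast
  qed
  have "cfun.span (B \<union> g ` C) = S"
  proof (rule cfun.span_subspace[OF _ _ S])
    show "B \<union> g ` C \<subseteq> S" using BT g(1) by auto
    show "S \<subseteq> cfun.span (B \<union> g ` C)"
    proof
      fix s assume s: "s \<in> S"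
      have gs: "g (T s) \<in> cfun.span (g ` C)"
        using s C(3) by (simp add: g.span_image)
      have "s - g (T s) \<in> cfun.span B"
        using s g(1) g(3)[of "T s"] cfun.subspace_diff[OF S, of s "g (T s)"]
        by (auto simp: B(3) T.diff zero_fun_def)
      then have "s - g (T s) + g (T s) \<in> cfun.span (B \<union> g ` C)"
        using gs cfun.span_mono[of B "B \<union> g ` C"] cfun.span_mono[of "g ` C" "B \<union> g ` C"]
        by (intro cfun.span_add) auto
      then show "s \<in> cfun.span (B \<union> g ` C)" by simp
    qed
  qed
  moreover have "card (B \<union> g ` C) = k + r"
    using B C disj inj by (simp add: card_Un_disjoint card_image)
  ultimately show ?thesis
    using B C indep unfolding has_dim_def by (intro exI[of _ "B \<union> g ` C"]) auto
qed

lemma subspace_kernel_on: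
  assumes "clinear T" "cfun.subspace S"
  shows "cfun.subspace {f \<in> S. T f = (\<lambda>_. 0)}"
proof -
  have "cfun.subspace {f. T f = (\<lambda>_. 0)}"
    using cfun_pair.linear_subspace_kernel[OF assms(1)] by (simp add: zero_fun_def)
  then have "cfun.subspace (S \<inter> {f. T f = (\<lambda>_. 0)})"
    using assms(2) by (rule cfun.subspace_inter[rotated])
  then show ?thesis by (simp add: Int_def)
qed

lemma rank_nullity:
  fixes T :: "('x \<Rightarrow> complex) \<Rightarrow> ('y \<Rightarrow> complex)"
  assumes T: "clinear T" and S: "has_dim S n"
  obtains k r where "has_dim {f \<in> S. T f = (\<lambda>_. 0)} k" "has_dim (T ` S) r" "k + r = n"
proof -
  have sS: "cfun.subspace S" using has_dim_subspace[OF S] .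
  obtain k where k: "has_dim {f \<in> S. T f = (\<lambda>_. 0)} k"
    using has_dim_mono[OF S subspace_kernel_on[OF T sS]] by auto
  obtain B where B: "finite B" "cfun.span B = S" using S by (auto simp: has_dim_def)
  have "T ` S = cfun.span (T ` B)"
    using cfun_pair.linear_span_image[OF T, of B] B by simp
  then obtain r where r: "has_dim (T ` S) r"
    using has_dim_le_subspace[OF cfun.subspace_span[of "T ` B"] subset_refl] B(1) by auto
  show ?thesis
    by (rule that[OF k r]) (rule has_dim_unique[OF rank_nullity_kernel_image[OF T sS k r] S])
qed

lemma has_dim_inj_image_iff:
  assumes T: "clinear T" and S: "cfun.subspace S" and inj: "\<And>f. f \<in> S \<Longrightarrow> T f = (\<lambda>_. 0) \<Longrightarrow> f = (\<lambda>_. 0)"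
  shows "has_dim (T ` S) n \<longleftrightarrow> has_dim S n"
proof -
  interpret T: Vector_Spaces.linear cscale cscale T by (rule T)
  have "{f \<in> S. T f = (\<lambda>_. 0)} = {\<lambda>_. 0}"
  proof -
    have "(\<lambda>_. 0) \<in> S" "T (\<lambda>_. 0) = (\<lambda>_. 0)"
      using cfun.subspace_0[OF S] T.zero by (simp_all only: zero_fun_def)
    then show ?thesis using inj by blast
  qed
  then have k: "has_dim {f \<in> S. T f = (\<lambda>_. 0)} 0" by (simp add: has_dim_0)
  show ?thesis
  proof
    show "has_dim (T ` S) n \<Longrightarrow> has_dim S n"
      using rank_nullity_kernel_image[OF T S k] by simp
    assume S': "has_dim S n"
    obtain k' r where "has_dim {f \<in> S. T f = (\<lambda>_. 0)} k'" "has_dim (T ` S) r" "k' + r = n"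
      by (rule rank_nullity[OF T S'])
    then show "has_dim (T ` S) n" using has_dim_unique[OF k, of k'] by simp
  qed
qed

text \<open>Pairs of functions are functions on a sum type, so that products stay within the function spaces
  to which rank-nullity applies.\<close>

abbreviation cfun_prod :: "('x \<Rightarrow> complex) set \<Rightarrow> ('y \<Rightarrow> complex) set \<Rightarrow> ('x + 'y \<Rightarrow> complex) set" where
  "cfun_prod S T \<equiv> {h. (\<lambda>x. h (Inl x)) \<in> S \<and> (\<lambda>y. h (Inr y)) \<in> T}"

lemma subspace_iff:
  "cfun.subspace S \<longleftrightarrow> (\<lambda>_. 0) \<in> S \<and> (\<forall>f\<in>S. \<forall>g\<in>S. (\<lambda>x. f x + g x) \<in> S) \<and> (\<forall>c. \<forall>f\<in>S. (\<lambda>x. c * f x) \<in> S)"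
  unfolding cfun.subspace_def zero_fun_def plus_fun_def by simp

lemma has_dim_prod:
  assumes S: "has_dim S m" and T: "has_dim T n"
  shows "has_dim (cfun_prod S T) (m + n)"
proof -
  let ?p = "\<lambda>h x. h (Inl x)" and ?q = "\<lambda>f. case_sum f (\<lambda>_. 0)"
  let ?q' = "\<lambda>g. case_sum (\<lambda>_. 0) g"
  note sS = has_dim_subspace[OF S, unfolded subspace_iff] and sT = has_dim_subspace[OF T, unfolded subspace_iff]
  have "clinear ?q'" by (rule clinearI) (auto simp: fun_eq_iff split: sum.split)
  then have 1: "has_dim (?q' ` T) n"
    by (subst has_dim_inj_image_iff) (use T has_dim_subspace in \<open>auto simp: fun_eq_iff split: sum.splits\<close>)
  have "{h \<in> cfun_prod S T. ?p h = (\<lambda>_. 0)} = ?q' ` T"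
  proof (intro subset_antisym subsetI)
    fix h assume h: "h \<in> {h \<in> cfun_prod S T. ?p h = (\<lambda>_. 0)}"
    then have "h = ?q' (\<lambda>y. h (Inr y))" by (auto simp: fun_eq_iff split: sum.split)
    then show "h \<in> ?q' ` T" using h by blast
  qed (use sS in auto)
  moreover have "?p ` cfun_prod S T = S"
  proof (intro subset_antisym subsetI)
    fix f assume "f \<in> S"
    then show "f \<in> ?p ` cfun_prod S T"
      using sT by (intro image_eqI[of _ _ "?q f"]) auto
  qed auto
  moreover have "clinear ?p" by (rule clinearI) auto
  moreover have "cfun.subspace (cfun_prod S T)" using sS sT by (auto simp: subspace_iff)
  ultimately show ?thesis
    using rank_nullity_kernel_image[of ?p "cfun_prod S T" n m] 1 S by (simp add: add.commute)
qed

text \<open>By induction on \<open>A\<close>, splitting off one coordinate by an evaluation map.\<close>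

lemma has_dim_coordinate_space:
  assumes "finite A"
  shows "has_dim {f. \<forall>x. x \<notin> A \<longrightarrow> f x = 0} (card A)"
  using assms
proof (induction A)
  case empty
  have "{f. \<forall>x. x \<notin> {} \<longrightarrow> f x = 0} = {\<lambda>_ :: 'a. 0 :: complex}" by auto
  then show ?case by (simp add: has_dim_0)
next
  case (insert a A)
  let ?S = "{f. \<forall>x. x \<notin> insert a A \<longrightarrow> f x = 0} :: ('a \<Rightarrow> complex) set"
  \<comment> \<open>A one-dimensional space is modelled by the functions on a one-point type.\<close>
  let ?T = "\<lambda>(f :: 'a \<Rightarrow> complex) (u :: unit). f a"
  have T: "clinear ?T" by (rule clinearI) auto
  have S: "cfun.subspace ?S" by (auto simp: subspace_iff)
  have k: "{f \<in> ?S. ?T f = (\<lambda>_. 0)} = {f. \<forall>x. x \<notin> A \<longrightarrow> f x = 0}"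
    using insert.hyps by (auto simp: fun_eq_iff)
  have "?T ` ?S = UNIV"
  proof -
    have "g \<in> ?T ` ?S" for g by (rule image_eqI[of _ _ "\<lambda>x. if x = a then g () else 0"]) auto
    then show ?thesis by auto
  qed
  also have "has_dim (UNIV :: (unit \<Rightarrow> complex) set) 1"
  proof -
    have i: "cfun.independent {\<lambda>_::unit. 1 :: complex}"
      unfolding cfun.dependent_single zero_fun_def fun_eq_iff by simp
    have "cfun.span {\<lambda>_::unit. 1 :: complex} = UNIV"
    proof -
      have "g \<in> cfun.span {\<lambda>_::unit. 1 :: complex}" for g
        unfolding cfun.span_singleton by (rule image_eqI[of _ _ "g ()"]) auto
      then show ?thesis by auto
    qed
    then show ?thesis
      unfolding has_dim_def using i by (intro exI[of _ "{\<lambda>_::unit. 1 :: complex}"] conjI) simp_all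
  qed
  finally have r: "has_dim (?T ` ?S) 1" .
  show ?case
    using rank_nullity_kernel_image[OF T S _ r, of "card A"] insert unfolding k by simp
qed

text \<open>This transfers dimensions from the function spaces to vector spaces given by records.\<close>

lemma dim_eq_if_iso_function_space:
  fixes Q :: "(complex, 'q, 'm) module_scheme" and h :: "'q \<Rightarrow> 'x \<Rightarrow> complex"
  assumes Q: "vectorspace complex_field Q"
    and hadd: "\<And>u v. u \<in> carrier Q \<Longrightarrow> v \<in> carrier Q \<Longrightarrow> h (u \<oplus>\<^bsub>Q\<^esub> v) = (\<lambda>x. h u x + h v x)"
    and hsc: "\<And>c u. u \<in> carrier Q \<Longrightarrow> h (c \<odot>\<^bsub>Q\<^esub> u) = (\<lambda>x. c * h u x)"
    and inj: "inj_on h (carrier Q)" and S: "has_dim (h ` carrier Q) n"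
  shows "vectorspace.dim complex_field Q = n"
proof -
  interpret V: vectorspace complex_field Q by (rule Q)
  obtain B where B: "finite B" "cfun.independent B" "cfun.span B = h ` carrier Q" "card B = n"
    using S by (auto simp: has_dim_def)
  define C where "C = inv_into (carrier Q) h ` B"
  have Bh: "b \<in> h ` carrier Q" if "b \<in> B" for b using cfun.span_base[OF that] B(3) by simp
  have CQ: "C \<subseteq> carrier Q" using Bh by (auto simp: C_def inv_into_into)
  have hC: "h ` C = B"
  proof -
    have "h (inv_into (carrier Q) h b) = b" if "b \<in> B" for b using f_inv_into_f[OF Bh[OF that]] .
    then show ?thesis by (force simp: C_def image_image)
  qed
  have fC: "finite C" using B by (simp add: C_def)
  have injC: "inj_on h C" using inj CQ inj_on_subset by blast
  have cardC: "card C = n" using card_image[OF injC] hC B(4) by simp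
  have h0: "h \<zero>\<^bsub>Q\<^esub> = 0"
    using hsc[OF V.M.zero_closed, of 0] V.smult_l_null[OF V.M.zero_closed] by (simp add: zero_fun_def)
  have hlin: "h (V.lincomb a A) = (\<Sum>v\<in>A. cscale (a v) (h v))" if "finite A" "A \<subseteq> carrier Q" for a A
    using that
  proof (induction A)
    case empty
    then show ?case using h0 by (simp add: V.lincomb_def)
  next
    case (insert x A)
    have "V.lincomb a (A \<union> {x}) = (a x \<odot>\<^bsub>Q\<^esub> x) \<oplus>\<^bsub>Q\<^esub> V.lincomb a A"
      by (rule V.lincomb_insert) (use insert in auto)
    moreover have "V.lincomb a A \<in> carrier Q" by (rule V.lincomb_closed) (use insert in auto)
    ultimately show ?case
      using insert by (simp add: hadd hsc plus_fun_def)
  qed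
  have "V.lin_indpt C"
  proof
    assume "V.lin_dep C"
    then obtain a v where a: "V.lincomb a C = \<zero>\<^bsub>Q\<^esub>" "v \<in> C" "a v \<noteq> 0"
      using V.finite_lin_dep[OF fC _ CQ] by auto
    define u where "u b = a (inv_into C h b)" for b
    have "(\<Sum>b\<in>B. cscale (u b) b) = (\<Sum>v\<in>C. cscale (a v) (h v))"
      unfolding hC[symmetric] by (subst sum.reindex[OF injC]) (auto intro!: sum.cong simp: u_def inv_into_f_f[OF injC])
    also have "\<dots> = 0" using hlin[OF fC CQ, of a] a(1) h0 by simp
    finally have "u (h v) = 0"
      using cfun.independentD[OF B(2,1) subset_refl, of u "h v"] hC a(2) by blast
    then show False using a by (simp add: u_def inv_into_f_f[OF injC])
  qed
  moreover have "V.span C = carrier Q"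
  proof (intro subset_antisym subsetI)
    fix x assume "x \<in> V.span C"
    then show "x \<in> carrier Q" using V.span_is_subset2[OF CQ] by blast
  next
    fix x assume x: "x \<in> carrier Q"
    then have "h x \<in> cfun.span B" using B(3) by simp
    then obtain u where "h x = (\<Sum>b\<in>B. cscale (u b) b)"
      unfolding cfun.span_finite[OF B(1)] by auto
    also have "\<dots> = (\<Sum>v\<in>C. cscale (u (h v)) (h v))"
      unfolding hC[symmetric] by (subst sum.reindex[OF injC]) simp
    also have "\<dots> = h (V.lincomb (\<lambda>v. u (h v)) C)" using hlin[OF fC CQ] by simp
    finally have "x = V.lincomb (\<lambda>v. u (h v)) C"
      using inj x V.lincomb_closed[OF CQ, of "\<lambda>v. u (h v)"] by (auto simp: inj_on_def)
    then show "x \<in> V.span C" using fC by (auto simp: V.span_def intro!: exI[of _ "\<lambda>v. u (h v)"] exI[of _ C])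
  qed
  ultimately have "V.basis C" using CQ by (simp add: V.basis_def)
  then show ?thesis using V.dim_basis[OF fC] cardC by simp
qed

lemma dim_quotient_eq:
  fixes Q :: "(complex, 'q, 'm) module_scheme" and q :: "'d \<Rightarrow> 'q" and T :: "'d \<Rightarrow> 'x \<Rightarrow> complex"
  assumes Q: "vectorspace complex_field Q"
    and surj: "q ` D = carrier Q"
    and add: "\<And>a b. a \<in> D \<Longrightarrow> b \<in> D \<Longrightarrow> \<exists>c\<in>D. q c = q a \<oplus>\<^bsub>Q\<^esub> q b \<and> T c = (\<lambda>x. T a x + T b x)"
    and scale: "\<And>k a. a \<in> D \<Longrightarrow> \<exists>c\<in>D. q c = k \<odot>\<^bsub>Q\<^esub> q a \<and> T c = (\<lambda>x. k * T a x)"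
    and ker: "\<And>a b. a \<in> D \<Longrightarrow> b \<in> D \<Longrightarrow> q a = q b \<longleftrightarrow> T a = T b"
    and S: "has_dim (T ` D) n"
  shows "vectorspace.dim complex_field Q = n"
proof (rule dim_eq_if_iso_function_space[OF Q])
  define h where "h u = T (SOME a. a \<in> D \<and> q a = u)" for u
  have h: "h (q a) = T a" if "a \<in> D" for a
  proof -
    have "(SOME b. b \<in> D \<and> q b = q a) \<in> D \<and> q (SOME b. b \<in> D \<and> q b = q a) = q a"
      by (rule someI[of _ a]) (simp add: that)
    then show ?thesis unfolding h_def using ker[OF _ that] by blast
  qed
  show "h (u \<oplus>\<^bsub>Q\<^esub> v) = (\<lambda>x. h u x + h v x)" if "u \<in> carrier Q" "v \<in> carrier Q" for u v
  proof -
    obtain a b where ab: "a \<in> D" "b \<in> D" "u = q a" "v = q b" using \<open>u \<in> carrier Q\<close> \<open>v \<in> carrier Q\<close> surj by blast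
    obtain c where "c \<in> D" "q c = q a \<oplus>\<^bsub>Q\<^esub> q b" "T c = (\<lambda>x. T a x + T b x)" using add ab by blast
    then show ?thesis using h ab by metis
  qed
  show "h (k \<odot>\<^bsub>Q\<^esub> u) = (\<lambda>x. k * h u x)" if "u \<in> carrier Q" for k u
  proof -
    obtain a where a: "a \<in> D" "u = q a" using \<open>u \<in> carrier Q\<close> surj by blast
    obtain c where "c \<in> D" "q c = k \<odot>\<^bsub>Q\<^esub> q a" "T c = (\<lambda>x. k * T a x)" using scale a by blast
    then show ?thesis using h a by metis
  qed
  show "inj_on h (carrier Q)" unfolding surj[symmetric] by (auto simp: inj_on_def h ker)
  have "h ` carrier Q = T ` D" unfolding surj[symmetric] by (auto simp: image_image h)
  then show "has_dim (h ` carrier Q) n" using S by simp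
qed

text \<open>Coordinates on the quotient \<open>D / R\<close>: subtract from a vector its image under a linear projection
  onto \<open>R\<close>.\<close>

lemma quotient_coordinates:
  fixes D :: "('x \<Rightarrow> complex) set"
  assumes D: "has_dim D n" and R: "has_dim R k" "R \<subseteq> D"
  obtains T :: "('x \<Rightarrow> complex) \<Rightarrow> 'x \<Rightarrow> complex" where "clinear T" "\<And>f. f \<in> D \<Longrightarrow> T f = (\<lambda>_. 0) \<longleftrightarrow> f \<in> R" "has_dim (T ` D) (n - k)"
proof -
  have sR: "cfun.subspace R" using has_dim_subspace[OF R(1)] .
  obtain g where g: "range g \<subseteq> R" "clinear g" "\<And>f. f \<in> R \<Longrightarrow> g (id f) = f"
    using cfun_pair.linear_exists_left_inverse_on[OF cfun.linear_id sR inj_on_id] by blast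
  interpret g: Vector_Spaces.linear cscale cscale g by (rule g(2))
  define T where "T f = (\<lambda>x. f x - g f x)" for f
  have T: "clinear T"
  proof (rule clinearI)
    show "T (\<lambda>x. f x + f' x) = (\<lambda>y. T f y + T f' y)" for f f'
      using g.add[of f f'] by (simp add: T_def plus_fun_def fun_eq_iff)
    show "T (\<lambda>x. c * f x) = (\<lambda>y. c * T f y)" for c f
      using g.scale[of c f] by (simp add: T_def fun_eq_iff algebra_simps)
  qed
  have ker: "T f = (\<lambda>_. 0) \<longleftrightarrow> f \<in> R" if "f \<in> D" for f
  proof -
    have "T f = (\<lambda>_. 0) \<longleftrightarrow> g f = f" by (auto simp: T_def fun_eq_iff)
    moreover have "g f \<in> R" using g(1) by blast
    ultimately show ?thesis using g(3)[of f] unfolding id_def by metis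
  qed
  have "{f \<in> D. T f = (\<lambda>_. 0)} = R" using ker R(2) by blast
  moreover obtain k' r where "has_dim {f \<in> D. T f = (\<lambda>_. 0)} k'" "has_dim (T ` D) r" "k' + r = n"
    by (rule rank_nullity[OF T D])
  ultimately have "has_dim (T ` D) (n - k)" using has_dim_unique[OF R(1)] by fastforce
  from that[OF T _ this] ker show ?thesis by blast
qed

text \<open>A linear map whose kernel on \<open>D\<close> is \<open>D \<inter> W\<close> induces an isomorphism from the cosets of elements of
  \<open>D\<close> onto its image. Singular cohomology and the graded parts of the
  Orlik--Solomon algebra are both of this form, with \<open>D\<close> the cocycles and the homogeneous elements.\<close>

lemma dim_space_of_cosets:
  fixes V :: "(complex, 'x \<Rightarrow> complex, 'm) module_scheme" and Q :: "(complex, ('x \<Rightarrow> complex) set) module"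
  assumes V: "vectorspace complex_field V" and [simp]: "zero V = (\<lambda>_. 0)" "add V = (\<lambda>f g x. f x + g x)"
      "smult V = (\<lambda>c f x. c * f x)"
    and W: "LinearCombinations.submodule complex_field W V"
    and D: "cfun.subspace D" "D \<subseteq> carrier V"
    and T: "clinear T" "\<And>f. f \<in> D \<Longrightarrow> T f = (\<lambda>_. 0) \<longleftrightarrow> f \<in> W" "has_dim (T ` D) n"
    and Q: "vectorspace complex_field Q" "carrier Q = (\<lambda>f. W +>\<^bsub>V\<^esub> f) ` D"
      "add Q = add (quot_module V W)" "smult Q = smult (quot_module V W)"
  shows "vectorspace.dim complex_field Q = n"
proof (rule dim_quotient_eq[OF Q(1), where D = D and q = "\<lambda>f. W +>\<^bsub>V\<^esub> f" and T = T])
  interpret T: Vector_Spaces.linear cscale cscale T by (rule T(1))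
  note q = quot_module_vectorspace[OF V W, folded Q(3,4)]
  have Wlin: "(\<lambda>x. w x + k * v x) \<in> W" if "w \<in> W" "v \<in> W" for k w v
    using W that by (simp add: submodule_def)
  have W0: "(\<lambda>_. 0) \<in> W" using W by (simp add: submodule_def)
  have Dadd: "(\<lambda>x. f x + g x) \<in> D" if "f \<in> D" "g \<in> D" for f g
    using D(1) that unfolding subspace_iff by blast
  have Dscale: "(\<lambda>x. k * f x) \<in> D" if "f \<in> D" for k f
    using D(1) that unfolding subspace_iff by blast
  show "(\<lambda>f. W +>\<^bsub>V\<^esub> f) ` D = carrier Q" by (simp add: Q(2))
  show "has_dim (T ` D) n" by (rule T(3))
  show "\<exists>c\<in>D. W +>\<^bsub>V\<^esub> c = (W +>\<^bsub>V\<^esub> a) \<oplus>\<^bsub>Q\<^esub> (W +>\<^bsub>V\<^esub> b) \<and> T c = (\<lambda>x. T a x + T b x)"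
    if ab: "a \<in> D" "b \<in> D" for a b
    using Dadd[OF ab] q(4)[of a b] ab D(2) T.add[of a b]
    by (intro bexI[of _ "\<lambda>x. a x + b x"]) (auto simp: plus_fun_def)
  show "\<exists>c\<in>D. W +>\<^bsub>V\<^esub> c = k \<odot>\<^bsub>Q\<^esub> (W +>\<^bsub>V\<^esub> a) \<and> T c = (\<lambda>x. k * T a x)" if a: "a \<in> D" for k a
    using Dscale[OF a] q(5)[of k a] a D(2) T.scale[of k a]
    by (intro bexI[of _ "\<lambda>x. k * a x"]) auto
  have coset: "W +>\<^bsub>V\<^esub> f = (\<lambda>w x. w x + f x) ` W" for f by (auto simp: a_r_coset_def')
  show "(W +>\<^bsub>V\<^esub> a = W +>\<^bsub>V\<^esub> b) \<longleftrightarrow> T a = T b" if ab: "a \<in> D" "b \<in> D" for a b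
  proof -
    have abD: "a - b \<in> D" by (rule cfun.subspace_diff[OF D(1) ab])
    have "T a = T b \<longleftrightarrow> T (a - b) = (\<lambda>_. 0)" unfolding T.diff by (auto simp: fun_eq_iff)
    also have "\<dots> \<longleftrightarrow> a - b \<in> W" by (rule T(2)[OF abD])
    also have "\<dots> \<longleftrightarrow> W +>\<^bsub>V\<^esub> a = W +>\<^bsub>V\<^esub> b"
    proof
      assume d: "a - b \<in> W"
      have "\<exists>w'\<in>W. (\<lambda>x. w x + a x) = (\<lambda>x. w' x + b x)" if "w \<in> W" for w
        using Wlin[OF that d, of 1] by (intro bexI) auto
      moreover have "\<exists>w'\<in>W. (\<lambda>x. w x + b x) = (\<lambda>x. w' x + a x)" if "w \<in> W" for w
        using Wlin[OF that d, of "-1"] by (intro bexI) auto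
      ultimately show "W +>\<^bsub>V\<^esub> a = W +>\<^bsub>V\<^esub> b" unfolding coset by blast
    next
      assume "W +>\<^bsub>V\<^esub> a = W +>\<^bsub>V\<^esub> b"
      moreover have "a \<in> W +>\<^bsub>V\<^esub> a" unfolding coset by (rule image_eqI[OF _ W0]) auto
      ultimately obtain w where "w \<in> W" "a = (\<lambda>x. w x + b x)" unfolding coset by auto
      then have "a - b = w" by (auto simp: fun_eq_iff)
      then show "a - b \<in> W" using \<open>w \<in> W\<close> by simp
    qed
    finally show ?thesis by blast
  qed
qed

section \<open>Extension of additive functions into the complex numbers\<close>

text \<open>The complex numbers are divisible, hence injective as an abelian group. Zorn's lemma is applied to
  the graphs of additive extensions. To extend a maximal one to a further element \<open>x\<close>, take a positive
  multiple \<open>k x\<close> in its domain, if there is one, and divide its value by \<open>k\<close>; otherwise any value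
  will do.\<close>

lemma additive_extension:
  fixes G :: "'a::ab_group_add set" and f :: "'a \<Rightarrow> complex"
  assumes G: "0 \<in> G" "\<And>x y. x \<in> G \<Longrightarrow> y \<in> G \<Longrightarrow> x - y \<in> G"
    and f: "\<And>x y. x \<in> G \<Longrightarrow> y \<in> G \<Longrightarrow> f (x - y) = f x - f y"
  obtains F where "\<And>x y. F (x - y) = F x - F y" "\<And>x. x \<in> G \<Longrightarrow> F x = f x"
proof -
  define P where "P = {R :: ('a \<times> complex) set. (\<forall>x\<in>G. (x, f x) \<in> R)
    \<and> (\<forall>a w b v. (a, w) \<in> R \<longrightarrow> (b, v) \<in> R \<longrightarrow> (a - b, w - v) \<in> R) \<and> (\<forall>w. (0, w) \<in> R \<longrightarrow> w = 0)}"
  have "\<exists>M\<in>P. \<forall>X\<in>P. M \<subseteq> X \<longrightarrow> X = M"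
  proof (rule subset_Zorn_nonempty)
    have "f 0 = 0" using f[OF G(1) G(1)] by simp
    then have "{(x, f x) |x. x \<in> G} \<in> P" using G f by (auto simp: P_def)
    then show "P \<noteq> {}" by blast
  next
    fix \<C> assume ne: "\<C> \<noteq> {}" and ch: "subset.chain P \<C>"
    have CP: "\<And>R. R \<in> \<C> \<Longrightarrow> R \<in> P" using ch by (auto simp: subset_chain_def)
    have "(a - b, w - v) \<in> \<Union>\<C>" if aw: "(a, w) \<in> \<Union>\<C>" and bv: "(b, v) \<in> \<Union>\<C>" for a b w v
    proof -
      obtain R R' where R: "R \<in> \<C>" "R' \<in> \<C>" "(a, w) \<in> R" "(b, v) \<in> R'" using aw bv by blast
      then have "R \<subseteq> R' \<or> R' \<subseteq> R" using ch by (auto simp: subset_chain_def)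
      then obtain R'' where "R'' \<in> \<C>" "(a, w) \<in> R''" "(b, v) \<in> R''" using R by blast
      moreover from this have "(a - b, w - v) \<in> R''" using CP unfolding P_def by blast
      ultimately show ?thesis by blast
    qed
    moreover have "\<forall>x\<in>G. (x, f x) \<in> \<Union>\<C>" using ne CP by (fastforce simp: P_def)
    moreover have "\<forall>w. (0, w) \<in> \<Union>\<C> \<longrightarrow> w = 0" using CP by (auto simp: P_def)
    ultimately show "\<Union>\<C> \<in> P" unfolding P_def by blast
  qed
  then obtain M where MP: "M \<in> P" and max: "\<And>X. X \<in> P \<Longrightarrow> M \<subseteq> X \<Longrightarrow> X = M" by blast
  have MG: "\<And>x. x \<in> G \<Longrightarrow> (x, f x) \<in> M"
    and Mdiff: "\<And>a w b v. (a, w) \<in> M \<Longrightarrow> (b, v) \<in> M \<Longrightarrow> (a - b, w - v) \<in> M"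
    and M0: "\<And>w. (0, w) \<in> M \<Longrightarrow> w = 0"
    using MP by (auto simp: P_def)
  have M00: "(0, 0) \<in> M" using Mdiff[OF MG[OF G(1)] MG[OF G(1)]] by simp
  have Madd: "(a + b, w + v) \<in> M" if "(a, w) \<in> M" "(b, v) \<in> M" for a b w v
    using Mdiff[OF that(1) Mdiff[OF M00 that(2)]] by simp
  \<comment> \<open>The multiple of \<open>x\<close> by a natural number, as a constant sum.\<close>
  let ?n = "\<lambda>(n::nat) (x::'a). \<Sum>i<n. x"
  have nadd: "?n (m + n) x = ?n m x + ?n n x" for m n x by (induction n) (auto simp: algebra_simps)
  have Mn: "(?n n a, of_nat n * w) \<in> M" if "(a, w) \<in> M" for n a w
  proof (induction n)
    case (Suc n)
    then show ?case using Madd[OF Suc that] by (simp add: algebra_simps)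
  qed (simp add: M00)
  have nmult: "?n m (?n n x) = ?n (m * n) x" for m n x
    by (induction m) (auto simp: nadd[symmetric] add.commute)
  have dom: "\<exists>w. (x, w) \<in> M" for x
  proof (rule ccontr)
    assume x: "\<nexists>w. (x, w) \<in> M"
    obtain z where z: "\<And>n w. (?n n x, w) \<in> M \<Longrightarrow> w = of_nat n * z"
    proof (cases "\<exists>k w. k > 0 \<and> (?n k x, w) \<in> M")
      case True
      then obtain k w where k: "k > 0" "(?n k x, w) \<in> M" by blast
      have "w' = of_nat n * (w / of_nat k)" if "(?n n x, w') \<in> M" for n w'
      proof -
        have "(?n (n * k) x, of_nat n * w) \<in> M" using Mn[OF k(2), of n] by (simp only: nmult)
        moreover have "(?n (n * k) x, of_nat k * w') \<in> M"
          using Mn[OF that, of k] by (simp only: nmult mult.commute)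
        ultimately have "(0, of_nat n * w - of_nat k * w') \<in> M" using Mdiff by fastforce
        then have "of_nat n * w = of_nat k * w'" using M0 by fastforce
        then show ?thesis using k(1) by (simp add: field_simps)
      qed
      then show ?thesis using that by blast
    next
      case False
      then have "n = 0" if "(?n n x, w) \<in> M" for n w using that by (metis gr0I)
      then have "w = of_nat n * 0" if "(?n n x, w) \<in> M" for n w using M0[of w] that by fastforce
      then show ?thesis by (rule that)
    qed
    \<comment> \<open>Integer multiples of \<open>x\<close> are written as differences of natural multiples.\<close>
    define M' where "M' = {(a + ?n n x - ?n m x, w + of_nat n * z - of_nat m * z) |a w n m. (a, w) \<in> M}"
    have MM': "M \<subseteq> M'"
    proof
      fix p assume "p \<in> M"
      then show "p \<in> M'" unfolding M'_def
        by (cases p) (rule CollectI, rule exI[of _ "fst p"], rule exI[of _ "snd p"], rule exI[of _ 0], rule exI[of _ 0], auto)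
    qed
    have "M' \<in> P"
    proof -
      have "(p - q, u - v) \<in> M'" if pq: "(p, u) \<in> M'" "(q, v) \<in> M'" for p q u v
      proof -
        obtain a w n m where p: "p = a + ?n n x - ?n m x" "u = w + of_nat n * z - of_nat m * z" "(a, w) \<in> M"
          using pq(1) unfolding M'_def by blast
        obtain b y k l where q: "q = b + ?n k x - ?n l x" "v = y + of_nat k * z - of_nat l * z" "(b, y) \<in> M"
          using pq(2) unfolding M'_def by blast
        have "p - q = (a - b) + ?n (n + l) x - ?n (m + k) x" unfolding p q nadd by (simp add: algebra_simps)
        moreover have "u - v = (w - y) + of_nat (n + l) * z - of_nat (m + k) * z"
          unfolding p q by (simp add: algebra_simps)
        ultimately show ?thesis using Mdiff[OF p(3) q(3)] unfolding M'_def by blast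
      qed
      moreover have "u = 0" if u: "(0, u) \<in> M'" for u
      proof -
        obtain a w n m where p: "0 = a + ?n n x - ?n m x" "u = w + of_nat n * z - of_nat m * z" "(a, w) \<in> M"
          using u unfolding M'_def by blast
        show ?thesis
        proof (cases "m \<le> n")
          case True
          then obtain d where d: "n = m + d" by (auto simp: le_iff_add)
          have "0 - a = ?n d x" using p(1) unfolding d nadd by (simp add: algebra_simps minus_unique)
          then have "(?n d x, 0 - w) \<in> M" using Mdiff[OF M00 p(3)] by metis
          from z[OF this] have "w = - (of_nat d * z)" by (metis diff_0 minus_minus)
          then show ?thesis unfolding p(2) d by (simp add: algebra_simps)
        next
          case False
          then obtain d where d: "m = n + d" by (metis le_iff_add linear)
          have "a = ?n d x" using p(1) unfolding d nadd by (simp add: algebra_simps)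
          then have "(?n d x, w) \<in> M" using p(3) by simp
          from z[OF this] show ?thesis unfolding p d by (simp add: algebra_simps)
        qed
      qed
      ultimately show ?thesis using MM' MG unfolding P_def by blast
    qed
    then have "M' = M" using max MM' by blast
    moreover have "(0 + ?n 1 x - ?n 0 x, 0 + of_nat 1 * z - of_nat 0 * z) \<in> M'"
      unfolding M'_def using M00 by blast
    ultimately show False using x by auto
  qed
  define F where "F x = (SOME w. (x, w) \<in> M)" for x
  have F: "(x, F x) \<in> M" for x unfolding F_def using dom[of x] by (rule someI_ex)
  have uniq: "w = v" if "(x, w) \<in> M" "(x, v) \<in> M" for x w v using M0 Mdiff[OF that] by fastforce
  show ?thesis
    by (rule that[of F]) (use uniq F Mdiff MG in blast)+
qed

section \<open>Cohomology as the dual of homology\<close>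

abbreviation cycle :: "nat \<Rightarrow> 'a topology \<Rightarrow> 'a chain \<Rightarrow> bool" where
  "cycle p X \<equiv> singular_relcycle p X {}"

abbreviation bdry :: "nat \<Rightarrow> 'a topology \<Rightarrow> 'a chain \<Rightarrow> bool" where
  "bdry p X \<equiv> singular_relboundary p X {}"

text \<open>The homomorphisms from homology to the complex numbers, as functions on cycles that vanish on
  boundaries. They are set to zero off the cycles so that equal homomorphisms are equal functions.\<close>

definition hom_homology :: "nat \<Rightarrow> 'a topology \<Rightarrow> ('a chain \<Rightarrow> complex) set" where
  "hom_homology p X = {g. (\<forall>c. \<not> cycle p X c \<longrightarrow> g c = 0) \<and>
     (\<forall>a b. cycle p X a \<longrightarrow> cycle p X b \<longrightarrow> g (a - b) = g a - g b) \<and>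
     (\<forall>c. bdry p X c \<longrightarrow> g c = 0)}"

lemma
  assumes "g \<in> hom_homology p X"
  shows hom_homology_outside: "\<not> cycle p X c \<Longrightarrow> g c = 0"
    and hom_homology_diff: "cycle p X a \<Longrightarrow> cycle p X b \<Longrightarrow> g (a - b) = g a - g b"
    and hom_homology_bdry: "bdry p X c \<Longrightarrow> g c = 0"
    and hom_homology_0: "g 0 = 0"
    and hom_homology_add: "cycle p X a \<Longrightarrow> cycle p X b \<Longrightarrow> g (a + b) = g a + g b"
    and hom_homology_minus: "cycle p X b \<Longrightarrow> g (- b) = - g b"
proof -
  show "\<not> cycle p X c \<Longrightarrow> g c = 0" "bdry p X c \<Longrightarrow> g c = 0" using assms by (auto simp: hom_homology_def)
  show d: "cycle p X a \<Longrightarrow> cycle p X b \<Longrightarrow> g (a - b) = g a - g b" for a b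
    using assms by (auto simp: hom_homology_def)
  show z: "g 0 = 0" using d[of 0 0] by simp
  show m: "cycle p X b \<Longrightarrow> g (- b) = - g b" for b using d[of 0 b] z by simp
  show "cycle p X a \<Longrightarrow> cycle p X b \<Longrightarrow> g (a + b) = g a + g b"
    using d[of a "- b"] m[of b] by (simp add: singular_relcycle_minus)
qed

text \<open>Homologous cycles have the same value, which is how homotopies and subdivisions act.\<close>

lemma hom_homology_homologous:
  assumes "g \<in> hom_homology p X" "cycle p X a" "bdry p X (a - b)"
  shows "g a = g b"
proof -
  have "cycle p X (a - (a - b))"
    by (rule singular_relcycle_diff[OF assms(2) singular_relboundary_imp_relcycle[OF assms(3)]])
  then show ?thesis using hom_homology_diff[OF assms(1,2), of b] hom_homology_bdry[OF assms(1,3)] by simp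
qed

lemma subspace_hom_homology: "cfun.subspace (hom_homology p X)"
  unfolding subspace_iff hom_homology_def by (auto simp: right_diff_distrib)

text \<open>Since \<^typ>\<open>complex\<close> is divisible, a homomorphism can be prescribed on any group of cycles, as
  long as it kills the boundaries in it.\<close>

lemma hom_homology_extend:
  fixes f :: "'a chain \<Rightarrow> complex"
  assumes G: "0 \<in> G" "\<And>x y. x \<in> G \<Longrightarrow> y \<in> G \<Longrightarrow> x - y \<in> G" "\<And>x. x \<in> G \<Longrightarrow> cycle p X x"
    and f: "\<And>x y. x \<in> G \<Longrightarrow> y \<in> G \<Longrightarrow> f (x - y) = f x - f y"
    and b: "\<And>x. x \<in> G \<Longrightarrow> bdry p X x \<Longrightarrow> f x = 0"
  obtains g where "g \<in> hom_homology p X" "\<And>x. x \<in> G \<Longrightarrow> g x = f x"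
proof -
  define G' where "G' = {y. \<exists>x\<in>G. bdry p X (y - x)}"
  define f' where "f' y = f (SOME x. x \<in> G \<and> bdry p X (y - x))" for y
  have f': "f' y = f x" if "x \<in> G" "bdry p X (y - x)" for x y
  proof -
    let ?x = "SOME x. x \<in> G \<and> bdry p X (y - x)"
    have x: "?x \<in> G \<and> bdry p X (y - ?x)" by (rule someI[of _ x]) (use that in blast)
    have "bdry p X ((y - x) - (y - ?x))" by (rule singular_relboundary_diff[OF that(2) conjunct2[OF x]])
    then have "bdry p X (?x - x)" by simp
    then have "f (?x - x) = 0" using b[OF G(2)] x that(1) by blast
    then show ?thesis using f[of ?x x] x that by (simp add: f'_def)
  qed
  have G'd: "x - y \<in> G' \<and> f' (x - y) = f' x - f' y" if "x \<in> G'" "y \<in> G'" for x y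
  proof -
    obtain u v where uv: "u \<in> G" "bdry p X (x - u)" "v \<in> G" "bdry p X (y - v)"
      using \<open>x \<in> G'\<close> \<open>y \<in> G'\<close> by (auto simp: G'_def)
    have "bdry p X ((x - u) - (y - v))" by (rule singular_relboundary_diff[OF uv(2,4)])
    moreover have "(x - u) - (y - v) = (x - y) - (u - v)" by (simp add: algebra_simps)
    ultimately have bd: "bdry p X ((x - y) - (u - v))" by simp
    have "f' (x - y) = f u - f v" using f'[OF G(2)[OF uv(1,3)] bd] f[OF uv(1,3)] by simp
    moreover have "x - y \<in> G'" unfolding G'_def using G(2)[OF uv(1,3)] bd by blast
    ultimately show ?thesis using f'[OF uv(1,2)] f'[OF uv(3,4)] by simp
  qed
  have GG': "x \<in> G' \<and> f' x = f x" if "x \<in> G" for x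
  proof
    have "bdry p X (x - x)" by simp
    then show "x \<in> G'" unfolding G'_def using that by blast
    show "f' x = f x" by (rule f'[OF that]) simp
  qed
  obtain F where F: "\<And>x y. F (x - y) = F x - F y" "\<And>x. x \<in> G' \<Longrightarrow> F x = f' x"
    by (rule additive_extension[of G' f']) (use GG' G(1) G'd in blast)+
  define g where "g c = (if cycle p X c then F c else 0)" for c
  have "F c = 0" if "bdry p X c" for c
  proof -
    have "bdry p X (c - 0)" using that by simp
    then have c: "c \<in> G'" unfolding G'_def using G(1) by blast
    have "f 0 = 0" using f[OF G(1,1)] by simp
    then show ?thesis using F(2)[OF c] f'[OF G(1), of c] that by simp
  qed
  then have "g \<in> hom_homology p X"
    unfolding hom_homology_def g_def
    using F(1) singular_relcycle_diff singular_relboundary_imp_relcycle by (simp, blast)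
  moreover have "g x = f x" if "x \<in> G" for x using GG'[OF that] F(2) G(3)[OF that] by (simp add: g_def)
  ultimately show ?thesis by (rule that)
qed

lemma cochain_eval_diff: "cochain_eval \<phi> (c - d) = cochain_eval \<phi> c - cochain_eval \<phi> d"
  using cochain_eval_add[of \<phi> "c - d" d] by simp

lemma cochain_eval_of: "cochain_eval \<phi> (frag_of \<sigma>) = \<phi> \<sigma>"
  by (simp add: cochain_eval_def)

lemma cochain_eval_unique:
  assumes c: "singular_chain p X c" and F: "\<And>a b. F (a - b) = F a - F b"
    and "\<And>\<sigma>. singular_simplex p X \<sigma> \<Longrightarrow> \<phi> \<sigma> = F (frag_of \<sigma>)"
  shows "cochain_eval \<phi> c = F c"
proof -
  have "F 0 = 0" using F[of 0 0] by simp
  show ?thesis using c \<open>F 0 = 0\<close> unfolding singular_chain_def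
    by (induction c rule: frag_induction) (auto simp: cochain_eval_of cochain_eval_diff F assms(3))
qed

lemma cochain_eval_coboundary:
  assumes "singular_chain (Suc p) X d"
  shows "cochain_eval (coboundary p X \<phi>) d = cochain_eval \<phi> (chain_boundary (Suc p) d)"
  by (rule cochain_eval_unique[OF assms])
    (auto simp: coboundary_def chain_boundary_diff cochain_eval_diff)

definition cocycle_functional :: "nat \<Rightarrow> 'a topology \<Rightarrow> 'a cochain \<Rightarrow> 'a chain \<Rightarrow> complex" where
  "cocycle_functional p X \<phi> = (\<lambda>c. if cycle p X c then cochain_eval \<phi> c else 0)"

lemma cocycle_functional_in:
  assumes "\<phi> \<in> cocycle_set p X"
  shows "cocycle_functional p X \<phi> \<in> hom_homology p X"
proof -
  have "cochain_eval \<phi> c = 0" if c: "bdry p X c" for c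
  proof -
    obtain d where d: "singular_chain (Suc p) X d" "c = chain_boundary (Suc p) d"
      using c unfolding singular_boundary by blast
    then have "cochain_eval \<phi> c = cochain_eval (coboundary p X \<phi>) d"
      by (simp add: cochain_eval_coboundary)
    then show ?thesis using assms by (simp add: cocycle_set_def cochain_eval_def)
  qed
  then show ?thesis
    by (auto simp: hom_homology_def cocycle_functional_def cochain_eval_diff singular_relcycle_diff)
qed

text \<open>Extend the functional from the cycles to all chains and read off its values on simplices; the
  result is a cocycle because the functional vanishes on boundaries.\<close>

lemma cocycle_functional_surj:
  assumes g: "g \<in> hom_homology p X"
  shows "\<exists>\<phi>\<in>cocycle_set p X. cocycle_functional p X \<phi> = g"
proof -
  obtain F where F: "\<And>x y. F (x - y) = F x - F y" "\<And>x. cycle p X x \<Longrightarrow> F x = g x"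
  proof (rule additive_extension[of "Collect (cycle p X)" g])
    fix x y assume "x \<in> Collect (cycle p X)" "y \<in> Collect (cycle p X)"
    then show "x - y \<in> Collect (cycle p X)" "g (x - y) = g x - g y"
      using hom_homology_diff[OF g] singular_relcycle_diff by auto
  qed auto
  define \<phi> where "\<phi> \<sigma> = (if singular_simplex p X \<sigma> then F (frag_of \<sigma>) else 0)" for \<sigma>
  have ev: "cochain_eval \<phi> c = F c" if "singular_chain p X c" for c
    by (rule cochain_eval_unique[OF that F(1)]) (simp add: \<phi>_def)
  have "coboundary p X \<phi> \<sigma> = 0" for \<sigma>
  proof (cases "singular_simplex (Suc p) X \<sigma>")
    case True
    let ?b = "chain_boundary (Suc p) (frag_of \<sigma>)"
    have b: "bdry p X ?b"
      using True unfolding singular_boundary by (intro exI[of _ "frag_of \<sigma>"]) (simp add: singular_chain_of)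
    have "coboundary p X \<phi> \<sigma> = F ?b"
      using True ev[OF singular_boundary_imp_chain[OF b]] by (simp add: coboundary_def)
    also have "\<dots> = 0"
      using F(2)[OF singular_relboundary_imp_relcycle[OF b]] hom_homology_bdry[OF g b] by simp
    finally show ?thesis .
  qed (simp add: coboundary_def)
  then have "\<phi> \<in> cocycle_set p X" by (auto simp: cocycle_set_def cochain_set_def \<phi>_def)
  moreover have "cocycle_functional p X \<phi> = g"
    using ev F(2) hom_homology_outside[OF g] by (auto simp: cocycle_functional_def singular_cycle)
  ultimately show ?thesis by blast
qed

text \<open>A cocycle that vanishes on cycles induces a function on boundaries, sending \<open>\<partial>c\<close> to its value at
  \<open>c\<close>. An extension of this function to all chains is a cochain with the given coboundary.\<close>

lemma cocycle_functional_eq_0_iff: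
  assumes \<phi>: "\<phi> \<in> cocycle_set p X"
  shows "cocycle_functional p X \<phi> = (\<lambda>_. 0) \<longleftrightarrow> \<phi> \<in> coboundary_set p X"
proof
  assume "\<phi> \<in> coboundary_set p X"
  show "cocycle_functional p X \<phi> = (\<lambda>_. 0)"
  proof (cases p)
    case 0
    then show ?thesis
      using \<open>\<phi> \<in> coboundary_set p X\<close> by (auto simp: coboundary_set_def cocycle_functional_def cochain_eval_def)
  next
    case (Suc q)
    then obtain \<psi> where \<psi>: "\<phi> = coboundary q X \<psi>"
      using \<open>\<phi> \<in> coboundary_set p X\<close> by (auto simp: coboundary_set_def)
    show ?thesis
      by (rule ext) (auto simp: cocycle_functional_def \<psi> Suc singular_cycle cochain_eval_coboundary)
  qed
next
  assume z: "cocycle_functional p X \<phi> = (\<lambda>_. 0)"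
  have z: "cochain_eval \<phi> c = 0" if "cycle p X c" for c
    using that fun_cong[OF z, of c] by (simp add: cocycle_functional_def)
  have out: "\<phi> \<sigma> = 0" if "\<not> singular_simplex p X \<sigma>" for \<sigma>
    using \<phi> that by (simp add: cocycle_set_def cochain_set_def)
  show "\<phi> \<in> coboundary_set p X"
  proof (cases p)
    case 0
    have "\<phi> \<sigma> = 0" for \<sigma>
    proof (cases "singular_simplex p X \<sigma>")
      case True
      then have "cycle p X (frag_of \<sigma>)" by (simp add: singular_cycle singular_chain_of 0 chain_boundary_def)
      then show ?thesis using z[of "frag_of \<sigma>"] by (simp add: cochain_eval_of)
    qed (rule out)
    then show ?thesis by (auto simp: coboundary_set_def 0)
  next
    case (Suc q)
    define G where "G = chain_boundary p ` Collect (singular_chain p X)"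
    define f where "f y = cochain_eval \<phi> (SOME c. singular_chain p X c \<and> chain_boundary p c = y)" for y
    have f: "f (chain_boundary p c) = cochain_eval \<phi> c" if c: "singular_chain p X c" for c
    proof -
      let ?c = "SOME c'. singular_chain p X c' \<and> chain_boundary p c' = chain_boundary p c"
      have c': "singular_chain p X ?c \<and> chain_boundary p ?c = chain_boundary p c"
        by (rule someI[of _ c]) (use c in blast)
      then have "cycle p X (?c - c)"
        using c by (auto simp: singular_cycle singular_chain_diff chain_boundary_diff)
      then show ?thesis using z[of "?c - c"] by (simp add: f_def cochain_eval_diff)
    qed
    have "x - y \<in> G \<and> f (x - y) = f x - f y" if "x \<in> G" "y \<in> G" for x y
    proof -
      obtain c d where cd: "singular_chain p X c" "singular_chain p X d" "x = chain_boundary p c" "y = chain_boundary p d"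
        using \<open>x \<in> G\<close> \<open>y \<in> G\<close> by (auto simp: G_def)
      have e: "x - y = chain_boundary p (c - d)" by (simp add: cd chain_boundary_diff)
      show ?thesis
        using cd unfolding e by (auto simp: G_def f singular_chain_diff cochain_eval_diff)
    qed
    moreover have "0 \<in> G" unfolding G_def by (rule image_eqI[of _ _ 0]) auto
    ultimately obtain F where F: "\<And>x y. F (x - y) = F x - F y" "\<And>x. x \<in> G \<Longrightarrow> F x = f x"
      using additive_extension[of G f] by blast
    define \<psi> where "\<psi> \<sigma> = (if singular_simplex q X \<sigma> then F (frag_of \<sigma>) else 0)" for \<sigma>
    have "coboundary q X \<psi> \<sigma> = \<phi> \<sigma>" for \<sigma>
    proof (cases "singular_simplex p X \<sigma>")
      case True
      let ?b = "chain_boundary p (frag_of \<sigma>)"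
      have \<sigma>: "singular_chain p X (frag_of \<sigma>)" using True by (simp add: singular_chain_of)
      then have "singular_chain q X ?b" unfolding Suc by (rule singular_chain_boundary_alt)
      then have "cochain_eval \<psi> ?b = F ?b" by (rule cochain_eval_unique[OF _ F(1)]) (simp add: \<psi>_def)
      also have "\<dots> = f ?b" using F(2) \<sigma> by (auto simp: G_def)
      also have "\<dots> = \<phi> \<sigma>" using f[OF \<sigma>] by (simp add: cochain_eval_of)
      finally show ?thesis using True by (simp add: coboundary_def Suc)
    qed (use out in \<open>auto simp: coboundary_def Suc\<close>)
    then have "\<phi> = coboundary q X \<psi>" by auto
    moreover have "\<psi> \<in> cochain_set q X" by (auto simp: cochain_set_def \<psi>_def)
    ultimately show ?thesis by (auto simp: coboundary_set_def Suc)
  qed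
qed

lemma clinear_cocycle_functional: "clinear (cocycle_functional p X)"
  by (rule clinearI)
    (auto simp: cocycle_functional_def fun_eq_iff cochain_eval_def algebra_simps sum.distrib sum_distrib_left)

text \<open>The universal coefficient theorem for the complex numbers: evaluation on cycles identifies cocycles
  modulo coboundaries with the dual of homology.\<close>

lemma dim_cohomology_space:
  assumes "has_dim (hom_homology p X) n"
  shows "vectorspace.dim complex_field (cohomology_space p X) = n"
proof -
  let ?V = "cocycle_space p X" and ?W = "coboundary_set p X" and ?D = "cocycle_set p X"
  interpret V: vectorspace complex_field ?V by (rule cocycle_space_vectorspace)
  have D: "cfun.subspace ?D"
    by (auto simp: subspace_iff cocycle_set_def cochain_set_def coboundary_add coboundary_scale coboundary_zero)
  have WD: "?W \<subseteq> ?D"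
    by (cases p) (auto simp: coboundary_set_def cocycle_set_def coboundary_coboundary coboundary_zero cochain_set_def,
        simp_all add: coboundary_def)
  have "?W = {\<phi> \<in> ?D. cocycle_functional p X \<phi> = (\<lambda>_. 0)}"
    using WD cocycle_functional_eq_0_iff by blast
  then have sW: "cfun.subspace ?W" using subspace_kernel_on[OF clinear_cocycle_functional D] by simp
  have sub: "LinearCombinations.submodule complex_field ?W ?V"
    using V.module_axioms WD sW by (auto simp: submodule_def cocycle_space_def subspace_iff)
  have img: "cocycle_functional p X ` ?D = hom_homology p X"
    using cocycle_functional_in cocycle_functional_surj by (metis (no_types, lifting) image_eqI image_subset_iff subsetI subset_antisym)
  show ?thesis
  proof (rule dim_space_of_cosets[OF V.vectorspace_axioms _ _ _ sub D _ clinear_cocycle_functional])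
    show "vectorspace complex_field (cohomology_space p X)" by (rule cohomology_space_vectorspace)
    show "carrier (cohomology_space p X) = (\<lambda>\<phi>. ?W +>\<^bsub>?V\<^esub> \<phi>) ` ?D"
      by (auto simp: cohomology_space_def quot_module_def A_RCOSETS_def' a_r_coset_def' cocycle_space_def)
    show "has_dim (cocycle_functional p X ` ?D) n" unfolding img by (rule assms)
  qed (use cocycle_functional_eq_0_iff in \<open>auto simp: cohomology_space_def cocycle_space_def\<close>)
qed

section \<open>Functoriality and homotopy invariance\<close>

definition pull :: "nat \<Rightarrow> 'a topology \<Rightarrow> ('a \<Rightarrow> 'b) \<Rightarrow> ('b chain \<Rightarrow> complex) \<Rightarrow> 'a chain \<Rightarrow> complex" where
  "pull p X f g = (\<lambda>c. if cycle p X c then g (chain_map p f c) else 0)"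

lemma clinear_pull: "clinear (pull p X f)"
  by (rule clinearI) (auto simp: pull_def)

lemma cycle_chain_map: "cycle p X c \<Longrightarrow> continuous_map X Y f \<Longrightarrow> cycle p Y (chain_map p f c)"
  by (rule singular_relcycle_chain_map) auto

lemma bdry_chain_map: "bdry p X c \<Longrightarrow> continuous_map X Y f \<Longrightarrow> bdry p Y (chain_map p f c)"
  by (rule singular_relboundary_chain_map) auto

lemma pull_in:
  assumes f: "continuous_map X Y f" and g: "g \<in> hom_homology p Y"
  shows "pull p X f g \<in> hom_homology p X"
proof -
  have "pull p X f g (a - b) = pull p X f g a - pull p X f g b" if ab: "cycle p X a" "cycle p X b" for a b
    using ab singular_relcycle_diff[OF ab] hom_homology_diff[OF g cycle_chain_map[OF ab(1) f] cycle_chain_map[OF ab(2) f]]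
    by (simp add: pull_def chain_map_diff)
  moreover have "pull p X f g c = 0" if "bdry p X c" for c
    using hom_homology_bdry[OF g bdry_chain_map[OF that f]] by (simp add: pull_def)
  ultimately show ?thesis unfolding hom_homology_def by (auto simp: pull_def)
qed

lemma pull_zero: "pull p X f (\<lambda>_. 0) = (\<lambda>_. 0)"
  by (simp add: pull_def)

lemma pull_pull:
  assumes f: "continuous_map X Y f"
  shows "pull p X f (pull p Y k g) = pull p X (k \<circ> f) g"
  using cycle_chain_map[OF _ f] by (auto simp: pull_def fun_eq_iff chain_map_compose)

lemma pull_id:
  assumes g: "g \<in> hom_homology p X" and f: "\<And>x. x \<in> topspace X \<Longrightarrow> f x = x"
  shows "pull p X f g = g"
proof -
  have "chain_map p f c = c" if "cycle p X c" for c
    using that f by (intro chain_map_id_gen[of p X]) (auto simp: singular_cycle)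
  then show ?thesis using hom_homology_outside[OF g] by (auto simp: pull_def)
qed

text \<open>Homotopic maps send a cycle to homologous cycles.\<close>

lemma pull_homotopic:
  assumes h: "homotopic_with (\<lambda>_. True) X Y f f'" and g: "g \<in> hom_homology p Y"
  shows "pull p X f g = pull p X f' g"
proof -
  have f: "continuous_map X Y f" using homotopic_with_imp_continuous_maps[OF h] by blast
  have h': "homotopic_with (\<lambda>k. k \<in> {} \<rightarrow> {}) X Y f f'"
    using h by (rule homotopic_with_mono) auto
  have "g (chain_map p f c) = g (chain_map p f' c)" if c: "cycle p X c" for c
    using homotopic_imp_homologous_rel_chain_maps[OF h' c] cycle_chain_map[OF c f]
    by (intro hom_homology_homologous[OF g]) (auto simp: homologous_rel_def)
  then show ?thesis by (auto simp: pull_def)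
qed

lemma pull_homotopic_id:
  assumes h: "homotopic_with (\<lambda>_. True) X X (k \<circ> f) id" and f: "continuous_map X Y f"
    and g: "g \<in> hom_homology p X"
  shows "pull p X f (pull p Y k g) = g"
  unfolding pull_pull[OF f] pull_homotopic[OF h g] by (rule pull_id[OF g]) simp

lemma pull_homotopy_equivalence:
  assumes f: "continuous_map X Y f" and k: "continuous_map Y X k"
    and kf: "homotopic_with (\<lambda>_. True) X X (k \<circ> f) id" and fk: "homotopic_with (\<lambda>_. True) Y Y (f \<circ> k) id"
  shows "pull p X f ` hom_homology p Y = hom_homology p X"
    and "has_dim (hom_homology p X) n \<longleftrightarrow> has_dim (hom_homology p Y) n"
proof -
  show e: "pull p X f ` hom_homology p Y = hom_homology p X"
  proof (intro subset_antisym subsetI)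
    fix g assume g: "g \<in> hom_homology p X"
    then show "g \<in> pull p X f ` hom_homology p Y"
      using pull_homotopic_id[OF kf f g] pull_in[OF k g] by (metis image_eqI)
  qed (use pull_in[OF f] in auto)
  have "g = (\<lambda>_. 0)" if g: "g \<in> hom_homology p Y" "pull p X f g = (\<lambda>_. 0)" for g
    using pull_homotopic_id[OF fk k g(1)] unfolding g(2) pull_zero by simp
  then show "has_dim (hom_homology p X) n \<longleftrightarrow> has_dim (hom_homology p Y) n"
    using has_dim_inj_image_iff[OF clinear_pull subspace_hom_homology, of p Y p X f n] e by auto
qed

text \<open>All spaces to be considered are subsets of a fixed space, with the subspace topology.\<close>

abbreviation HH :: "nat \<Rightarrow> 'a::topological_space set \<Rightarrow> ('a chain \<Rightarrow> complex) set" where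
  "HH p S \<equiv> hom_homology p (top_of_set S)"

abbreviation hpull :: "nat \<Rightarrow> 'a::topological_space set \<Rightarrow> ('a \<Rightarrow> 'b) \<Rightarrow> ('b chain \<Rightarrow> complex) \<Rightarrow> 'a chain \<Rightarrow> complex" where
  "hpull p S \<equiv> pull p (top_of_set S)"

text \<open>In positive degrees every cycle of a point is a boundary. In degree zero there are no boundaries, and
  the cycles are the multiples of the constant simplex, so that a functional is determined by
  its value there.\<close>

lemma HH_singleton:
  shows "p > 0 \<Longrightarrow> has_dim (HH p {a}) 0" and "has_dim (HH 0 {a}) 1"
proof -
  have t: "topspace (top_of_set {a}) = {a}" by simp
  show "has_dim (HH p {a}) 0" if "p > 0"
  proof -
    have "g = (\<lambda>_. 0)" if g: "g \<in> HH p {a}" for g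
    proof
      fix c
      show "g c = 0"
        using hom_homology_outside[OF g, of c] hom_homology_bdry[OF g, of c]
          singular_boundary_eq_cycle_singleton[OF t, of p c] \<open>p > 0\<close> by auto
    qed
    then have "HH p {a} = {\<lambda>_. 0}" using cfun.subspace_0[OF subspace_hom_homology] by (auto simp: zero_fun_def)
    then show ?thesis by (simp add: has_dim_0)
  qed
  define s where "s = frag_of (restrict (\<lambda>x. a) (standard_simplex 0))"
  define e where "e g = (\<lambda>u::unit. g s :: complex)" for g
  have e: "clinear e" by (rule clinearI) (auto simp: e_def)
  have sc: "singular_chain 0 (top_of_set {a}) c \<longleftrightarrow> (\<exists>b. c = frag_cmul b s)" for c
    unfolding s_def by (rule singular_chain_singleton[OF t])
  have cyc: "cycle 0 (top_of_set {a}) c \<longleftrightarrow> (\<exists>b. c = frag_cmul b s)" for c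
    using singular_cycle_singleton[OF t, of 0 c] sc by simp
  have bd: "bdry 0 (top_of_set {a}) c \<longleftrightarrow> c = 0" for c
    using singular_boundary_singleton[OF t, of 0 c] by auto
  have s: "cycle 0 (top_of_set {a}) s" unfolding cyc by (rule exI[of _ 1]) simp
  have inj: "g = (\<lambda>_. 0)" if g: "g \<in> HH 0 {a}" and z: "e g = (\<lambda>_. 0)" for g
  proof -
    have gs: "g s = 0" using fun_cong[OF z, of "()"] by (simp add: e_def)
    have nat: "g (frag_cmul (int n) s) = 0" for n
    proof (induction n)
      case (Suc n)
      have "g (frag_cmul (int n) s + s) = g (frag_cmul (int n) s) + g s"
        by (rule hom_homology_add[OF g]) (use cyc s in auto)
      then show ?case using Suc gs by (simp add: frag_cmul_distrib add.commute)
    qed (simp add: hom_homology_0[OF g])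
    have "g (frag_cmul b s) = 0" for b
    proof (cases b)
      case (neg n)
      have "g (- frag_cmul (int (Suc n)) s) = - g (frag_cmul (int (Suc n)) s)"
        by (rule hom_homology_minus[OF g]) (use cyc in auto)
      then show ?thesis using nat[of "Suc n"] neg by simp
    qed (simp add: nat)
    then show ?thesis using hom_homology_outside[OF g] cyc by (metis ext)
  qed
  have "e ` HH 0 {a} = {h. \<forall>u. u \<notin> {()} \<longrightarrow> h u = 0}"
  proof -
    have "h \<in> e ` HH 0 {a}" for h
    proof -
      define g where "g c = (if cycle 0 (top_of_set {a}) c
        then of_int (Poly_Mapping.lookup c (restrict (\<lambda>x. a) (standard_simplex 0))) * h () else 0)" for c
      have "g \<in> HH 0 {a}"
        unfolding hom_homology_def bd
        by (auto simp: g_def singular_relcycle_diff lookup_minus algebra_simps)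
      moreover have "e g = h" using s by (auto simp: e_def g_def s_def)
      ultimately show ?thesis by blast
    qed
    then show ?thesis by auto
  qed
  then have "has_dim (e ` HH 0 {a}) 1" using has_dim_coordinate_space[of "{()}"] by simp
  then show "has_dim (HH 0 {a}) 1"
    using has_dim_inj_image_iff[OF e subspace_hom_homology inj] by blast
qed

section \<open>The Mayer--Vietoris sequence\<close>

lemma small_chain_split:
  fixes c :: "'a::topological_space chain"
  assumes c: "singular_chain p (top_of_set (U \<union> V)) c"
    and small: "\<And>f. f \<in> Poly_Mapping.keys c \<Longrightarrow> f ` standard_simplex p \<subseteq> U \<or> f ` standard_simplex p \<subseteq> V"
  obtains u v where "singular_chain p (top_of_set U) u" "singular_chain p (top_of_set V) v" "c = u + v"
proof -
  let ?S = "{f. singular_simplex p (top_of_set U) f} \<union> {f. singular_simplex p (top_of_set V) f}"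
  have "Poly_Mapping.keys c \<subseteq> ?S"
  proof
    fix f assume f: "f \<in> Poly_Mapping.keys c"
    then have "singular_simplex p (top_of_set (U \<union> V)) f" using c by (auto simp: singular_chain_def)
    then show "f \<in> ?S" using small[OF f] by (auto simp: singular_simplex_subtopology)
  qed
  then have "\<exists>u v. singular_chain p (top_of_set U) u \<and> singular_chain p (top_of_set V) v \<and> c = u + v"
  proof (induction c rule: frag_induction)
    case zero
    then show ?case by (intro exI[of _ 0]) auto
  next
    case (one f)
    then show ?case
    proof
      assume "f \<in> {f. singular_simplex p (top_of_set U) f}"
      then show ?thesis by (intro exI[of _ "frag_of f"] exI[of _ 0]) (auto simp: singular_chain_of)
    next
      assume "f \<in> {f. singular_simplex p (top_of_set V) f}"
      then show ?thesis by (intro exI[of _ 0] exI[of _ "frag_of f"]) (auto simp: singular_chain_of)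
    qed
  next
    case (diff a b)
    then obtain u v u' v' where "singular_chain p (top_of_set U) u" "singular_chain p (top_of_set V) v" "a = u + v"
      "singular_chain p (top_of_set U) u'" "singular_chain p (top_of_set V) v'" "b = u' + v'" by blast
    then show ?case
      by (intro exI[of _ "u - u'"] exI[of _ "v - v'"]) (auto simp: singular_chain_diff)
  qed
  then show ?thesis using that by blast
qed

locale open_cover =
  fixes U V :: "'a::topological_space set"
  assumes open_U: "open U" and open_V: "open V"
begin

abbreviation "TX \<equiv> top_of_set (U \<union> V)"
abbreviation "TU \<equiv> top_of_set U"
abbreviation "TV \<equiv> top_of_set V"
abbreviation "TW \<equiv> top_of_set (U \<inter> V)"

lemma chain_mono:
  "singular_chain p TW c \<Longrightarrow> singular_chain p TU c" "singular_chain p TW c \<Longrightarrow> singular_chain p TV c"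
  "singular_chain p TU c \<Longrightarrow> singular_chain p TX c" "singular_chain p TV c \<Longrightarrow> singular_chain p TX c"
  by (erule singular_chain_mono; blast)+

lemma chain_Int: "singular_chain p TU c \<Longrightarrow> singular_chain p TV c \<Longrightarrow> singular_chain p TW c"
  by (auto simp: singular_chain_subtopology)

lemma cycle_mono:
  "cycle p TW c \<Longrightarrow> cycle p TU c" "cycle p TW c \<Longrightarrow> cycle p TV c"
  "cycle p TU c \<Longrightarrow> cycle p TX c" "cycle p TV c \<Longrightarrow> cycle p TX c"
  using chain_mono by (auto simp: singular_cycle)

lemma cycle_Int: "cycle p TU c \<Longrightarrow> cycle p TV c \<Longrightarrow> cycle p TW c"
  using chain_Int by (auto simp: singular_cycle)

lemma bdry_mono:
  "bdry p TW c \<Longrightarrow> bdry p TU c" "bdry p TW c \<Longrightarrow> bdry p TV c"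
  "bdry p TU c \<Longrightarrow> bdry p TX c" "bdry p TV c \<Longrightarrow> bdry p TX c"
  using chain_mono unfolding singular_boundary by blast+

text \<open>Iterated barycentric subdivision makes every simplex of a chain small enough to lie in one of the two
  open sets.\<close>

lemma subdivision_split:
  assumes "singular_chain p TX c"
  obtains n u v where "singular_chain p TU u" "singular_chain p TV v" "(singular_subdivision p ^^ n) c = u + v"
proof -
  have op: "\<And>S. S \<in> {U, V} \<Longrightarrow> openin TX S" and cov: "topspace TX \<subseteq> \<Union>{U, V}"
    using open_U open_V by (auto simp: openin_open)
  obtain n where n: "\<And>m f. n \<le> m \<Longrightarrow> f \<in> Poly_Mapping.keys ((singular_subdivision p ^^ m) c)
      \<Longrightarrow> \<exists>S\<in>{U, V}. f \<in> standard_simplex p \<rightarrow> S"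
    using sufficient_iterated_singular_subdivision_exists[OF op cov assms] by blast
  have sc: "singular_chain p TX ((singular_subdivision p ^^ n) c)"
    by (induction n) (use assms singular_chain_singular_subdivision in auto)
  have sm: "f ` standard_simplex p \<subseteq> U \<or> f ` standard_simplex p \<subseteq> V"
    if "f \<in> Poly_Mapping.keys ((singular_subdivision p ^^ n) c)" for f
    using n[OF order_refl that] by auto
  show ?thesis using small_chain_split[OF sc sm] that by metis
qed

lemma small_cycle:
  assumes z: "cycle p TX z"
  obtains u v where "singular_chain p TU u" "singular_chain p TV v" "bdry p TX (z - (u + v))" "cycle p TX (u + v)"
proof -
  have sz: "singular_chain p TX z" using z by (simp add: singular_cycle)
  obtain n u v where uv: "singular_chain p TU u" "singular_chain p TV v" "(singular_subdivision p ^^ n) z = u + v"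
    by (rule subdivision_split[OF sz])
  obtain h where h: "\<And>p. h p 0 = (0 :: 'a chain)"
    "\<And>p X c. singular_chain p X c \<Longrightarrow> singular_chain (Suc p) X (h p c)"
    "\<And>p X c. singular_chain p X c \<Longrightarrow> chain_boundary (Suc p) (h p c) + h (p - Suc 0) (chain_boundary p c)
        = (singular_subdivision p ^^ n) c - c"
    by (rule chain_homotopic_iterated_singular_subdivision[where n = n and ?'a = 'a]) blast
  have "chain_boundary (Suc p) (h p z) = (u + v) - z"
    using h(3)[OF sz] z uv(3) by (simp add: singular_cycle h(1))
  then have b: "bdry p TX ((u + v) - z)" using h(2)[OF sz] unfolding singular_boundary by blast
  then have b': "bdry p TX (z - (u + v))" using singular_relboundary_minus[of p TX "{}" "(u + v) - z"] by simp
  have "cycle p TX ((u + v) - z + z)"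
    by (rule singular_relcycle_add[OF singular_relboundary_imp_relcycle[OF b] z])
  then show ?thesis using that uv b' by simp
qed

text \<open>If a small cycle bounds, subdivide the bounding chain. The chain homotopy between subdivision and
  the identity preserves chains in \<open>U\<close> and chains in \<open>V\<close>, so the correction term is again small.\<close>

lemma small_boundary:
  assumes u: "singular_chain p TU u" and v: "singular_chain p TV v" and b: "bdry p TX (u + v)"
  obtains c d where "singular_chain (Suc p) TU c" "singular_chain (Suc p) TV d"
    "u + v = chain_boundary (Suc p) c + chain_boundary (Suc p) d"
proof -
  obtain e where e: "singular_chain (Suc p) TX e" "chain_boundary (Suc p) e = u + v"
    using b unfolding singular_boundary by blast
  obtain n x y where xy: "singular_chain (Suc p) TU x" "singular_chain (Suc p) TV y"
    "(singular_subdivision (Suc p) ^^ n) e = x + y"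
    by (rule subdivision_split[OF e(1)])
  obtain h where h: "\<And>p. h p 0 = (0 :: 'a chain)"
    "\<And>p c1 c2. h p (c1 - c2) = h p c1 - h p c2"
    "\<And>p X c. singular_chain p X c \<Longrightarrow> singular_chain (Suc p) X (h p c)"
    "\<And>p X c. singular_chain p X c \<Longrightarrow> chain_boundary (Suc p) (h p c) + h (p - Suc 0) (chain_boundary p c)
        = (singular_subdivision p ^^ n) c - c"
    by (rule chain_homotopic_iterated_singular_subdivision[where n = n and ?'a = 'a]) blast
  have sd: "(singular_subdivision p ^^ n) (chain_boundary (Suc p) e) = chain_boundary (Suc p) (x + y)"
  proof -
    have "singular_chain (Suc p) TX ((singular_subdivision (Suc p) ^^ n) e) \<and>
      (singular_subdivision p ^^ n) (chain_boundary (Suc p) e) = chain_boundary (Suc p) ((singular_subdivision (Suc p) ^^ n) e)" for n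
    proof (induction n)
      case (Suc n)
      then show ?case
        using singular_chain_singular_subdivision[OF conjunct1[OF Suc]]
          chain_boundary_singular_subdivision[of "Suc p" TX "(singular_subdivision (Suc p) ^^ n) e"]
        by simp
    qed (use e in auto)
    then show ?thesis using xy(3) by simp
  qed
  have cyc: "chain_boundary p (u + v) = 0" using singular_relboundary_imp_relcycle[OF b] by (simp add: singular_cycle)
  have suv: "singular_chain p TX (u + v)" using u v chain_mono singular_chain_add by blast
  have "chain_boundary (Suc p) (h p (u + v)) = chain_boundary (Suc p) (x + y) - (u + v)"
    using h(4)[OF suv] cyc sd e(2) by (simp add: h(1))
  moreover have "h p (u + v) = h p u + h p v"
  proof -
    have "h p (u - (0 - v)) = h p u - (h p 0 - h p v)" by (simp only: h(2))
    then show ?thesis by (simp add: h(1))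
  qed
  ultimately have eq: "u + v = chain_boundary (Suc p) (x - h p u) + chain_boundary (Suc p) (y - h p v)"
    by (simp add: chain_boundary_add chain_boundary_diff algebra_simps)
  show ?thesis
    by (rule that[OF singular_chain_diff[OF xy(1) h(3)[OF u]] singular_chain_diff[OF xy(2) h(3)[OF v]] eq])
qed

text \<open>The two maps of the Mayer--Vietoris sequence: restriction to both open sets, and the difference of the
  restrictions of a pair to the intersection.\<close>

definition restrict_pair :: "nat \<Rightarrow> ('a chain \<Rightarrow> complex) \<Rightarrow> 'a chain + 'a chain \<Rightarrow> complex" where
  "restrict_pair p \<gamma> = case_sum (\<lambda>c. if cycle p TU c then \<gamma> c else 0) (\<lambda>c. if cycle p TV c then \<gamma> c else 0)"

definition overlap_diff :: "nat \<Rightarrow> ('a chain + 'a chain \<Rightarrow> complex) \<Rightarrow> 'a chain \<Rightarrow> complex" where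
  "overlap_diff p h = (\<lambda>c. if cycle p TW c then h (Inl c) - h (Inr c) else 0)"

abbreviation pair_space :: "nat \<Rightarrow> ('a chain + 'a chain \<Rightarrow> complex) set" where
  "pair_space p \<equiv> cfun_prod (HH p U) (HH p V)"

lemma clinear_restrict_pair: "clinear (restrict_pair p)"
  by (rule clinearI) (auto simp: restrict_pair_def fun_eq_iff split: sum.split)

lemma clinear_overlap_diff: "clinear (overlap_diff p)"
  by (rule clinearI) (auto simp: overlap_diff_def fun_eq_iff algebra_simps)

lemma restrict_in:
  assumes \<gamma>: "\<gamma> \<in> hom_homology p X" and c: "\<And>c. cycle p Y c \<Longrightarrow> cycle p X c" and b: "\<And>c. bdry p Y c \<Longrightarrow> bdry p X c"
  shows "(\<lambda>c. if cycle p Y c then \<gamma> c else 0) \<in> hom_homology p Y"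
  unfolding hom_homology_def
  using hom_homology_diff[OF \<gamma>] hom_homology_bdry[OF \<gamma>] c b
  by (simp add: singular_relcycle_diff)

lemma overlap_diff_in: assumes "h \<in> pair_space p" shows "overlap_diff p h \<in> HH p (U \<inter> V)"
proof -
  let ?a = "\<lambda>c. if cycle p TW c then h (Inl c) else 0" and ?b = "\<lambda>c. if cycle p TW c then h (Inr c) else 0"
  have "?a \<in> HH p (U \<inter> V)"
    by (rule restrict_in[where X = TU]) (use assms cycle_mono(1) bdry_mono(1) in auto)
  moreover have "?b \<in> HH p (U \<inter> V)"
    by (rule restrict_in[where X = TV]) (use assms cycle_mono(2) bdry_mono(2) in auto)
  ultimately have "?a - ?b \<in> HH p (U \<inter> V)" by (rule cfun.subspace_diff[OF subspace_hom_homology])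
  moreover have "?a - ?b = overlap_diff p h" by (auto simp: overlap_diff_def fun_eq_iff)
  ultimately show ?thesis by simp
qed

text \<open>Exactness at \<open>H(U) \<oplus> H(V)\<close>. A compatible pair \<open>(\<alpha>, \<beta>)\<close> prescribes the values
  \<open>\<alpha> u + \<beta> v\<close> on sums of cycles. This is consistent: if \<open>u + v\<close> bounds, it is a sum of
  boundaries \<open>\<partial>c + \<partial>d\<close> of small chains, and the cycle \<open>u - \<partial>c = \<partial>d - v\<close> of the intersection has equal
  values under \<open>\<alpha>\<close> and \<open>\<beta>\<close>. The rest is extension to all cycles.\<close>

lemma range_restrict_pair: "restrict_pair p ` HH p (U \<union> V) = {h \<in> pair_space p. overlap_diff p h = (\<lambda>_. 0)}"
proof (intro subset_antisym subsetI)
  fix h assume "h \<in> restrict_pair p ` HH p (U \<union> V)"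
  then obtain \<gamma> where \<gamma>: "\<gamma> \<in> HH p (U \<union> V)" "h = restrict_pair p \<gamma>" by blast
  have "(\<lambda>c. h (Inl c)) \<in> HH p U"
    using restrict_in[OF \<gamma>(1) cycle_mono(3) bdry_mono(3)] by (simp add: \<gamma>(2) restrict_pair_def)
  moreover have "(\<lambda>c. h (Inr c)) \<in> HH p V"
    using restrict_in[OF \<gamma>(1) cycle_mono(4) bdry_mono(4)] by (simp add: \<gamma>(2) restrict_pair_def)
  ultimately show "h \<in> {h \<in> pair_space p. overlap_diff p h = (\<lambda>_. 0)}"
    using cycle_mono(1,2) by (auto simp: \<gamma>(2) restrict_pair_def overlap_diff_def)
next
  fix h assume "h \<in> {h \<in> pair_space p. overlap_diff p h = (\<lambda>_. 0)}"
  then have a: "(\<lambda>c. h (Inl c)) \<in> HH p U" and b: "(\<lambda>c. h (Inr c)) \<in> HH p V" and d: "overlap_diff p h = (\<lambda>_. 0)" by auto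
  define \<alpha> where "\<alpha> = (\<lambda>c. h (Inl c))"
  define \<beta> where "\<beta> = (\<lambda>c. h (Inr c))"
  have a: "\<alpha> \<in> HH p U" and b: "\<beta> \<in> HH p V" using a b by (auto simp: \<alpha>_def \<beta>_def)
  have ab: "\<alpha> w = \<beta> w" if "cycle p TW w" for w
    using fun_cong[OF d, of w] that by (simp add: overlap_diff_def \<alpha>_def \<beta>_def)
  have key: "\<alpha> u + \<beta> v = 0" if u: "cycle p TU u" and v: "cycle p TV v" and uv: "bdry p TX (u + v)" for u v
  proof -
    obtain c d where cd: "singular_chain (Suc p) TU c" "singular_chain (Suc p) TV d"
      "u + v = chain_boundary (Suc p) c + chain_boundary (Suc p) d"
      using small_boundary[OF _ _ uv] u v by (auto simp: singular_cycle)
    define w where "w = u - chain_boundary (Suc p) c"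
    have w': "w = chain_boundary (Suc p) d - v" using cd(3) by (simp add: w_def algebra_simps)
    have bc: "bdry p TU (chain_boundary (Suc p) c)" and bd: "bdry p TV (chain_boundary (Suc p) d)"
      using cd unfolding singular_boundary by blast+
    note cc = singular_relboundary_imp_relcycle[OF bc] and cd' = singular_relboundary_imp_relcycle[OF bd]
    have "cycle p TU w" unfolding w_def by (rule singular_relcycle_diff[OF u cc])
    moreover have "cycle p TV w" unfolding w' by (rule singular_relcycle_diff[OF cd' v])
    ultimately have "\<alpha> w = \<beta> w" using ab cycle_Int by blast
    moreover have "\<alpha> w = \<alpha> u" unfolding w_def using hom_homology_diff[OF a u cc] hom_homology_bdry[OF a bc] by simp
    moreover have "\<beta> w = - \<beta> v" unfolding w' using hom_homology_diff[OF b cd' v] hom_homology_bdry[OF b bd] by simp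
    ultimately show ?thesis by simp
  qed
  define P where "P y uv \<longleftrightarrow> cycle p TU (fst uv) \<and> cycle p TV (snd uv) \<and> y = fst uv + snd uv" for y uv
  define f where "f y = (case SOME uv. P y uv of (u, v) \<Rightarrow> \<alpha> u + \<beta> v)" for y
  have f: "f (u + v) = \<alpha> u + \<beta> v" if u: "cycle p TU u" and v: "cycle p TV v" for u v
  proof -
    define uv where "uv = (SOME uv. P (u + v) uv)"
    have P: "P (u + v) uv" unfolding uv_def by (rule someI[of _ "(u, v)"]) (simp add: P_def u v)
    obtain u' v' where e: "uv = (u', v')" by (cases uv)
    have u': "cycle p TU u'" and v': "cycle p TV v'" and s: "u + v = u' + v'" using P by (auto simp: P_def e)
    have "(u - u') + (v - v') = 0" using s by (simp add: algebra_simps)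
    then have "bdry p TX ((u - u') + (v - v'))" by simp
    then have "\<alpha> (u - u') + \<beta> (v - v') = 0"
      by (rule key[OF singular_relcycle_diff[OF u u'] singular_relcycle_diff[OF v v']])
    then have "(\<alpha> u + \<beta> v) - (\<alpha> u' + \<beta> v') = 0"
      using hom_homology_diff[OF a u u'] hom_homology_diff[OF b v v'] by (simp add: algebra_simps)
    then show ?thesis by (simp add: f_def uv_def[symmetric] e)
  qed
  define G where "G = {u + v |u v. cycle p TU u \<and> cycle p TV v}"
  obtain \<gamma> where \<gamma>: "\<gamma> \<in> HH p (U \<union> V)" "\<And>x. x \<in> G \<Longrightarrow> \<gamma> x = f x"
  proof (rule hom_homology_extend[of G p TX f])
    have "cycle p TU 0" "cycle p TV 0" by simp_all
    then show "0 \<in> G" unfolding G_def by (metis (mono_tags, lifting) CollectI add_0)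
    have gd: "x - y \<in> G \<and> f (x - y) = f x - f y" if x: "x \<in> G" and y: "y \<in> G" for x y
    proof -
      obtain u v where u: "cycle p TU u" "cycle p TV v" "x = u + v" using x unfolding G_def by blast
      obtain u' v' where u': "cycle p TU u'" "cycle p TV v'" "y = u' + v'" using y unfolding G_def by blast
      have e: "x - y = (u - u') + (v - v')" using u u' by (simp add: algebra_simps)
      have c: "cycle p TU (u - u')" "cycle p TV (v - v')" using u u' singular_relcycle_diff by blast+
      have "f (x - y) = f x - f y"
        unfolding e f[OF c] unfolding u(3) u'(3) f[OF u(1,2)] f[OF u'(1,2)]
        using hom_homology_diff[OF a u(1) u'(1)] hom_homology_diff[OF b u(2) u'(2)] by simp
      then show ?thesis using c e unfolding G_def by blast
    qed
    then show "\<And>x y. x \<in> G \<Longrightarrow> y \<in> G \<Longrightarrow> x - y \<in> G" "\<And>x y. x \<in> G \<Longrightarrow> y \<in> G \<Longrightarrow> f (x - y) = f x - f y" by auto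
    show "cycle p TX x" if "x \<in> G" for x
      using that cycle_mono(3,4) singular_relcycle_add unfolding G_def by blast
    show "f x = 0" if "x \<in> G" "bdry p TX x" for x
      using that f key unfolding G_def by fastforce
  qed (rule that)
  have "\<gamma> u = \<alpha> u" if u: "cycle p TU u" for u
  proof -
    have z: "cycle p TV 0" by simp
    have "u + 0 \<in> G" unfolding G_def using u z by blast
    then have "\<gamma> (u + 0) = \<alpha> u + \<beta> 0" using \<gamma>(2) f[OF u z] by metis
    then show ?thesis by (simp add: hom_homology_0[OF b])
  qed
  moreover have "\<gamma> v = \<beta> v" if v: "cycle p TV v" for v
  proof -
    have z: "cycle p TU 0" by simp
    have "0 + v \<in> G" unfolding G_def using v z by blast
    then have "\<gamma> (0 + v) = \<alpha> 0 + \<beta> v" using \<gamma>(2) f[OF z v] by metis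
    then show ?thesis by (simp add: hom_homology_0[OF a])
  qed
  ultimately have "restrict_pair p \<gamma> = h"
    using hom_homology_outside[OF a] hom_homology_outside[OF b]
    by (auto simp: restrict_pair_def fun_eq_iff \<alpha>_def \<beta>_def split: sum.split)
  then show "h \<in> restrict_pair p ` HH p (U \<union> V)" using \<gamma>(1) by blast
qed

text \<open>The cycles of the intersection that bound in \<open>U\<close> and in \<open>V\<close>. Modulo the boundaries of the intersection
  they are the image of the boundary map \<open>H\<^bsub>p+1\<^esub>(U \<union> V) \<rightarrow> H\<^sub>p(U \<inter> V)\<close> of the homology sequence.\<close>

definition bounding :: "nat \<Rightarrow> 'a chain \<Rightarrow> bool" where
  "bounding p w \<longleftrightarrow> bdry p TU w \<and> bdry p TV w"

definition eval_bounding :: "nat \<Rightarrow> ('a chain \<Rightarrow> complex) \<Rightarrow> 'a chain \<Rightarrow> complex" where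
  "eval_bounding p g = (\<lambda>w. if bounding p w then g w else 0)"

lemma clinear_eval_bounding: "clinear (eval_bounding p)"
  by (rule clinearI) (auto simp: eval_bounding_def)

lemma bounding_cycle: "bounding p w \<Longrightarrow> cycle p TW w"
  unfolding bounding_def using cycle_Int singular_relboundary_imp_relcycle by blast

lemma bounding_diff: "bounding p w \<Longrightarrow> bounding p w' \<Longrightarrow> bounding p (w - w')"
  unfolding bounding_def using singular_relboundary_diff by blast

lemma bounding_0: "bounding p 0"
  by (simp add: bounding_def)

text \<open>Exactness at \<open>H(U \<inter> V)\<close>. A functional on the cycles \<open>w\<close> of the intersection prescribes the value of a
  pair \<open>(\<alpha>, - \<beta>)\<close> on the diagonal elements \<open>(w, w)\<close>. Prescribing zero on pairs of boundaries is
  consistent exactly if the functional vanishes on cycles that bound on both sides. Extension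
  to all pairs of chains yields \<open>\<alpha>\<close> and \<open>\<beta>\<close>.\<close>

lemma range_overlap_diff: "overlap_diff p ` pair_space p = {g \<in> HH p (U \<inter> V). eval_bounding p g = (\<lambda>_. 0)}"
proof (intro subset_antisym subsetI)
  fix g assume "g \<in> overlap_diff p ` pair_space p"
  then obtain h where h: "h \<in> pair_space p" "g = overlap_diff p h" by blast
  have "g w = 0" if "bounding p w" for w
    using that h(1) hom_homology_bdry[of "\<lambda>c. h (Inl c)" p TU w] hom_homology_bdry[of "\<lambda>c. h (Inr c)" p TV w]
    by (simp add: bounding_def h(2) overlap_diff_def)
  then show "g \<in> {g \<in> HH p (U \<inter> V). eval_bounding p g = (\<lambda>_. 0)}"
    using overlap_diff_in[OF h(1)] h(2) by (auto simp: eval_bounding_def)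
next
  fix g assume "g \<in> {g \<in> HH p (U \<inter> V). eval_bounding p g = (\<lambda>_. 0)}"
  then have g: "g \<in> HH p (U \<inter> V)" and z: "eval_bounding p g = (\<lambda>_. 0)" by auto
  have z: "g w = 0" if "bounding p w" for w using fun_cong[OF z, of w] that by (simp add: eval_bounding_def)
  define P where "P x w \<longleftrightarrow> cycle p TW w \<and> bdry p TU (fst x - w) \<and> bdry p TV (snd x - w)" for x w
  define G where "G = {x. \<exists>w. P x w}"
  define f where "f x = g (SOME w. P x w)" for x
  have f: "f x = g w" if w: "P x w" for x w
  proof -
    define w' where "w' = (SOME w. P x w)"
    have w': "P x w'" unfolding w'_def using w by (rule someI)
    have "bdry p TU ((fst x - w') - (fst x - w))" "bdry p TV ((snd x - w') - (snd x - w))"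
      using w w' singular_relboundary_diff unfolding P_def by blast+
    then have "bounding p (w - w')" by (simp add: bounding_def)
    then have "g (w - w') = 0" by (rule z)
    then have "g w = g w'" using hom_homology_diff[OF g, of w w'] w w' by (simp add: P_def)
    then show ?thesis unfolding f_def w'_def by simp
  qed
  have Pd: "P (x - y) (w - v)" if "P x w" "P y v" for x y w v
  proof -
    have "bdry p TU ((fst x - w) - (fst y - v))" "bdry p TV ((snd x - w) - (snd y - v))"
      using that singular_relboundary_diff unfolding P_def by blast+
    moreover have "(fst x - w) - (fst y - v) = fst (x - y) - (w - v)" "(snd x - w) - (snd y - v) = snd (x - y) - (w - v)"
      by (simp_all add: algebra_simps)
    moreover have "cycle p TW (w - v)" using that singular_relcycle_diff unfolding P_def by blast
    ultimately show ?thesis unfolding P_def by simp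
  qed
  have fd: "f (x - y) = f x - f y" if "P x w" "P y v" for x y w v
    unfolding f[OF that(1)] f[OF that(2)] f[OF Pd[OF that]]
    using that by (intro hom_homology_diff[OF g]) (auto simp: P_def)
  obtain F where F: "\<And>x y. F (x - y) = F x - F y" "\<And>x. x \<in> G \<Longrightarrow> F x = f x"
  proof (rule additive_extension[of G f])
    show "0 \<in> G" by (auto simp: G_def P_def intro!: exI[of _ 0])
    show "x - y \<in> G" "f (x - y) = f x - f y" if "x \<in> G" "y \<in> G" for x y
      using that Pd fd unfolding G_def by blast+
  qed (rule that)
  have FP: "F x = g w" if "P x w" for x w using F(2)[of x] f[OF that] that by (auto simp: G_def)
  define \<alpha> where "\<alpha> u = (if cycle p TU u then F (u, 0) else 0)" for u
  define \<beta> where "\<beta> v = (if cycle p TV v then - F (0, v) else 0)" for v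
  have "F (b, 0) = 0" if "bdry p TU b" for b
    using FP[of "(b, 0)" 0] that hom_homology_0[OF g] by (simp add: P_def)
  moreover have "F (a - b, 0) = F (a, 0) - F (b, 0)" for a b using F(1)[of "(a, 0)" "(b, 0)"] by simp
  ultimately have \<alpha>: "\<alpha> \<in> HH p U" by (simp add: hom_homology_def \<alpha>_def singular_relcycle_diff)
  have "F (0, b) = 0" if "bdry p TV b" for b
    using FP[of "(0, b)" 0] that hom_homology_0[OF g] by (simp add: P_def)
  moreover have "F (0, a - b) = F (0, a) - F (0, b)" for a b using F(1)[of "(0, a)" "(0, b)"] by simp
  ultimately have \<beta>: "\<beta> \<in> HH p V" by (simp add: hom_homology_def \<beta>_def singular_relcycle_diff)
  have "\<alpha> w - \<beta> w = g w" if w: "cycle p TW w" for w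
  proof -
    have "F (0, 0) = 0" using F(1)[of 0 0] by (simp add: zero_prod_def)
    then have "F ((w, 0) - ((0, 0) - (0, w))) = F (w, 0) + F (0, w)" by (simp only: F(1)) simp
    moreover have "F (w, w) = g w" by (rule FP) (simp add: P_def w)
    ultimately show ?thesis using w cycle_mono(1,2) by (simp add: \<alpha>_def \<beta>_def)
  qed
  then have "overlap_diff p (case_sum \<alpha> \<beta>) = g" using hom_homology_outside[OF g] by (auto simp: overlap_diff_def)
  moreover have "case_sum \<alpha> \<beta> \<in> pair_space p" using \<alpha> \<beta> by (simp add: eta_contract_eq)
  ultimately show "g \<in> overlap_diff p ` pair_space p" by blast
qed

lemma eval_on_glued:
  assumes \<gamma>: "\<gamma> \<in> HH p (U \<union> V)" and r: "restrict_pair p \<gamma> = (\<lambda>_. 0)"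
  shows "cycle p TU c \<Longrightarrow> \<gamma> c = 0" "cycle p TV c \<Longrightarrow> \<gamma> c = 0"
  using fun_cong[OF r, of "Inl c"] fun_cong[OF r, of "Inr c"] by (simp_all add: restrict_pair_def)

definition bound_U :: "nat \<Rightarrow> 'a chain \<Rightarrow> 'a chain" where
  "bound_U p w = (SOME c. singular_chain (Suc p) TU c \<and> chain_boundary (Suc p) c = w)"

definition bound_V :: "nat \<Rightarrow> 'a chain \<Rightarrow> 'a chain" where
  "bound_V p w = (SOME c. singular_chain (Suc p) TV c \<and> chain_boundary (Suc p) c = w)"

lemma bound_UV:
  assumes "bounding p w"
  shows "singular_chain (Suc p) TU (bound_U p w)" "chain_boundary (Suc p) (bound_U p w) = w"
    "singular_chain (Suc p) TV (bound_V p w)" "chain_boundary (Suc p) (bound_V p w) = w"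
proof -
  have "\<exists>c. singular_chain (Suc p) TU c \<and> chain_boundary (Suc p) c = w"
    using assms unfolding bounding_def singular_boundary by (rule conjunct1)
  then have "singular_chain (Suc p) TU (bound_U p w) \<and> chain_boundary (Suc p) (bound_U p w) = w"
    unfolding bound_U_def by (rule someI_ex)
  moreover have "\<exists>c. singular_chain (Suc p) TV c \<and> chain_boundary (Suc p) c = w"
    using assms unfolding bounding_def singular_boundary by (rule conjunct2)
  then have "singular_chain (Suc p) TV (bound_V p w) \<and> chain_boundary (Suc p) (bound_V p w) = w"
    unfolding bound_V_def by (rule someI_ex)
  ultimately show "singular_chain (Suc p) TU (bound_U p w)" "chain_boundary (Suc p) (bound_U p w) = w"
    "singular_chain (Suc p) TV (bound_V p w)" "chain_boundary (Suc p) (bound_V p w) = w" by auto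
qed

text \<open>A cycle bounding on both sides is glued to a cycle of the union from its two bounding chains. Evaluating
  there identifies the kernel of the restriction in degree \<open>p + 1\<close> with functions on the cycles
  that bound on both sides, and so makes the connecting homomorphism superfluous.\<close>

definition glue_eval :: "nat \<Rightarrow> ('a chain \<Rightarrow> complex) \<Rightarrow> 'a chain \<Rightarrow> complex" where
  "glue_eval p \<gamma> = (\<lambda>w. if bounding p w then \<gamma> (bound_U p w - bound_V p w) else 0)"

lemma clinear_glue_eval: "clinear (glue_eval p)"
  by (rule clinearI) (auto simp: glue_eval_def)

lemma glued_cycle:
  assumes "singular_chain (Suc p) TU u" "singular_chain (Suc p) TV v"
    "chain_boundary (Suc p) u = chain_boundary (Suc p) v"
  shows "cycle (Suc p) TX (u - v)"
  unfolding singular_cycle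
  using singular_chain_diff[OF chain_mono(3)[OF assms(1)] chain_mono(4)[OF assms(2)]] assms(3)
  by (simp add: chain_boundary_diff)

text \<open>Two choices of bounding chains differ by a cycle of \<open>U\<close> and a cycle of \<open>V\<close>.\<close>

lemma eval_glued_independent:
  assumes \<gamma>: "\<gamma> \<in> HH (Suc p) (U \<union> V)" and r: "restrict_pair (Suc p) \<gamma> = (\<lambda>_. 0)"
    and u: "singular_chain (Suc p) TU u" "singular_chain (Suc p) TU u'"
    and v: "singular_chain (Suc p) TV v" "singular_chain (Suc p) TV v'"
    and b: "chain_boundary (Suc p) u = chain_boundary (Suc p) v"
      "chain_boundary (Suc p) u' = chain_boundary (Suc p) u" "chain_boundary (Suc p) v' = chain_boundary (Suc p) v"
  shows "\<gamma> (u' - v') = \<gamma> (u - v)"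
proof -
  have cu: "cycle (Suc p) TU (u' - u)" using u b by (auto simp: singular_cycle chain_boundary_diff singular_chain_diff)
  have cv: "cycle (Suc p) TV (v' - v)" using v b by (auto simp: singular_cycle chain_boundary_diff singular_chain_diff)
  have c: "cycle (Suc p) TX (u - v)" "cycle (Suc p) TX (u' - v')" using glued_cycle u v b by auto
  have "\<gamma> ((u' - v') - (u - v)) = \<gamma> ((u' - u) - (v' - v))" by (simp add: algebra_simps)
  also have "\<dots> = 0"
    using hom_homology_diff[OF \<gamma> cycle_mono(3)[OF cu] cycle_mono(4)[OF cv]] eval_on_glued[OF \<gamma> r] cu cv by simp
  finally show ?thesis using hom_homology_diff[OF \<gamma> c(2,1)] by simp
qed

lemma glue_eval_eq:
  assumes \<gamma>: "\<gamma> \<in> HH (Suc p) (U \<union> V)" and r: "restrict_pair (Suc p) \<gamma> = (\<lambda>_. 0)"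
    and uv: "singular_chain (Suc p) TU u" "singular_chain (Suc p) TV v"
      "chain_boundary (Suc p) u = w" "chain_boundary (Suc p) v = w"
  shows "glue_eval p \<gamma> w = \<gamma> (u - v)"
proof -
  have w: "bounding p w" unfolding bounding_def singular_boundary using uv by blast
  show ?thesis using eval_glued_independent[OF \<gamma> r uv(1) bound_UV(1)[OF w] uv(2) bound_UV(3)[OF w]]
    by (simp add: glue_eval_def w bound_UV(2,4)[OF w] uv(3,4))
qed

text \<open>Up to homology every cycle of the union is glued, by subdivision.\<close>

lemma glue_eval_inj:
  assumes \<gamma>: "\<gamma> \<in> HH (Suc p) (U \<union> V)" and r: "restrict_pair (Suc p) \<gamma> = (\<lambda>_. 0)" and z: "glue_eval p \<gamma> = (\<lambda>_. 0)"
  shows "\<gamma> = (\<lambda>_. 0)"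
proof
  fix c
  show "\<gamma> c = 0"
  proof (cases "cycle (Suc p) TX c")
    case True
    obtain u v where uv: "singular_chain (Suc p) TU u" "singular_chain (Suc p) TV v"
      "bdry (Suc p) TX (c - (u + v))" "cycle (Suc p) TX (u + v)" by (rule small_cycle[OF True])
    have e: "chain_boundary (Suc p) u = chain_boundary (Suc p) (- v)"
      using uv(4) by (simp add: singular_cycle chain_boundary_add chain_boundary_minus eq_neg_iff_add_eq_0)
    have mv: "singular_chain (Suc p) TV (- v)" using uv(2) by (simp add: singular_chain_minus)
    have "\<gamma> c = \<gamma> (u - (- v))" using hom_homology_homologous[OF \<gamma> True uv(3)] by simp
    also have "\<dots> = 0"
      using glue_eval_eq[OF \<gamma> r uv(1) mv e refl] z by simp
    finally show ?thesis .
  qed (rule hom_homology_outside[OF \<gamma>])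
qed

text \<open>Exactness at \<open>H(U \<union> V)\<close>. From left to right, the evaluation on glued cycles vanishes at boundaries of
  the intersection, so it extends to the cycles of the intersection. From right to left, \<open>g (\<partial>u)\<close> is
  the value prescribed for a glued cycle \<open>u - v\<close>; if \<open>u - v\<close> bounds, then \<open>\<partial>u\<close> bounds in
  the intersection, so the prescription is consistent.\<close>

lemma range_glue_eval:
  "glue_eval p ` {\<gamma> \<in> HH (Suc p) (U \<union> V). restrict_pair (Suc p) \<gamma> = (\<lambda>_. 0)} = eval_bounding p ` HH p (U \<inter> V)"
proof (intro subset_antisym subsetI)
  fix k assume "k \<in> glue_eval p ` {\<gamma> \<in> HH (Suc p) (U \<union> V). restrict_pair (Suc p) \<gamma> = (\<lambda>_. 0)}"
  then obtain \<gamma> where \<gamma>: "\<gamma> \<in> HH (Suc p) (U \<union> V)" and r: "restrict_pair (Suc p) \<gamma> = (\<lambda>_. 0)" and k: "k = glue_eval p \<gamma>" by blast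
  obtain g where g: "g \<in> HH p (U \<inter> V)" "\<And>w. w \<in> Collect (bounding p) \<Longrightarrow> g w = k w"
  proof (rule hom_homology_extend[of "Collect (bounding p)" p TW k])
    show "k (w - w') = k w - k w'" if "w \<in> Collect (bounding p)" "w' \<in> Collect (bounding p)" for w w'
    proof -
      have w: "bounding p w" "bounding p w'" using that by auto
      note b = bound_UV[OF w(1)] bound_UV[OF w(2)]
      have "k (w - w') = \<gamma> ((bound_U p w - bound_U p w') - (bound_V p w - bound_V p w'))"
        unfolding k by (rule glue_eval_eq[OF \<gamma> r]) (auto simp: b chain_boundary_diff intro: singular_chain_diff)
      also have "\<dots> = \<gamma> ((bound_U p w - bound_V p w) - (bound_U p w' - bound_V p w'))"
        by (simp add: algebra_simps)
      also have "\<dots> = \<gamma> (bound_U p w - bound_V p w) - \<gamma> (bound_U p w' - bound_V p w')"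
        by (rule hom_homology_diff[OF \<gamma>]; rule glued_cycle) (simp_all add: b)
      finally show ?thesis by (simp add: k glue_eval_def w)
    qed
    show "k w = 0" if "w \<in> Collect (bounding p)" and w: "bdry p TW w" for w
    proof -
      obtain c where c: "singular_chain (Suc p) TW c" "chain_boundary (Suc p) c = w"
        using w unfolding singular_boundary by blast
      have "k w = \<gamma> (c - c)" unfolding k by (rule glue_eval_eq[OF \<gamma> r]) (use c chain_mono in auto)
      then show ?thesis using hom_homology_0[OF \<gamma>] by simp
    qed
  qed (use bounding_0 bounding_diff bounding_cycle in auto)
  have "eval_bounding p g = k" using g(2) by (auto simp: eval_bounding_def k glue_eval_def)
  then show "k \<in> eval_bounding p ` HH p (U \<inter> V)" using g(1) by blast
next
  fix k assume "k \<in> eval_bounding p ` HH p (U \<inter> V)"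
  then obtain g where g: "g \<in> HH p (U \<inter> V)" and k: "k = eval_bounding p g" by blast
  define P where "P x uv \<longleftrightarrow> singular_chain (Suc p) TU (fst uv) \<and> singular_chain (Suc p) TV (snd uv) \<and>
    chain_boundary (Suc p) (fst uv) = chain_boundary (Suc p) (snd uv) \<and> x = fst uv - snd uv" for x uv
  define f where "f x = g (chain_boundary (Suc p) (fst (SOME uv. P x uv)))" for x
  have bW: "bounding p (chain_boundary (Suc p) u)" if "P x (u, v)" for x u v
    unfolding bounding_def singular_boundary using that by (auto simp: P_def)
  have key: "g (chain_boundary (Suc p) u) = 0" if P: "P x (u, v)" and x: "bdry (Suc p) TX x" for x u v
  proof -
    have u: "singular_chain (Suc p) TU u" and v: "singular_chain (Suc p) TV (- v)" and e: "x = u + (- v)"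
      using P by (auto simp: P_def singular_chain_minus)
    obtain c d where cd: "singular_chain (Suc (Suc p)) TU c" "singular_chain (Suc (Suc p)) TV d"
      "u + (- v) = chain_boundary (Suc (Suc p)) c + chain_boundary (Suc (Suc p)) d"
      by (rule small_boundary[OF u v x[unfolded e]])
    let ?w = "u - chain_boundary (Suc (Suc p)) c"
    have "singular_chain (Suc p) TU ?w" using u cd(1) singular_chain_boundary_alt singular_chain_diff by blast
    moreover have "?w = chain_boundary (Suc (Suc p)) d - (- v)" using cd(3) by (simp add: algebra_simps)
    then have "singular_chain (Suc p) TV ?w"
      using v cd(2) singular_chain_boundary_alt singular_chain_diff by metis
    ultimately have w: "singular_chain (Suc p) TW ?w" by (rule chain_Int)
    have "chain_boundary (Suc p) ?w = chain_boundary (Suc p) u"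
      using chain_boundary_boundary_alt[OF cd(1)] by (simp add: chain_boundary_diff)
    then have "bdry p TW (chain_boundary (Suc p) u)" using w unfolding singular_boundary by metis
    then show ?thesis by (rule hom_homology_bdry[OF g])
  qed
  have Pd: "P (x - y) (u - u', v - v')" if "P x (u, v)" "P y (u', v')" for x y u v u' v'
    using that by (auto simp: P_def singular_chain_diff chain_boundary_diff algebra_simps)
  have gd: "g (chain_boundary (Suc p) (u - u')) = g (chain_boundary (Suc p) u) - g (chain_boundary (Suc p) u')"
    if "P x (u, v)" "P y (u', v')" for x y u v u' v'
    unfolding chain_boundary_diff
    by (rule hom_homology_diff[OF g bounding_cycle[OF bW[OF that(1)]] bounding_cycle[OF bW[OF that(2)]]])
  have f: "f x = g (chain_boundary (Suc p) u)" if P: "P x (u, v)" for x u v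
  proof -
    obtain u' v' where e: "(SOME uv. P x uv) = (u', v')" by fastforce
    have P': "P x (u', v')" unfolding e[symmetric] using P by (rule someI)
    have "P 0 (u - u', v - v')" using Pd[OF P P'] by simp
    then have "g (chain_boundary (Suc p) (u - u')) = 0" by (rule key) simp
    then show ?thesis using gd[OF P P'] by (simp add: f_def e)
  qed
  define G where "G = {x. \<exists>u v. P x (u, v)}"
  obtain \<gamma> where \<gamma>: "\<gamma> \<in> HH (Suc p) (U \<union> V)" "\<And>x. x \<in> G \<Longrightarrow> \<gamma> x = f x"
  proof (rule hom_homology_extend[of G "Suc p" TX f])
    show "0 \<in> G" by (auto simp: G_def P_def intro!: exI[of _ 0])
    show "x - y \<in> G" if "x \<in> G" "y \<in> G" for x y using that Pd unfolding G_def by blast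
    show "f (x - y) = f x - f y" if xy: "x \<in> G" "y \<in> G" for x y
    proof -
      obtain u v u' v' where P: "P x (u, v)" "P y (u', v')" using xy unfolding G_def by blast
      show ?thesis unfolding f[OF P(1)] f[OF P(2)] f[OF Pd[OF P]] by (rule gd[OF P])
    qed
    show "cycle (Suc p) TX x" if "x \<in> G" for x using that glued_cycle unfolding G_def P_def by auto
    show "f x = 0" if "x \<in> G" "bdry (Suc p) TX x" for x using that f key unfolding G_def by fastforce
  qed (rule that)
  have \<gamma>P: "\<gamma> x = g (chain_boundary (Suc p) u)" if "P x (u, v)" for x u v
  proof -
    have "x \<in> G" unfolding G_def using that by blast
    then show ?thesis using \<gamma>(2) f[OF that] by simp
  qed
  have "\<gamma> c = 0" if "cycle (Suc p) TU c" for c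
    using \<gamma>P[of c c 0] that hom_homology_0[OF g] by (simp add: P_def singular_cycle)
  moreover have "\<gamma> c = 0" if "cycle (Suc p) TV c" for c
    using \<gamma>P[of c 0 "- c"] that hom_homology_0[OF g]
    by (simp add: P_def singular_cycle singular_chain_minus chain_boundary_minus)
  ultimately have r: "restrict_pair (Suc p) \<gamma> = (\<lambda>_. 0)" by (auto simp: restrict_pair_def fun_eq_iff split: sum.split)
  have "glue_eval p \<gamma> w = k w" for w
  proof (cases "bounding p w")
    case True
    have "P (bound_U p w - bound_V p w) (bound_U p w, bound_V p w)" by (simp add: P_def bound_UV[OF True])
    from \<gamma>P[OF this] show ?thesis by (simp add: glue_eval_def k eval_bounding_def True bound_UV[OF True])
  qed (simp add: glue_eval_def k eval_bounding_def)
  then have "glue_eval p \<gamma> = k" by blast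
  then show "k \<in> glue_eval p ` {\<gamma> \<in> HH (Suc p) (U \<union> V). restrict_pair (Suc p) \<gamma> = (\<lambda>_. 0)}" using \<gamma>(1) r by blast
qed

lemma dim_kernel_restrict_pair:
  assumes w: "has_dim (HH p (U \<inter> V)) w" and r: "has_dim (overlap_diff p ` pair_space p) r"
  shows "r \<le> w" "has_dim {\<gamma> \<in> HH (Suc p) (U \<union> V). restrict_pair (Suc p) \<gamma> = (\<lambda>_. 0)} (w - r)"
proof -
  obtain k s where ks: "has_dim {g \<in> HH p (U \<inter> V). eval_bounding p g = (\<lambda>_. 0)} k"
    "has_dim (eval_bounding p ` HH p (U \<inter> V)) s" "k + s = w"
    by (rule rank_nullity[OF clinear_eval_bounding w])
  have k: "k = r" using has_dim_unique[OF ks(1)] r unfolding range_overlap_diff by blast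
  then show "r \<le> w" using ks(3) by simp
  have s: "s = w - r" using ks(3) k by simp
  show "has_dim {\<gamma> \<in> HH (Suc p) (U \<union> V). restrict_pair (Suc p) \<gamma> = (\<lambda>_. 0)} (w - r)"
    using ks(2) glue_eval_inj unfolding s range_glue_eval[symmetric]
    by (subst (asm) has_dim_inj_image_iff[OF clinear_glue_eval subspace_kernel_on[OF clinear_restrict_pair subspace_hom_homology]]) auto
qed

lemma restrict_pair_inj_0:
  assumes \<gamma>: "\<gamma> \<in> HH 0 (U \<union> V)" and r: "restrict_pair 0 \<gamma> = (\<lambda>_. 0)"
  shows "\<gamma> = (\<lambda>_. 0)"
proof
  fix c
  show "\<gamma> c = 0"
  proof (cases "cycle 0 TX c")
    case True
    obtain u v where uv: "singular_chain 0 TU u" "singular_chain 0 TV v" "bdry 0 TX (c - (u + v))"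
      by (rule small_cycle[OF True])
    have c: "cycle 0 TU u" "cycle 0 TV v" using uv by (auto simp: singular_cycle chain_boundary_def)
    have "\<gamma> c = \<gamma> (u + v)" by (rule hom_homology_homologous[OF \<gamma> True uv(3)])
    also have "\<dots> = 0"
      using hom_homology_add[OF \<gamma> cycle_mono(3)[OF c(1)] cycle_mono(4)[OF c(2)]] eval_on_glued[OF \<gamma> r] c by simp
    finally show ?thesis .
  qed (rule hom_homology_outside[OF \<gamma>])
qed

text \<open>The exact sequence reduced to dimensions: the cohomology of the union is the cokernel of the difference
  map in degree \<open>p\<close> together with its kernel in degree \<open>p + 1\<close>.\<close>

theorem mayer_vietoris_dim:
  assumes w: "has_dim (HH p (U \<inter> V)) w" and r: "has_dim (overlap_diff p ` pair_space p) r"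
    and a: "has_dim (HH (Suc p) U) a" and b: "has_dim (HH (Suc p) V) b"
    and s: "has_dim (overlap_diff (Suc p) ` pair_space (Suc p)) s"
  shows "s \<le> a + b" "has_dim (HH (Suc p) (U \<union> V)) ((w - r) + (a + b - s))"
proof -
  obtain k s' where ks: "has_dim {h \<in> pair_space (Suc p). overlap_diff (Suc p) h = (\<lambda>_. 0)} k"
    "has_dim (overlap_diff (Suc p) ` pair_space (Suc p)) s'" "k + s' = a + b"
    by (rule rank_nullity[OF clinear_overlap_diff has_dim_prod[OF a b]])
  have s': "s' = s" using has_dim_unique[OF ks(2) s] .
  then show "s \<le> a + b" using ks(3) by simp
  have "k = a + b - s" using ks(3) s' by simp
  then have "has_dim (restrict_pair (Suc p) ` HH (Suc p) (U \<union> V)) (a + b - s)" unfolding range_restrict_pair using ks(1) by simp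
  then show "has_dim (HH (Suc p) (U \<union> V)) ((w - r) + (a + b - s))"
    by (rule rank_nullity_kernel_image[OF clinear_restrict_pair subspace_hom_homology dim_kernel_restrict_pair(2)[OF w r]])
qed

theorem mayer_vietoris_dim_0:
  assumes a: "has_dim (HH 0 U) a" and b: "has_dim (HH 0 V) b" and s: "has_dim (overlap_diff 0 ` pair_space 0) s"
  shows "s \<le> a + b" "has_dim (HH 0 (U \<union> V)) (a + b - s)"
proof -
  obtain k s' where ks: "has_dim {h \<in> pair_space 0. overlap_diff 0 h = (\<lambda>_. 0)} k"
    "has_dim (overlap_diff 0 ` pair_space 0) s'" "k + s' = a + b"
    by (rule rank_nullity[OF clinear_overlap_diff has_dim_prod[OF a b]])
  have s': "s' = s" using has_dim_unique[OF ks(2) s] .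
  then show "s \<le> a + b" using ks(3) by simp
  have "k = a + b - s" using ks(3) s' by simp
  then have "has_dim (restrict_pair 0 ` HH 0 (U \<union> V)) (a + b - s)" unfolding range_restrict_pair using ks(1) by simp
  then show "has_dim (HH 0 (U \<union> V)) (a + b - s)"
    by (simp only: has_dim_inj_image_iff[OF clinear_restrict_pair subspace_hom_homology restrict_pair_inj_0])
qed

text \<open>This runs the sequence backwards. When a set is removed from a known union, finiteness for the
  unknown piece \<open>U\<close> follows from that of the union and the intersection.\<close>

lemma mayer_vietoris_finite:
  assumes n: "has_dim (HH p (U \<union> V)) n" and w: "has_dim (HH p (U \<inter> V)) w"
  obtains a s where "has_dim (HH p U) a" "has_dim (overlap_diff p ` pair_space p) s" "s \<le> w"
proof -
  have sub: "cfun.subspace (pair_space p)"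
    using subspace_hom_homology unfolding subspace_iff by auto
  obtain k where "has_dim (restrict_pair p ` HH p (U \<union> V)) k" using rank_nullity[OF clinear_restrict_pair n] by metis
  then have k: "has_dim {h \<in> pair_space p. overlap_diff p h = (\<lambda>_. 0)} k" unfolding range_restrict_pair .
  have "cfun.subspace (overlap_diff p ` pair_space p)" by (rule cfun_pair.linear_subspace_image[OF clinear_overlap_diff sub])
  moreover have "overlap_diff p ` pair_space p \<subseteq> HH p (U \<inter> V)" using overlap_diff_in by blast
  ultimately obtain s where s: "s \<le> w" "has_dim (overlap_diff p ` pair_space p) s" using has_dim_mono[OF w] by blast
  have ks: "has_dim (pair_space p) (k + s)" by (rule rank_nullity_kernel_image[OF clinear_overlap_diff sub k s(2)])
  let ?e = "\<lambda>f. case_sum f (\<lambda>_. 0) :: 'a chain + 'a chain \<Rightarrow> complex"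
  have e: "clinear ?e" by (rule clinearI) (auto simp: fun_eq_iff split: sum.split)
  have "cfun.subspace (?e ` HH p U)" by (rule cfun_pair.linear_subspace_image[OF e subspace_hom_homology])
  moreover have "?e ` HH p U \<subseteq> pair_space p"
    using subspace_hom_homology[of p TV] by (auto simp: subspace_iff)
  ultimately obtain a where "has_dim (?e ` HH p U) a" using has_dim_mono[OF ks] by blast
  then have "has_dim (HH p U) a"
    by (subst (asm) has_dim_inj_image_iff[OF e subspace_hom_homology]) (auto simp: fun_eq_iff split: sum.splits)
  then show ?thesis using that s by blast
qed

end

section \<open>Dimensions of the cohomology of some open sets\<close>

lemma HH_empty: "has_dim (HH p ({} :: 'a::topological_space set)) 0"
proof -
  have "g = (\<lambda>_. 0)" if g: "g \<in> HH p ({} :: 'a set)" for g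
  proof
    fix c
    show "g c = 0"
      using hom_homology_outside[OF g, of c] hom_homology_0[OF g]
      by (cases "c = 0") (auto simp: singular_cycle singular_chain_empty)
  qed
  moreover have "(\<lambda>_. 0) \<in> HH p ({} :: 'a set)" using subspace_hom_homology unfolding subspace_iff by blast
  ultimately have "HH p ({} :: 'a set) = {\<lambda>_. 0}" by blast
  then show ?thesis by (simp add: has_dim_0)
qed

text \<open>All homotopy equivalences below are realised by straight line homotopies.\<close>

lemma HH_linear_homotopy_equivalence:
  fixes S :: "'a::real_normed_vector set" and T :: "'b::real_normed_vector set"
  assumes f: "continuous_on S f" "f ` S \<subseteq> T" and k: "continuous_on T k" "k ` T \<subseteq> S"
    and kf: "\<And>x. x \<in> S \<Longrightarrow> closed_segment (k (f x)) x \<subseteq> S"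
    and fk: "\<And>y. y \<in> T \<Longrightarrow> closed_segment (f (k y)) y \<subseteq> T"
  shows "hpull p S f ` HH p T = HH p S" and "has_dim (HH p S) n \<longleftrightarrow> has_dim (HH p T) n"
proof -
  have 1: "continuous_map (top_of_set S) (top_of_set T) f" "continuous_map (top_of_set T) (top_of_set S) k"
    using f k by auto
  have 2: "homotopic_with (\<lambda>_. True) (top_of_set S) (top_of_set S) (k \<circ> f) id"
    by (rule homotopic_with_linear) (use continuous_on_compose2[OF k(1) f] kf in \<open>auto simp: o_def\<close>)
  have 3: "homotopic_with (\<lambda>_. True) (top_of_set T) (top_of_set T) (f \<circ> k) id"
    by (rule homotopic_with_linear) (use continuous_on_compose2[OF f(1) k] fk in \<open>auto simp: o_def\<close>)
  show "hpull p S f ` HH p T = HH p S" "has_dim (HH p S) n \<longleftrightarrow> has_dim (HH p T) n"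
    using pull_homotopy_equivalence[OF 1 2 3] by auto
qed

lemma HH_starlike:
  fixes S :: "'a::real_normed_vector set"
  assumes b: "b \<in> S" "\<And>x. x \<in> S \<Longrightarrow> closed_segment b x \<subseteq> S"
  shows "has_dim (HH 0 S) 1" "p > 0 \<Longrightarrow> has_dim (HH p S) 0"
proof -
  have "has_dim (HH p S) n \<longleftrightarrow> has_dim (HH p {b}) n" for p n
    by (rule HH_linear_homotopy_equivalence(2)[where f = "\<lambda>_. b" and k = "\<lambda>x. x"]) (use b in auto)
  then show "has_dim (HH 0 S) 1" "p > 0 \<Longrightarrow> has_dim (HH p S) 0"
    using HH_singleton by blast+
qed

text \<open>A constant map to a point splits the inclusion of the point.\<close>

lemma HH_0_pos:
  fixes S :: "'a::topological_space set"
  assumes x: "x \<in> S" and n: "has_dim (HH 0 S) n"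
  shows "n > 0"
proof (rule ccontr)
  assume "\<not> n > 0"
  then have S: "HH 0 S = {\<lambda>_. 0}" using n has_dim_0_iff by auto
  have c: "continuous_map (top_of_set S) (top_of_set {x}) (\<lambda>_. x)"
    "continuous_map (top_of_set {x}) (top_of_set S) (\<lambda>y. y)" using x by auto
  have "g = (\<lambda>_. 0)" if g: "g \<in> HH 0 {x}" for g
  proof -
    have "hpull 0 S (\<lambda>_. x) g = (\<lambda>_. 0)" using pull_in[OF c(1) g] S by blast
    then have "hpull 0 {x} (\<lambda>y. y) (hpull 0 S (\<lambda>_. x) g) = (\<lambda>_. 0)" by (simp add: pull_zero)
    moreover have "hpull 0 {x} (\<lambda>y. y) (hpull 0 S (\<lambda>_. x) g) = g"
      unfolding pull_pull[OF c(2)] by (rule pull_id[OF g]) simp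
    ultimately show ?thesis by simp
  qed
  then have "HH 0 {x} = {\<lambda>_. 0}" using cfun.subspace_0[OF subspace_hom_homology] by (auto simp: zero_fun_def)
  then have "has_dim (HH 0 {x}) 0" by (simp add: has_dim_0)
  then show False using has_dim_unique[OF HH_singleton(2)[of x]] by fastforce
qed

lemma (in open_cover) has_dim_range_overlap_diff:
  assumes w: "has_dim (HH p (U \<inter> V)) w"
  obtains s where "s \<le> w" "has_dim (overlap_diff p ` pair_space p) s"
proof -
  have "cfun.subspace (pair_space p)" using subspace_hom_homology unfolding subspace_iff by auto
  then have "cfun.subspace (overlap_diff p ` pair_space p)" by (rule cfun_pair.linear_subspace_image[OF clinear_overlap_diff])
  moreover have "overlap_diff p ` pair_space p \<subseteq> HH p (U \<inter> V)" using overlap_diff_in by blast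
  ultimately show ?thesis using has_dim_mono[OF w] that by blast
qed

lemma HH_disjoint_union:
  fixes U V :: "'a::topological_space set"
  assumes o: "open U" "open V" and d: "U \<inter> V = {}"
    and a: "has_dim (HH p U) a" and b: "has_dim (HH p V) b"
  shows "has_dim (HH p (U \<union> V)) (a + b)"
proof -
  interpret open_cover U V using o by unfold_locales
  have w: "has_dim (HH q (U \<inter> V)) 0" for q unfolding d by (rule HH_empty)
  have r: "has_dim (overlap_diff q ` pair_space q) 0" for q
  proof -
    obtain s where "s \<le> 0" "has_dim (overlap_diff q ` pair_space q) s" by (rule has_dim_range_overlap_diff[OF w])
    then show ?thesis by simp
  qed
  show ?thesis
  proof (cases p)
    case 0
    then show ?thesis using mayer_vietoris_dim_0(2)[OF a[unfolded 0] b[unfolded 0] r] by simp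
  next
    case (Suc q)
    then show ?thesis using mayer_vietoris_dim(2)[OF w r a[unfolded Suc] b[unfolded Suc] r] by simp
  qed
qed

subsection \<open>The product with the punctured plane\<close>

lemma HH_product_starlike:
  fixes S :: "'a::real_normed_vector set" and T :: "'b::real_normed_vector set"
  assumes b: "b \<in> T" "\<And>x. x \<in> T \<Longrightarrow> closed_segment b x \<subseteq> T"
  shows "hpull p (S \<times> T) fst ` HH p S = HH p (S \<times> T)" "has_dim (HH p (S \<times> T)) n \<longleftrightarrow> has_dim (HH p S) n"
proof -
  have seg: "closed_segment (x, b) (x, y) \<subseteq> S \<times> T" if "x \<in> S" "y \<in> T" for x y
  proof
    fix z assume z: "z \<in> closed_segment (x, b) (x, y)"
    then obtain u where u: "0 \<le> u" "u \<le> 1" "z = (1 - u) *\<^sub>R (x, b) + u *\<^sub>R (x, y)" by (auto simp: in_segment)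
    have "fst z = x" unfolding u(3) by (simp add: algebra_simps)
    moreover have "snd z \<in> closed_segment b y" using u by (auto simp: in_segment)
    ultimately show "z \<in> S \<times> T" using b(2)[OF that(2)] that(1) by (cases z) auto
  qed
  have c: "continuous_on (S \<times> T) fst" "continuous_on S (\<lambda>x. (x, b))" by (intro continuous_intros)+
  have i: "fst ` (S \<times> T) \<subseteq> S" "(\<lambda>x. (x, b)) ` S \<subseteq> S \<times> T" using b by auto
  have s1: "closed_segment (fst z, b) z \<subseteq> S \<times> T" if "z \<in> S \<times> T" for z
    using seg[of "fst z" "snd z"] that by (simp add: mem_Times_iff)
  have s2: "closed_segment (fst (x, b)) x \<subseteq> S" if "x \<in> S" for x using that by simp
  show "hpull p (S \<times> T) fst ` HH p S = HH p (S \<times> T)" "has_dim (HH p (S \<times> T)) n \<longleftrightarrow> has_dim (HH p S) n"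
    using HH_linear_homotopy_equivalence[OF c(1) i(1) c(2) i(2) s1 s2] by blast+
qed

definition plane_minus_neg :: "complex set" where
  "plane_minus_neg = {z. \<not> (Im z = 0 \<and> Re z \<le> 0)}"

definition plane_minus_pos :: "complex set" where
  "plane_minus_pos = {z. \<not> (Im z = 0 \<and> 0 \<le> Re z)}"

lemma open_slit_planes: "open plane_minus_neg" "open plane_minus_pos"
proof -
  have c: "closed {z. Im z = 0 \<and> Re z \<le> 0}" "closed {z. Im z = 0 \<and> 0 \<le> Re z}"
    by (intro closed_Collect_conj closed_Collect_eq closed_Collect_le continuous_intros)+
  show "open plane_minus_neg" unfolding plane_minus_neg_def by (rule open_Collect_neg[OF c(1)])
  show "open plane_minus_pos" unfolding plane_minus_pos_def by (rule open_Collect_neg[OF c(2)])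
qed

lemma slit_planes_Un: "plane_minus_neg \<union> plane_minus_pos = - {0}"
  by (auto simp: plane_minus_neg_def plane_minus_pos_def complex_eq_iff)

lemma slit_planes_Int: "plane_minus_neg \<inter> plane_minus_pos = {z. Im z > 0} \<union> {z. Im z < 0}"
  by (auto simp: plane_minus_neg_def plane_minus_pos_def)

lemma slit_plane_starlike:
  "x \<in> plane_minus_neg \<Longrightarrow> closed_segment 1 x \<subseteq> plane_minus_neg"
  "x \<in> plane_minus_pos \<Longrightarrow> closed_segment (- 1) x \<subseteq> plane_minus_pos"
proof -
  have pos: "(1 - u) + u * r > 0" if "0 \<le> u" "u \<le> 1" "r > 0" for u r :: real
    using that by (cases "u = 1") (auto intro!: add_pos_nonneg)
  show "closed_segment 1 x \<subseteq> plane_minus_neg" if x: "x \<in> plane_minus_neg"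
  proof
    fix z assume "z \<in> closed_segment 1 x"
    then obtain u where u: "0 \<le> u" "u \<le> 1" "z = (1 - u) *\<^sub>R 1 + u *\<^sub>R x" by (auto simp: in_segment)
    show "z \<in> plane_minus_neg"
    proof (cases "Im x = 0")
      case True
      then have "Re x > 0" using x by (auto simp: plane_minus_neg_def)
      then show ?thesis using pos[OF u(1,2)] by (simp add: plane_minus_neg_def u(3) not_le)
    next
      case False
      then show ?thesis by (cases "u = 0") (auto simp: plane_minus_neg_def u(3))
    qed
  qed
  show "closed_segment (- 1) x \<subseteq> plane_minus_pos" if x: "x \<in> plane_minus_pos"
  proof
    fix z assume "z \<in> closed_segment (- 1) x"
    then obtain u where u: "0 \<le> u" "u \<le> 1" "z = (1 - u) *\<^sub>R (- 1) + u *\<^sub>R x" by (auto simp: in_segment)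
    show "z \<in> plane_minus_pos"
    proof (cases "Im x = 0")
      case True
      then have "- Re x > 0" using x by (auto simp: plane_minus_pos_def)
      from pos[OF u(1,2) this] have "Re z < 0" by (simp add: u(3))
      then show ?thesis by (simp add: plane_minus_pos_def)
    next
      case False
      then show ?thesis by (cases "u = 0") (auto simp: plane_minus_pos_def u(3))
    qed
  qed
qed

text \<open>The Kuenneth formula for the product with a circle. The punctured plane is the union of two slit planes,
  which are star-shaped, and these intersect in two half planes. So the open pieces have
  the cohomology of \<open>Y\<close>, the intersection has two copies of it, and the difference map has the diagonal
  copy as its image.\<close>

lemma HH_product_punctured_plane:
  fixes Y :: "'a::real_normed_vector set"
  assumes Y: "open Y"
  shows "has_dim (HH 0 Y) a \<Longrightarrow> has_dim (HH 0 (Y \<times> - {0 :: complex})) a"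
    and "has_dim (HH p Y) a \<Longrightarrow> has_dim (HH (Suc p) Y) b \<Longrightarrow> has_dim (HH (Suc p) (Y \<times> - {0 :: complex})) (a + b)"
proof -
  let ?U = "Y \<times> plane_minus_neg" and ?V = "Y \<times> plane_minus_pos"
  let ?A = "{z. Im z > 0}" and ?B = "{z. Im z < 0}"
  interpret open_cover ?U ?V
    by unfold_locales (use Y open_slit_planes open_Times in auto)
  have Un: "?U \<union> ?V = Y \<times> - {0}" using slit_planes_Un by blast
  have Int: "?U \<inter> ?V = Y \<times> ?A \<union> Y \<times> ?B" using slit_planes_Int by blast
  have U: "hpull q ?U fst ` HH q Y = HH q ?U" "has_dim (HH q ?U) n \<longleftrightarrow> has_dim (HH q Y) n" for q n
    by (rule HH_product_starlike[where b = 1]; use slit_plane_starlike(1) in \<open>auto simp: plane_minus_neg_def\<close>)+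
  have V: "hpull q ?V fst ` HH q Y = HH q ?V" "has_dim (HH q ?V) n \<longleftrightarrow> has_dim (HH q Y) n" for q n
    by (rule HH_product_starlike[where b = "- 1"]; use slit_plane_starlike(2) in \<open>auto simp: plane_minus_pos_def\<close>)+
  have seg: "closed_segment z w \<subseteq> S" if "z \<in> S" "w \<in> S" "convex S" for z w :: complex and S
    using that by (simp add: closed_segment_subset)
  have cvx: "convex ?A" "convex ?B" by (rule convex_halfspace_Im_gt convex_halfspace_Im_lt)+
  have A: "has_dim (HH q (Y \<times> ?A)) n \<longleftrightarrow> has_dim (HH q Y) n" for q n
    by (rule HH_product_starlike(2)[where b = "\<i>"]) (use seg[OF _ _ cvx(1)] in auto)
  have B: "has_dim (HH q (Y \<times> ?B)) n \<longleftrightarrow> has_dim (HH q Y) n" for q n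
    by (rule HH_product_starlike(2)[where b = "- \<i>"]) (use seg[OF _ _ cvx(2)] in auto)
  have opn: "open ?A" "open ?B" by (intro open_Collect_less continuous_intros)+
  have W: "has_dim (HH q (?U \<inter> ?V)) (n + n)" if "has_dim (HH q Y) n" for q n
    unfolding Int
    by (rule HH_disjoint_union[OF open_Times[OF Y opn(1)] open_Times[OF Y opn(2)] _
          A[THEN iffD2, OF that] B[THEN iffD2, OF that]]) auto
  have fstW: "continuous_map TW (top_of_set Y) fst" by (auto intro!: continuous_intros)
  \<comment> \<open>A section of the projection; it shows that the diagonal copy embeds.\<close>
  have sec: "continuous_map (top_of_set Y) TW (\<lambda>y. (y, \<i>))"
    by (auto simp: plane_minus_neg_def plane_minus_pos_def intro!: continuous_intros)
  have img: "overlap_diff q ` pair_space q = pull q TW fst ` HH q Y" for q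
  proof (intro subset_antisym subsetI)
    fix k assume "k \<in> overlap_diff q ` pair_space q"
    then obtain h where h: "h \<in> pair_space q" "k = overlap_diff q h" by blast
    have "(\<lambda>c. h (Inl c)) \<in> pull q TU fst ` HH q Y" using h(1) unfolding U(1) by simp
    then obtain g where g: "g \<in> HH q Y" "(\<lambda>c. h (Inl c)) = pull q TU fst g" by blast
    have "(\<lambda>c. h (Inr c)) \<in> pull q TV fst ` HH q Y" using h(1) unfolding V(1) by simp
    then obtain g' where g': "g' \<in> HH q Y" "(\<lambda>c. h (Inr c)) = pull q TV fst g'" by blast
    have "k = pull q TW fst (g - g')"
      unfolding h(2)
    proof
      fix c
      show "overlap_diff q h c = pull q TW fst (g - g') c"
        using fun_cong[OF g(2), of c] fun_cong[OF g'(2), of c] cycle_mono(1,2)[of q c]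
        by (simp add: overlap_diff_def pull_def)
    qed
    then show "k \<in> pull q TW fst ` HH q Y" using cfun.subspace_diff[OF subspace_hom_homology g(1) g'(1)] by blast
  next
    fix k assume "k \<in> pull q TW fst ` HH q Y"
    then obtain g where g: "g \<in> HH q Y" "k = pull q TW fst g" by blast
    let ?h = "case_sum (pull q TU fst g) (\<lambda>_. 0)"
    have "?h \<in> pair_space q"
      using U(1)[of q] g(1) subspace_hom_homology[of q TV] by (auto simp: subspace_iff)
    moreover have "overlap_diff q ?h = k" using cycle_mono(1) by (auto simp: overlap_diff_def g(2) pull_def fun_eq_iff)
    ultimately show "k \<in> overlap_diff q ` pair_space q" by blast
  qed
  have rank: "has_dim (overlap_diff q ` pair_space q) n" if "has_dim (HH q Y) n" for q n
  proof -
    have "g = (\<lambda>_. 0)" if g: "g \<in> HH q Y" "pull q TW fst g = (\<lambda>_. 0)" for g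
    proof -
      have "hpull q Y (\<lambda>y. (y, \<i>)) (pull q TW fst g) = g"
        unfolding pull_pull[OF sec] by (rule pull_id[OF g(1)]) simp
      then show ?thesis by (simp add: g(2) pull_zero)
    qed
    then show ?thesis using that has_dim_inj_image_iff[OF clinear_pull subspace_hom_homology] unfolding img by blast
  qed
  show "has_dim (HH 0 (Y \<times> - {0 :: complex})) a" if "has_dim (HH 0 Y) a"
    using mayer_vietoris_dim_0(2)[OF U(2)[THEN iffD2] V(2)[THEN iffD2] rank, OF that that that] by (simp add: Un)
  show "has_dim (HH (Suc p) (Y \<times> - {0 :: complex})) (a + b)"
    if a: "has_dim (HH p Y) a" and b: "has_dim (HH (Suc p) Y) b"
    using mayer_vietoris_dim(2)[OF W[OF a] rank[OF a] U(2)[THEN iffD2, OF b] V(2)[THEN iffD2, OF b] rank[OF b]]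
    by (simp add: Un)
qed

subsection \<open>The punctured plane\<close>

text \<open>For \<open>r > 0\<close>, a homeomorphism from the plane to the open disc of radius \<open>r\<close> that preserves rays.\<close>

definition shrink :: "real \<Rightarrow> complex \<Rightarrow> complex" where
  "shrink r b = of_real (r / (1 + norm b)) * b"

lemma shrink_pos: "r > 0 \<Longrightarrow> r / (1 + norm (b :: complex)) > 0"
  by (intro divide_pos_pos add_pos_nonneg) auto

lemma norm_shrink: "r > 0 \<Longrightarrow> norm (shrink r b) < r"
proof -
  assume r: "r > 0"
  have "r * norm b < r * (1 + norm b)" using r by simp
  then have "r / (1 + norm b) * norm b < r" by (simp add: field_simps add_pos_nonneg)
  then show ?thesis using shrink_pos[OF r, of b] by (simp only: shrink_def norm_mult norm_of_real abs_of_pos)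
qed

lemma shrink_nz: "r > 0 \<Longrightarrow> b \<noteq> 0 \<Longrightarrow> shrink r b \<noteq> 0"
  using shrink_pos[of r b] unfolding shrink_def by (metis less_irrefl mult_eq_0_iff of_real_eq_0_iff)

lemma continuous_on_shrink:
  assumes "continuous_on S r" "continuous_on S b"
  shows "continuous_on S (\<lambda>x. shrink (r x) (b x))"
proof -
  have "1 + norm (b x) \<noteq> 0" for x using norm_ge_zero[of "b x"] by linarith
  then show ?thesis unfolding shrink_def using assms by (intro continuous_intros) auto
qed

lemma closed_segment_shrink:
  assumes v: "v \<in> closed_segment (shrink r b) b" and r: "r > 0"
  shows "norm v \<le> max (norm (shrink r b)) (norm b)" and "b \<noteq> 0 \<Longrightarrow> v \<noteq> 0"
proof -
  define c where "c = r / (1 + norm b)"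
  have c: "c > 0" unfolding c_def by (rule shrink_pos[OF r])
  obtain u where u: "0 \<le> u" "u \<le> 1" "v = (1 - u) *\<^sub>R shrink r b + u *\<^sub>R b"
    using v by (auto simp: in_segment)
  have "norm v \<le> (1 - u) * norm (shrink r b) + u * norm b"
    unfolding u(3) using u(1,2) by (intro norm_triangle_le) simp
  also have "\<dots> \<le> (1 - u) * max (norm (shrink r b)) (norm b) + u * max (norm (shrink r b)) (norm b)"
    using u by (intro add_mono mult_left_mono) auto
  finally show "norm v \<le> max (norm (shrink r b)) (norm b)" by (simp add: algebra_simps)
  have "shrink r b = of_real c * b" by (simp only: shrink_def c_def)
  then have "v = of_real ((1 - u) * c + u) * b"
    unfolding u(3) by (simp add: scaleR_conv_of_real algebra_simps)
  moreover have "(1 - u) * c + u > 0" using u(1,2) c by (cases "u = 0") (auto intro!: add_nonneg_pos)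
  ultimately show "v \<noteq> 0" if "b \<noteq> 0" using that by (metis less_irrefl mult_eq_0_iff of_real_eq_0_iff)
qed

text \<open>A circle up to homotopy, written as a product to which the Kuenneth formula applies.\<close>

abbreviation plane_times_punctured :: "(complex \<times> complex) set" where
  "plane_times_punctured \<equiv> UNIV \<times> - {0}"

lemma HH_plane: "has_dim (HH 0 (UNIV :: 'a::real_normed_vector set)) 1"
  "p > 0 \<Longrightarrow> has_dim (HH p (UNIV :: 'a::real_normed_vector set)) 0"
  by (rule HH_starlike[of 0]; simp)+

lemma HH_plane_times_punctured:
  "has_dim (HH 0 plane_times_punctured) 1" "has_dim (HH 1 plane_times_punctured) 1"
  "p > 1 \<Longrightarrow> has_dim (HH p plane_times_punctured) 0"
proof -
  show "has_dim (HH 0 plane_times_punctured) 1"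
    by (rule HH_product_punctured_plane(1)[OF open_UNIV HH_plane(1)])
  have "has_dim (HH (Suc 0) plane_times_punctured) (1 + 0)"
    by (rule HH_product_punctured_plane(2)[OF open_UNIV HH_plane(1) HH_plane(2)]) simp
  then show "has_dim (HH 1 plane_times_punctured) 1" by simp
  assume "p > 1"
  then obtain q where q: "p = Suc q" "q > 0" by (cases p) auto
  have "has_dim (HH (Suc q) plane_times_punctured) (0 + 0)"
    by (rule HH_product_punctured_plane(2)[OF open_UNIV HH_plane(2) HH_plane(2)]) (use q in auto)
  then show "has_dim (HH p plane_times_punctured) 0" by (simp add: q)
qed

lemma HH_punctured_disc:
  fixes x :: complex
  assumes r: "r > 0"
  shows "has_dim (HH p (ball x r - {x})) n \<longleftrightarrow> has_dim (HH p plane_times_punctured) n"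
proof (rule HH_linear_homotopy_equivalence(2)[where f = "\<lambda>z. (0, z - x)" and k = "\<lambda>w. x + shrink r (snd w)"])
  show "continuous_on (ball x r - {x}) (\<lambda>z. (0, z - x))" by (intro continuous_intros)
  show "(\<lambda>z. (0, z - x)) ` (ball x r - {x}) \<subseteq> plane_times_punctured" by auto
  show "continuous_on plane_times_punctured (\<lambda>w. x + shrink r (snd w))"
    by (intro continuous_intros continuous_on_shrink)
  show "(\<lambda>w. x + shrink r (snd w)) ` plane_times_punctured \<subseteq> ball x r - {x}"
    using norm_shrink[OF r] shrink_nz[OF r] by (auto simp: dist_norm)
  show "closed_segment (x + shrink r (snd (0 :: complex, z - x))) z \<subseteq> ball x r - {x}" if z: "z \<in> ball x r - {x}" for z
  proof
    fix v assume v: "v \<in> closed_segment (x + shrink r (snd (0 :: complex, z - x))) z"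
    have s: "v - x \<in> closed_segment (shrink r (z - x)) (z - x)"
      using v closed_segment_translation[of "- x" "x + shrink r (z - x)" z] by force
    have "norm (v - x) < r"
      using closed_segment_shrink(1)[OF s r] norm_shrink[OF r, of "z - x"] z by (auto simp: dist_norm norm_minus_commute)
    moreover have "v \<noteq> x" using closed_segment_shrink(2)[OF s r] z by auto
    ultimately show "v \<in> ball x r - {x}" by (simp add: dist_norm norm_minus_commute)
  qed
  show "closed_segment (0, x + shrink r (snd y) - x) y \<subseteq> plane_times_punctured" if y: "y \<in> plane_times_punctured" for y
  proof
    fix v assume "v \<in> closed_segment (0, x + shrink r (snd y) - x) y"
    then have s: "snd v \<in> closed_segment (shrink r (snd y)) (snd y)" by (auto simp: in_segment)
    have "snd v \<noteq> 0" using closed_segment_shrink(2)[OF s r] y by auto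
    then show "v \<in> plane_times_punctured" by (simp add: mem_Times_iff)
  qed
qed

text \<open>By induction on \<open>P\<close>: the plane without \<open>P\<close> is the union of the plane without \<open>P \<union> {x}\<close> and a disc around \<open>x\<close>, with a
  punctured disc as intersection. The vanishing of \<open>H\<^sup>2\<close> of the union forces the generator of the punctured
  disc to come from the larger complement, whose first Betti number therefore is one higher.\<close>

lemma HH_punctured_plane:
  fixes P :: "complex set"
  assumes "finite P"
  shows "has_dim (HH 0 (- P)) 1 \<and> has_dim (HH 1 (- P)) (card P) \<and> (\<forall>p>1. has_dim (HH p (- P)) 0)"
  using assms
proof (induction P)
  case empty
  show ?case using HH_plane[where 'a = complex] by simp
next
  case (insert x P)
  obtain r where r: "r > 0" "ball x r \<subseteq> - P"
    using finite_imp_closed[OF insert.hyps(1)] insert.hyps(2) open_contains_ball[of "- P"] by (auto simp: open_Compl)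
  let ?U = "- insert x P" and ?V = "ball x r"
  interpret open_cover ?U ?V
    by unfold_locales (use insert.hyps in \<open>auto intro!: open_Compl finite_imp_closed\<close>)
  have Un: "?U \<union> ?V = - P" using r insert.hyps(2) by auto
  have Int: "?U \<inter> ?V = ?V - {x}" using r by auto
  have "x \<in> ?V" and seg: "\<And>y. y \<in> ?V \<Longrightarrow> closed_segment x y \<subseteq> ?V"
    using closed_segment_subset[OF _ _ convex_ball] r(1) by (meson centre_in_ball)+
  note V1 = HH_starlike(1)[OF this] and V2 = HH_starlike(2)[OF this]
  have W: "has_dim (HH 0 (?U \<inter> ?V)) 1" "has_dim (HH 1 (?U \<inter> ?V)) 1" "p > 1 \<Longrightarrow> has_dim (HH p (?U \<inter> ?V)) 0" for p
    unfolding Int HH_punctured_disc[OF r(1)] by (rule HH_plane_times_punctured; assumption?)+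
  have X: "has_dim (HH 0 (?U \<union> ?V)) 1" "has_dim (HH 1 (?U \<union> ?V)) (card P)" "p > 1 \<Longrightarrow> has_dim (HH p (?U \<union> ?V)) 0" for p
    unfolding Un using insert.IH by auto
  obtain a0 s0 where 0: "has_dim (HH 0 ?U) a0" "has_dim (overlap_diff 0 ` pair_space 0) s0" "s0 \<le> 1"
    by (rule mayer_vietoris_finite[OF X(1) W(1)])
  obtain a1 s1 where 1: "has_dim (HH 1 ?U) a1" "has_dim (overlap_diff 1 ` pair_space 1) s1" "s1 \<le> 1"
    by (rule mayer_vietoris_finite[OF X(2) W(2)])
  obtain y where y: "y \<in> ?U"
    using ex_new_if_finite[OF infinite_UNIV_char_0, of "insert x P"] insert.hyps(1) by auto
  have a0: "a0 = 1" "s0 = 1"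
  proof -
    have "a0 + 1 - s0 = 1"
      using has_dim_unique[OF mayer_vietoris_dim_0(2)[OF 0(1) V1 0(2)] X(1)] by simp
    then show "a0 = 1" "s0 = 1" using 0(3) HH_0_pos[OF y 0(1)] by auto
  qed
  have e1: "a1 - s1 = card P" "s1 \<le> a1"
  proof -
    have "has_dim (HH (Suc 0) (?U \<union> ?V)) ((1 - s0) + (a1 + 0 - s1))" and le: "s1 \<le> a1 + 0"
      by (rule mayer_vietoris_dim[OF W(1) 0(2) _ V2]; use 1 in simp)+
    then have "(1 - s0) + (a1 + 0 - s1) = card P" using has_dim_unique X(2) unfolding One_nat_def by blast
    then show "a1 - s1 = card P" "s1 \<le> a1" using a0 le by auto
  qed
  have high: "has_dim (HH p ?U) 0 \<and> (p = 2 \<longrightarrow> s1 = 1)" if p: "p > 1" for p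
  proof -
    obtain q where q: "p = Suc q" "q \<ge> 1" using p by (cases p) auto
    obtain a s where as: "has_dim (HH p ?U) a" "has_dim (overlap_diff p ` pair_space p) s" "s \<le> 0"
      by (rule mayer_vietoris_finite[OF X(3)[OF p] W(3)[OF p]])
    obtain w t where wt: "has_dim (HH q (?U \<inter> ?V)) w" "has_dim (overlap_diff q ` pair_space q) t" "q = 1 \<Longrightarrow> w = 1 \<and> t = s1"
    proof (cases "q = 1")
      case True
      then show ?thesis using that W(2) 1(2) by blast
    next
      case False
      then have w: "has_dim (HH q (?U \<inter> ?V)) 0" using W(3) q(2) by simp
      obtain t where "has_dim (overlap_diff q ` pair_space q) t" using has_dim_range_overlap_diff[OF w] by blast
      then show ?thesis using that w False by blast
    qed
    have "has_dim (HH (Suc q) (?U \<union> ?V)) ((w - t) + (a + 0 - s))"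
      by (rule mayer_vietoris_dim(2)[OF wt(1,2) _ V2]) (use as q(1) in auto)
    then have "(w - t) + (a + 0 - s) = 0" using has_dim_unique X(3)[OF p] unfolding q(1) by blast
    then have "a = 0" "w \<le> t" using as(3) by auto
    then show ?thesis using as(1) wt(3) q(1) 1(3) by auto
  qed
  have "a1 = Suc (card P)" using e1 high[of 2] by simp
  then show ?case using 0(1) 1(1) high a0 insert.hyps by simp
qed

section \<open>Removing a line\<close>

lemma closed_segment_same_fst:
  assumes "v \<in> closed_segment (a, x) (a, y)"
  shows "fst v = a" "snd v \<in> closed_segment x y"
proof -
  obtain u where u: "0 \<le> u" "u \<le> 1" "v = (1 - u) *\<^sub>R (a, x) + u *\<^sub>R (a, y)" using assms by (auto simp: in_segment)
  show "fst v = a" unfolding u(3) by (simp add: algebra_simps)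
  show "snd v \<in> closed_segment x y" using u by (auto simp: in_segment)
qed

text \<open>A continuous lower bound for the distance to the points of \<open>P\<close>, positive off \<open>P\<close> even for empty \<open>P\<close>. It
  gives the width of the tube.\<close>

definition nearness :: "complex set \<Rightarrow> complex \<Rightarrow> real" where
  "nearness P a = (\<Prod>p\<in>P. min 1 (norm (a - p)))"

lemma nearness_pos: "finite P \<Longrightarrow> a \<notin> P \<Longrightarrow> 0 < nearness P a"
  unfolding nearness_def by (rule prod_pos) auto

lemma nearness_eq_0: "finite P \<Longrightarrow> a \<in> P \<Longrightarrow> nearness P a = 0"
  unfolding nearness_def by (rule prod_zero) (auto intro!: bexI[of _ a])

lemma nearness_le:
  assumes "finite P" "p \<in> P"
  shows "nearness P a \<le> norm (a - p)"
proof -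
  have "nearness P a = min 1 (norm (a - p)) * (\<Prod>p\<in>P - {p}. min 1 (norm (a - p)))"
    unfolding nearness_def using assms by (rule prod.remove)
  also have "\<dots> \<le> min 1 (norm (a - p)) * 1"
    by (intro mult_left_mono prod_le_1) auto
  finally show ?thesis by simp
qed

lemma continuous_on_nearness: "continuous_on S (nearness P)"
  unfolding nearness_def by (intro continuous_intros)

text \<open>In affine coordinates \<open>(a, b)\<close> in which the removed line is \<open>b = 0\<close>, every line that is not parallel to it
  has an equation \<open>a = p + c b\<close>, and is given by \<open>(p, c)\<close>.\<close>

definition lines_compl :: "(complex \<times> complex) set \<Rightarrow> (complex \<times> complex) set" where
  "lines_compl I = {z. \<forall>i\<in>I. fst z \<noteq> fst i + snd i * snd z}"

definition axis_compl :: "(complex \<times> complex) set \<Rightarrow> (complex \<times> complex) set" where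
  "axis_compl I = {z \<in> lines_compl I. snd z \<noteq> 0}"

text \<open>For \<open>K\<close> above all slopes \<open>\<bar>c\<bar>\<close>, a point of a line \<open>a = p + c b\<close> satisfies
  \<open>\<bar>a - p\<bar> \<le> K \<bar>b\<bar>\<close> and so lies outside this neighbourhood of the axis without \<open>P\<close>.\<close>

definition tube :: "real \<Rightarrow> complex set \<Rightarrow> (complex \<times> complex) set" where
  "tube K P = {z. K * norm (snd z) < nearness P (fst z)}"

definition punctured_tube :: "real \<Rightarrow> complex set \<Rightarrow> (complex \<times> complex) set" where
  "punctured_tube K P = {z \<in> tube K P. snd z \<noteq> 0}"

lemma open_lines_compl: "finite I \<Longrightarrow> open (lines_compl I)"
proof -
  assume I: "finite I"
  have "lines_compl I = (\<Inter>i\<in>I. {z. fst z \<noteq> fst i + snd i * snd z})" by (auto simp: lines_compl_def)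
  moreover have "open {z :: complex \<times> complex. fst z \<noteq> fst i + snd i * snd z}" for i
    by (intro open_Collect_neq continuous_intros)
  ultimately show ?thesis using I by auto
qed

lemma open_axis_compl: "finite I \<Longrightarrow> open (axis_compl I)"
proof -
  assume "finite I"
  moreover have "axis_compl I = lines_compl I \<inter> {z. snd z \<noteq> 0}" by (auto simp: axis_compl_def)
  moreover have "open {z :: complex \<times> complex. snd z \<noteq> 0}" by (intro open_Collect_neq continuous_intros)
  ultimately show ?thesis using open_lines_compl by auto
qed

lemma open_tube: "open (tube K P)"
  unfolding tube_def
  by (intro open_Collect_less continuous_intros continuous_on_compose2[OF continuous_on_nearness]) auto

lemma tube_scale:
  assumes "K > 0" "(a, b) \<in> tube K P" "norm b' \<le> norm b"
  shows "(a, b') \<in> tube K P"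
proof -
  have "K * norm b' \<le> K * norm b" using assms by (intro mult_left_mono) auto
  then show ?thesis using assms(2) by (simp add: tube_def)
qed

lemma tube_fst:
  assumes "finite P" "K > 0" "z \<in> tube K P"
  shows "fst z \<notin> P"
proof
  assume "fst z \<in> P"
  then have "K * norm (snd z) < 0" using assms nearness_eq_0[of P "fst z"] by (simp add: tube_def)
  moreover have "0 \<le> K * norm (snd z)" using assms(2) by simp
  ultimately show False by linarith
qed

lemma tube_axis: "finite P \<Longrightarrow> a \<notin> P \<Longrightarrow> (a, 0) \<in> tube K P"
  by (simp add: tube_def nearness_pos)

lemma tube_segment:
  assumes "K > 0" "z \<in> tube K P"
  shows "closed_segment (fst z, 0) z \<subseteq> tube K P"
proof
  fix v assume v: "v \<in> closed_segment (fst z, 0) z"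
  have e: "z = (fst z, snd z)" by simp
  have f: "fst v = fst z" "snd v \<in> closed_segment 0 (snd z)"
    using closed_segment_same_fst[of v "fst z" 0 "snd z"] v e by simp_all
  then have "norm (snd v) \<le> norm (snd z)" by (auto simp: in_segment mult_left_le_one_le)
  then show "v \<in> tube K P" using tube_scale[of K "fst z" "snd z" P "snd v"] assms f(1) by (metis prod.collapse)
qed

lemma HH_tube:
  assumes P: "finite P" and K: "K > 0"
  shows "has_dim (HH q (tube K P)) n \<longleftrightarrow> has_dim (HH q (- P)) n"
proof (rule HH_linear_homotopy_equivalence(2)[where f = fst and k = "\<lambda>a. (a, 0)"])
  show "continuous_on (tube K P) fst" "continuous_on (- P) (\<lambda>a. (a, 0))" by (intro continuous_intros)+
  show "fst ` tube K P \<subseteq> - P" using tube_fst[OF P K] by blast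
  show "(\<lambda>a. (a, 0)) ` (- P) \<subseteq> tube K P" using tube_axis[OF P] by blast
  show "closed_segment (fst z, 0) z \<subseteq> tube K P" if "z \<in> tube K P" for z by (rule tube_segment[OF K that])
qed auto

lemma shrink_in_punctured_tube:
  assumes P: "finite P" and K: "K > 0" and a: "a \<notin> P" and b: "b \<noteq> 0"
  shows "(a, shrink (nearness P a / K) b) \<in> punctured_tube K P"
proof -
  have r: "nearness P a / K > 0" using nearness_pos[OF P a] K by simp
  show ?thesis using norm_shrink[OF r, of b] shrink_nz[OF r b] K
    by (simp add: punctured_tube_def tube_def field_simps)
qed

lemma punctured_tube_segment:
  assumes K: "K > 0" and r: "r > 0" and z: "z \<in> punctured_tube K P" and s: "(fst z, shrink r (snd z)) \<in> tube K P"
  shows "closed_segment (fst z, shrink r (snd z)) z \<subseteq> punctured_tube K P"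
proof
  fix v assume "v \<in> closed_segment (fst z, shrink r (snd z)) z"
  then have f: "fst v = fst z" "snd v \<in> closed_segment (shrink r (snd z)) (snd z)"
    using closed_segment_same_fst[of v "fst z" "shrink r (snd z)" "snd z"] by simp_all
  note sv = closed_segment_shrink[OF f(2) r]
  have "(fst z, snd v) \<in> tube K P"
  proof (cases "norm (snd v) \<le> norm (snd z)")
    case True
    then show ?thesis using tube_scale[OF K, of "fst z" "snd z"] z by (simp add: punctured_tube_def)
  next
    case False
    then show ?thesis using tube_scale[OF K s] sv(1) by simp
  qed
  moreover have "snd v \<noteq> 0" using sv(2) z by (simp add: punctured_tube_def)
  ultimately show "v \<in> punctured_tube K P" using f(1) by (metis (mono_tags, lifting) CollectI prod.collapse punctured_tube_def)
qed

text \<open>Shrinking the second coordinate moves the full product into the punctured tube.\<close>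

lemma HH_punctured_tube:
  assumes P: "finite P" and K: "K > 0"
  shows "has_dim (HH q (punctured_tube K P)) n \<longleftrightarrow> has_dim (HH q ((- P) \<times> - {0 :: complex})) n"
proof (rule HH_linear_homotopy_equivalence(2)[where f = "\<lambda>z. z" and k = "\<lambda>z. (fst z, shrink (nearness P (fst z) / K) (snd z))"])
  let ?Z = "(- P) \<times> - {0 :: complex}"
  show "continuous_on (punctured_tube K P) (\<lambda>z. z)" by (intro continuous_intros)
  show "(\<lambda>z. z) ` punctured_tube K P \<subseteq> ?Z" using tube_fst[OF P K] by (auto simp: punctured_tube_def)
  show "continuous_on ?Z (\<lambda>z. (fst z, shrink (nearness P (fst z) / K) (snd z)))"
    using K by (intro continuous_intros continuous_on_shrink continuous_on_compose2[OF continuous_on_nearness]) auto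
  show "(\<lambda>z. (fst z, shrink (nearness P (fst z) / K) (snd z))) ` ?Z \<subseteq> punctured_tube K P"
    by (auto intro!: shrink_in_punctured_tube[OF P K])
  show "closed_segment (fst z, shrink (nearness P (fst z) / K) (snd z)) z \<subseteq> punctured_tube K P"
    if z: "z \<in> punctured_tube K P" for z
  proof (rule punctured_tube_segment[OF K _ z])
    have a: "fst z \<notin> P" using tube_fst[OF P K] z by (auto simp: punctured_tube_def)
    show "nearness P (fst z) / K > 0" using nearness_pos[OF P a] K by simp
    show "(fst z, shrink (nearness P (fst z) / K) (snd z)) \<in> tube K P"
      using shrink_in_punctured_tube[OF P K a] z by (simp add: punctured_tube_def)
  qed
  show "closed_segment (fst z, shrink (nearness P (fst z) / K) (snd z)) z \<subseteq> ?Z" if z: "z \<in> ?Z" for z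
  proof
    fix v assume v: "v \<in> closed_segment (fst z, shrink (nearness P (fst z) / K) (snd z)) z"
    let ?r = "nearness P (fst z) / K"
    have r: "?r > 0" using nearness_pos[OF P, of "fst z"] z K by auto
    have f: "fst v = fst z" "snd v \<in> closed_segment (shrink ?r (snd z)) (snd z)"
      using closed_segment_same_fst[of v "fst z" "shrink ?r (snd z)" "snd z"] v by simp_all
    have "snd v \<noteq> 0" using closed_segment_shrink(2)[OF f(2) r] z by auto
    then show "v \<in> ?Z" using z f(1) by (auto simp: mem_Times_iff)
  qed
qed

text \<open>The Mayer--Vietoris sequence of \<open>M' = M \<union> N\<close>, with \<open>N\<close> the tube around the line. In degrees \<open>1\<close>
  and \<open>2\<close> the difference map onto the cohomology of the intersection is surjective: in degree \<open>1\<close> by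
  a direct argument, in degree \<open>2\<close> because \<open>H\<^sup>3(M') = 0\<close>. Hence \<open>H\<^sup>2(M')\<close> is the kernel of a surjection
  from \<open>H\<^sup>2(M)\<close>, as \<open>H\<^sup>2(N) = 0\<close>, to the \<open>k\<close>-dimensional \<open>H\<^sup>2(M \<inter> N)\<close>.\<close>

lemma HH_remove_line:
  assumes I: "finite I" and n: "has_dim (HH 2 (lines_compl I)) n" and h3: "has_dim (HH 3 (lines_compl I)) 0"
  shows "has_dim (HH 2 (axis_compl I)) (n + card (fst ` I))" "has_dim (HH 3 (axis_compl I)) 0"
proof -
  define P where "P = fst ` I"
  define k where "k = card P"
  have P: "finite P" using I by (simp add: P_def)
  \<comment> \<open>Larger than every slope, so that the tube misses the other lines.\<close>
  define K where "K = 1 + (\<Sum>i\<in>I. norm (snd i))"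
  have K: "K > 0" unfolding K_def by (intro add_pos_nonneg sum_nonneg) auto
  have Ki: "norm (snd i) \<le> K" if "i \<in> I" for i
    using member_le_sum[OF that, of "\<lambda>i. norm (snd i)"] I by (simp add: K_def)
  let ?U = "axis_compl I" and ?V = "tube K P"
  interpret open_cover ?U ?V by unfold_locales (rule open_axis_compl[OF I] open_tube)+
  have VM: "?V \<subseteq> lines_compl I"
  proof
    fix z assume z: "z \<in> ?V"
    have "fst z \<noteq> fst i + snd i * snd z" if i: "i \<in> I" for i
    proof
      assume e: "fst z = fst i + snd i * snd z"
      have "nearness P (fst z) \<le> norm (fst z - fst i)" using nearness_le[OF P] i by (simp add: P_def)
      also have "\<dots> = norm (snd i) * norm (snd z)" by (simp add: e norm_mult)
      also have "\<dots> \<le> K * norm (snd z)" using Ki[OF i] by (intro mult_right_mono) auto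
      also have "\<dots> < nearness P (fst z)" using z by (simp add: tube_def)
      finally show False by simp
    qed
    then show "z \<in> lines_compl I" by (simp add: lines_compl_def)
  qed
  have Un: "?U \<union> ?V = lines_compl I"
  proof (intro subset_antisym subsetI)
    fix z assume z: "z \<in> lines_compl I"
    show "z \<in> ?U \<union> ?V"
    proof (cases "snd z = 0")
      case True
      then have "fst z \<notin> P" using z by (auto simp: lines_compl_def P_def)
      then show ?thesis using True tube_axis[OF P, of "fst z" K] by (metis UnCI prod.collapse)
    qed (use z in \<open>simp add: axis_compl_def\<close>)
  qed (use VM in \<open>auto simp: axis_compl_def\<close>)
  have Int: "?U \<inter> ?V = punctured_tube K P" using VM by (auto simp: axis_compl_def punctured_tube_def)
  note F = HH_punctured_plane[OF P, folded k_def]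
  have V: "has_dim (HH 1 ?V) k" "p > 1 \<Longrightarrow> has_dim (HH p ?V) 0" for p
    using F unfolding HH_tube[OF P K] by auto
  have oP: "open (- P)" using P by (simp add: finite_imp_closed open_Compl)
  have W1: "has_dim (HH (Suc 0) (?U \<inter> ?V)) (1 + k)"
    unfolding Int HH_punctured_tube[OF P K] by (rule HH_product_punctured_plane(2)[OF oP]) (use F in auto)
  have W2: "has_dim (HH (Suc 1) (?U \<inter> ?V)) (k + 0)"
    unfolding Int HH_punctured_tube[OF P K] by (rule HH_product_punctured_plane(2)[OF oP]) (use F in auto)
  have W3: "has_dim (HH (Suc 2) (?U \<inter> ?V)) (0 + 0)"
    unfolding Int HH_punctured_tube[OF P K] by (rule HH_product_punctured_plane(2)[OF oP]) (use F in auto)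
  \<comment> \<open>The restrictions from \<open>N\<close> give a space of dimension \<open>k\<close>, on which pulling back to a small loop \<open>j\<close> around the
    line is zero. The equation \<open>m\<close> of the line winds once along \<open>j\<close>, so \<open>M\<close> contributes one further
    dimension.\<close>
  have rank: "has_dim (overlap_diff 1 ` pair_space 1) (1 + k)"
  proof -
    obtain r where r: "r \<le> 1 + k" "has_dim (overlap_diff 1 ` pair_space 1) r"
      using has_dim_range_overlap_diff[OF W1] unfolding One_nat_def by blast
    obtain a where a: "a \<notin> P" using ex_new_if_finite[OF infinite_UNIV_char_0 P] by blast
    let ?Z = "plane_times_punctured"
    let ?r = "nearness P a / K"
    have rpos: "?r > 0" using nearness_pos[OF P a] K by simp
    define j where "j z = (a, shrink ?r (snd z))" for z :: "complex \<times> complex"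
    define m where "m z = (0 :: complex, snd z)" for z :: "complex \<times> complex"
    have cj: "continuous_on ?Z j" unfolding j_def
      by (intro continuous_intros continuous_on_shrink)
    have jW: "j ` ?Z \<subseteq> ?U \<inter> ?V" unfolding Int j_def by (auto intro!: shrink_in_punctured_tube[OF P K a])
    have j: "continuous_map (top_of_set ?Z) TW j" using cj jW by auto
    have m: "continuous_map TU (top_of_set ?Z) m"
      unfolding m_def by (auto simp: axis_compl_def intro!: continuous_intros)
    have idW: "continuous_map TW TV (\<lambda>z. z)" "continuous_map TW TU (\<lambda>z. z)" by auto
    have segZ: "closed_segment (m (j z)) z \<subseteq> ?Z" if z: "z \<in> ?Z" for z
    proof
      fix v assume "v \<in> closed_segment (m (j z)) z"
      then have s: "snd v \<in> closed_segment (shrink ?r (snd z)) (snd z)"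
        by (auto simp: in_segment m_def j_def)
      have "snd v \<noteq> 0" using closed_segment_shrink(2)[OF s rpos] z by auto
      then show "v \<in> ?Z" by (simp add: mem_Times_iff)
    qed
    have mj: "homotopic_with (\<lambda>_. True) (top_of_set ?Z) (top_of_set ?Z) (m \<circ> j) id"
    proof (rule homotopic_with_linear)
      show "continuous_on ?Z (m \<circ> j)"
        using cj unfolding m_def o_def by (intro continuous_intros) auto
    qed (use segZ in auto)
    have jc: "homotopic_with (\<lambda>_. True) (top_of_set ?Z) TV j (\<lambda>_. (a, 0))"
    proof (rule homotopic_with_linear[OF cj])
      fix z assume "z \<in> ?Z"
      then have "j z \<in> ?V" using jW by blast
      then show "closed_segment (j z) (a, 0) \<subseteq> ?V"
        using tube_segment[OF K, of "j z" P] by (simp add: j_def closed_segment_commute)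
    qed (intro continuous_intros)
    \<comment> \<open>The loop contracts to a point of the axis within the tube.\<close>
    have Tj: "hpull 1 ?Z j (pull 1 TW (\<lambda>z. z) \<gamma>) = (\<lambda>_. 0)" if \<gamma>: "\<gamma> \<in> HH 1 ?V" for \<gamma>
    proof -
      have c: "continuous_map (top_of_set ?Z) (top_of_set {(a, 0 :: complex)}) (\<lambda>_. (a, 0))"
        "continuous_map (top_of_set {(a, 0)}) TV (\<lambda>z. z)" using tube_axis[OF P a] by auto
      have "hpull 1 ?Z j (pull 1 TW (\<lambda>z. z) \<gamma>) = hpull 1 ?Z (\<lambda>_. (a, 0)) \<gamma>"
        unfolding pull_pull[OF j] using pull_homotopic[OF jc \<gamma>] by (simp add: o_def)
      also have "\<dots> = hpull 1 ?Z (\<lambda>_. (a, 0)) (hpull 1 {(a, 0)} (\<lambda>z. z) \<gamma>)"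
        unfolding pull_pull[OF c(1)] by (simp add: o_def)
      also have "hpull 1 {(a, 0)} (\<lambda>z. z) \<gamma> = (\<lambda>_. 0)"
      proof -
        have "HH 1 {(a, 0 :: complex)} = {\<lambda>_. 0}"
          using HH_singleton(1)[of 1 "(a, 0 :: complex)"] unfolding has_dim_0_iff by simp
        then show ?thesis using pull_in[OF c(2) \<gamma>] by blast
      qed
      finally show ?thesis by (simp add: pull_zero)
    qed
    let ?T = "hpull 1 ?Z j"
    let ?RV = "pull 1 TW (\<lambda>z. z) ` HH 1 ?V"
    have kV: "has_dim ?RV k"
    proof -
      \<comment> \<open>The axis pushed off itself into the punctured tube, a section up to homotopy.\<close>
      define g where "g b = (b, of_real (nearness P b / (2 * K)) :: complex)" for b
      have cg: "continuous_on (- P) g" unfolding g_def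
        using K by (intro continuous_intros continuous_on_compose2[OF continuous_on_nearness]) auto
      have gW: "g b \<in> ?U \<inter> ?V" if "b \<notin> P" for b
        using nearness_pos[OF P that] K unfolding Int by (simp add: punctured_tube_def tube_def g_def norm_divide)
      then have g: "continuous_map (top_of_set (- P)) TW g" using cg by auto
      have gh: "homotopic_with (\<lambda>_. True) (top_of_set (- P)) TV g (\<lambda>b. (b, 0))"
      proof (rule homotopic_with_linear[OF cg])
        fix b assume "b \<in> - P"
        then have "g b \<in> ?V" using gW by blast
        then show "closed_segment (g b) (b, 0) \<subseteq> ?V"
          using tube_segment[OF K, of "g b" P] by (simp add: g_def closed_segment_commute)
      qed (intro continuous_intros)
      have fstV: "continuous_map TV (top_of_set (- P)) fst"
        using tube_fst[OF P K] by (auto intro!: continuous_intros)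
      have idV: "homotopic_with (\<lambda>_. True) TV TV ((\<lambda>b. (b, 0)) \<circ> fst) id"
      proof (rule homotopic_with_linear)
        show "continuous_on ?V ((\<lambda>b. (b, 0)) \<circ> fst)" unfolding o_def by (intro continuous_intros)
      qed (use tube_segment[OF K] in auto)
      have inj: "\<gamma> = (\<lambda>_. 0)" if \<gamma>: "\<gamma> \<in> HH 1 ?V" and z: "pull 1 TW (\<lambda>z. z) \<gamma> = (\<lambda>_. 0)" for \<gamma>
      proof -
        have "hpull 1 (- P) g (pull 1 TW (\<lambda>z. z) \<gamma>) = (\<lambda>_. 0)" unfolding z by (rule pull_zero)
        then have "hpull 1 (- P) (\<lambda>b. (b, 0)) \<gamma> = (\<lambda>_. 0)"
          unfolding pull_pull[OF g] using pull_homotopic[OF gh \<gamma>] by (simp add: o_def)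
        then show ?thesis using pull_homotopic_id[OF idV fstV \<gamma>] by (simp add: pull_zero)
      qed
      show ?thesis
        by (rule has_dim_inj_image_iff[OF clinear_pull subspace_hom_homology, THEN iffD2, OF _ V(1)]) (rule inj)
    qed
    obtain k' r' where kr: "has_dim {f \<in> overlap_diff 1 ` pair_space 1. ?T f = (\<lambda>_. 0)} k'" "has_dim (?T ` overlap_diff 1 ` pair_space 1) r'" "k' + r' = r"
      by (rule rank_nullity[OF clinear_pull r(2)])
    have "?RV \<subseteq> {f \<in> overlap_diff 1 ` pair_space 1. ?T f = (\<lambda>_. 0)}"
    proof
      fix f assume "f \<in> ?RV"
      then obtain \<gamma> where \<gamma>: "\<gamma> \<in> HH 1 ?V" "f = pull 1 TW (\<lambda>z. z) \<gamma>" by blast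
      have \<gamma>id: "pull 1 TV (\<lambda>z. z) \<gamma> = \<gamma>" by (rule pull_id[OF \<gamma>(1)]) simp
      let ?h = "case_sum (\<lambda>_. 0) (\<lambda>c. (-1) * \<gamma> c)"
      have "(\<lambda>_. 0) \<in> HH 1 ?U" "(\<lambda>c. (-1) * \<gamma> c) \<in> HH 1 ?V"
        using subspace_hom_homology \<gamma>(1) unfolding subspace_iff by blast+
      then have hU: "?h \<in> pair_space 1" by simp
      have hd: "overlap_diff 1 ?h = f"
      proof
        fix c
        have "\<gamma> c = \<gamma> (chain_map 1 (\<lambda>z. z) c)" if "cycle 1 TW c"
          using fun_cong[OF \<gamma>id, of c] cycle_mono(2)[OF that] by (simp add: pull_def)
        then show "overlap_diff 1 ?h c = f c" by (simp add: overlap_diff_def \<gamma>(2) pull_def)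
      qed
      have "f \<in> overlap_diff 1 ` pair_space 1" unfolding hd[symmetric] by (rule imageI[OF hU])
      moreover have "?T f = (\<lambda>_. 0)" unfolding \<gamma>(2) by (rule Tj[OF \<gamma>(1)])
      ultimately show "f \<in> {f \<in> overlap_diff 1 ` pair_space 1. ?T f = (\<lambda>_. 0)}" by simp
    qed
    then obtain k'' where "k'' \<le> k'" "has_dim ?RV k''" using has_dim_mono[OF kr(1) has_dim_subspace[OF kV]] by blast
    then have kk: "k \<le> k'" using has_dim_unique[OF kV] by blast
    have "?T ` overlap_diff 1 ` pair_space 1 = HH 1 ?Z"
    proof (intro subset_antisym subsetI)
      fix \<omega> assume \<omega>: "\<omega> \<in> HH 1 ?Z"
      let ?h = "case_sum (pull 1 TU m \<omega>) (\<lambda>_. 0)"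
      have h: "?h \<in> pair_space 1" using pull_in[OF m \<omega>] subspace_hom_homology[of 1 TV] by (simp add: subspace_iff)
      have hd: "overlap_diff 1 ?h = pull 1 TW m \<omega>" using cycle_mono(1) by (auto simp: overlap_diff_def pull_def fun_eq_iff)
      have "?T (overlap_diff 1 ?h) = \<omega>"
        unfolding hd pull_pull[OF j] pull_homotopic[OF mj \<omega>] by (rule pull_id[OF \<omega>]) simp
      then show "\<omega> \<in> ?T ` overlap_diff 1 ` pair_space 1" using imageI[OF imageI[OF h, of "overlap_diff 1"], of ?T] by simp
    qed (use pull_in[OF j] overlap_diff_in in blast)
    then have "r' = 1" using kr(2) has_dim_unique HH_plane_times_punctured(2) by metis
    then have "r = 1 + k" using kk kr(3) r(1) by simp
    then show ?thesis using r(2) by simp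
  qed
  have W2': "has_dim (HH 2 (?U \<inter> ?V)) k" and W3': "has_dim (HH 3 (?U \<inter> ?V)) 0"
    using W2 W3 by (simp_all add: numeral_2_eq_2 numeral_3_eq_3)
  obtain a2 s2 where 2: "has_dim (HH 2 ?U) a2" "has_dim (overlap_diff 2 ` pair_space 2) s2" "s2 \<le> k"
    by (rule mayer_vietoris_finite[OF n[folded Un] W2'])
  obtain a3 s3 where 3: "has_dim (HH 3 ?U) a3" "has_dim (overlap_diff 3 ` pair_space 3) s3" "s3 \<le> 0"
    by (rule mayer_vietoris_finite[OF h3[folded Un] W3'])
  have "has_dim (HH (Suc 2) (?U \<union> ?V)) ((k - s2) + (a3 + 0 - s3))"
    by (rule mayer_vietoris_dim(2)[OF W2' 2(2) _ V(2)]) (use 3 in simp_all)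
  then have "(k - s2) + (a3 + 0 - s3) = 0" using has_dim_unique h3 unfolding Un by fastforce
  then have s2: "s2 = k" and a3: "a3 = 0" using 2(3) 3(3) by auto
  have e2: "has_dim (HH (Suc 1) (?U \<union> ?V)) ((1 + k - (1 + k)) + (a2 + 0 - s2))" and l2: "s2 \<le> a2 + 0"
    by (rule mayer_vietoris_dim[OF W1[folded One_nat_def] rank _ V(2)]; use 2 in \<open>simp add: numeral_2_eq_2\<close>)+
  have "a2 + 0 - s2 = n" using has_dim_unique[OF n[folded Un]] e2 by (simp add: numeral_2_eq_2)
  then have "a2 = n + k" using s2 l2 by simp
  then show "has_dim (HH 2 ?U) (n + card (fst ` I))" "has_dim (HH 3 ?U) 0"
    using 2(1) 3(1) a3 by (simp_all add: k_def P_def)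
qed

section \<open>The degree two part of the Orlik--Solomon algebra\<close>

text \<open>The boundary of a monomial is a signed sum of the monomials with one index removed.\<close>

lemma ext_boundary_mono_support:
  assumes "finite S" "ext_boundary m (ext_mono S) U \<noteq> 0"
  shows "U \<subseteq> S" "Suc (card U) = card S"
proof -
  obtain i where i: "i \<in> {..<m} - U" "ext_mono S (insert i U) \<noteq> 0"
    using assms(2) unfolding ext_boundary_def by (metis (no_types, lifting) mult_zero_right sum.neutral)
  then have S: "S = insert i U" by (auto simp: ext_mono_def split: if_splits)
  show "U \<subseteq> S" using S by blast
  show "Suc (card U) = card S" using assms(1) i(1) S by simp
qed

lemma ext_boundary_mono_nz:
  assumes "S \<subseteq> {..<m}" "i \<in> S"
  shows "ext_boundary m (ext_mono S) (S - {i}) \<noteq> 0"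
proof -
  let ?U = "S - {i}"
  have "ext_boundary m (ext_mono S) ?U = (\<Sum>k\<in>{..<m} - ?U. if k = i then (-1) ^ card {j \<in> ?U. j < i} else 0)"
    unfolding ext_boundary_def
  proof (rule sum.cong)
    fix k assume k: "k \<in> {..<m} - ?U"
    have "insert k ?U = S \<longleftrightarrow> k = i" using assms(2) k by auto
    then show "(-1) ^ card {j \<in> ?U. j < k} * ext_mono S (insert k ?U)
        = (if k = i then (-1) ^ card {j \<in> ?U. j < i} else 0)" by (auto simp: ext_mono_def)
  qed simp
  also have "\<dots> = (-1) ^ card {j \<in> ?U. j < i}" using assms by (subst sum.delta) auto
  finally show ?thesis by simp
qed

definition through :: "cplane set list \<Rightarrow> cplane \<Rightarrow> nat set" where
  "through ls p = {i. i < length ls \<and> p \<in> ls ! i}"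

definition node_relation :: "cplane set list \<Rightarrow> cplane \<Rightarrow> ext" where
  "node_relation ls p = ext_boundary (length ls) (ext_mono (through ls p))"

lemma wedge_list_lines_through:
  "wedge_list (map ext_gen (lines_through ls p)) = ext_mono (through ls p)"
proof -
  have "sorted_wrt (<) (lines_through ls p)"
    unfolding lines_through_def by (rule sorted_wrt_filter) (rule sorted_wrt_upt)
  then have "wedge_list (map ext_gen (lines_through ls p)) = ext_mono (set (lines_through ls p))"
    by (rule wedge_list_gens)
  also have "set (lines_through ls p) = through ls p" by (auto simp: lines_through_def through_def)
  finally show ?thesis .
qed

lemma OS_relations_eq:
  "OS_relations ls = node_relation ls ` {p. multiplicity_at (set ls) p \<ge> 3}"
proof -
  have "(2 \<le> x \<and> 3 \<le> x) = (3 \<le> x)" for x :: nat by auto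
  then show ?thesis
    unfolding OS_relations_def wedge_list_lines_through node_relation_def is_node_def
    by (simp only: setcompr_eq_image)
qed

lemma card_through:
  assumes "distinct ls"
  shows "card (through ls p) = multiplicity_at (set ls) p"
proof -
  have "bij_betw (\<lambda>i. ls ! i) (through ls p) {l \<in> set ls. p \<in> l}"
    unfolding through_def
    by (rule bij_betw_imageI)
      (use assms in \<open>auto simp: inj_on_def nth_eq_iff_index_eq in_set_conv_nth image_iff\<close>)
  then show ?thesis by (simp add: multiplicity_at_def bij_betw_same_card)
qed

lemma finite_through: "finite (through ls p)" "through ls p \<subseteq> {..<length ls}"
  by (auto simp: through_def)

lemma node_relation_support:
  assumes "distinct ls" "node_relation ls p U \<noteq> 0"
  shows "U \<subseteq> through ls p" "Suc (card U) = multiplicity_at (set ls) p"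
  using ext_boundary_mono_support[OF finite_through(1), of "length ls" ls p U] assms card_through[OF assms(1), of p]
  by (auto simp: node_relation_def)

definition triple_points :: "cplane set set \<Rightarrow> cplane set" where
  "triple_points A = {p. multiplicity_at A p = 3}"

definition relation_comb :: "cplane set list \<Rightarrow> (cplane \<Rightarrow> complex) \<Rightarrow> ext" where
  "relation_comb ls c = (\<lambda>U. \<Sum>p\<in>triple_points (set ls). c p * node_relation ls p U)"

text \<open>Two distinct lines meet at most once. This makes the relations of different triple points have
  disjoint supports in degree two.\<close>

locale linear_arrangement =
  fixes ls :: "cplane set list"
  assumes dist: "distinct ls"
    and meet: "\<And>l l' p q. l \<in> set ls \<Longrightarrow> l' \<in> set ls \<Longrightarrow> l \<noteq> l' \<Longrightarrow> p \<in> l \<inter> l' \<Longrightarrow> q \<in> l \<inter> l' \<Longrightarrow> p = q"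
begin

abbreviation "m \<equiv> length ls"
abbreviation "T3 \<equiv> triple_points (set ls)"
abbreviation "E \<equiv> ext_alg m"
abbreviation "I \<equiv> OS_ideal ls"
abbreviation "D \<equiv> ext_degree m 2"

lemma common_pair_imp_eq:
  assumes U: "U \<subseteq> through ls p" "U \<subseteq> through ls q" "card U = 2"
  shows "p = q"
proof -
  obtain i j where ij: "U = {i, j}" "i \<noteq> j" using U(3) by (auto simp: card_2_iff)
  have "ls ! i \<noteq> ls ! j" using ij U dist by (auto simp: through_def nth_eq_iff_index_eq)
  then show ?thesis using meet[of "ls ! i" "ls ! j" p q] ij U by (auto simp: through_def)
qed

lemma finite_T3: "finite T3"
proof (rule finite_imageD)
  have "through ls ` T3 \<subseteq> Pow {..<m}" using finite_through(2) by auto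
  then show "finite (through ls ` T3)" by (rule finite_subset) simp
  show "inj_on (through ls) T3"
  proof (rule inj_onI)
    fix p q assume p: "p \<in> T3" and e: "through ls p = through ls q"
    have "2 \<le> card (through ls p)" using p by (simp add: card_through[OF dist] triple_points_def)
    then obtain U where "U \<subseteq> through ls p" "card U = 2" "finite U" by (rule obtain_subset_with_card_n)
    then show "p = q" using common_pair_imp_eq[of U p q] e by blast
  qed
qed

lemma clinear_relation_comb: "clinear (relation_comb ls)"
  by (rule clinearI) (auto simp: relation_comb_def algebra_simps sum.distrib sum_distrib_left)

lemma relation_comb_inj:
  assumes z: "relation_comb ls c = (\<lambda>_. 0)" and p: "p \<in> T3"
  shows "c p = 0"
proof -
  have "card (through ls p) = 3" using p by (simp add: card_through[OF dist] triple_points_def)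
  then obtain i where i: "i \<in> through ls p" by fastforce
  let ?U = "through ls p - {i}"
  have U: "card ?U = 2" using \<open>card (through ls p) = 3\<close> i finite_through(1) by simp
  have "node_relation ls q ?U = 0" if "q \<in> T3 - {p}" for q
    using node_relation_support(1)[OF dist, of q ?U] common_pair_imp_eq[of ?U p q] U that by blast
  then have "relation_comb ls c ?U = c p * node_relation ls p ?U"
    unfolding relation_comb_def by (subst sum.remove[OF finite_T3 p]) simp
  then show ?thesis
    using fun_cong[OF z, of ?U] ext_boundary_mono_nz[OF finite_through(2) i] by (simp add: node_relation_def)
qed

text \<open>A pair of lines lies on one node only, so that the coefficient of a monomial in the relation of a
  triple point can be read off from a linear combination.\<close>

lemma has_dim_relations: "has_dim (range (relation_comb ls)) (card T3)"
proof -
  let ?C = "{c :: cplane \<Rightarrow> complex. \<forall>p. p \<notin> T3 \<longrightarrow> c p = 0}"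
  have C: "has_dim ?C (card T3)" by (rule has_dim_coordinate_space[OF finite_T3])
  have "c = (\<lambda>_. 0)" if "c \<in> ?C" "relation_comb ls c = (\<lambda>_. 0)" for c
  proof
    show "c p = 0" for p using relation_comb_inj[OF that(2), of p] that(1) by blast
  qed
  then have d: "has_dim (relation_comb ls ` ?C) (card T3)"
    by (rule has_dim_inj_image_iff[OF clinear_relation_comb has_dim_subspace[OF C], THEN iffD2, OF _ C])
  have "relation_comb ls c \<in> relation_comb ls ` ?C" for c
  proof (rule image_eqI)
    show "relation_comb ls c = relation_comb ls (\<lambda>p. if p \<in> T3 then c p else 0)"
      unfolding relation_comb_def by (intro ext sum.cong) auto
  qed auto
  then have "range (relation_comb ls) = relation_comb ls ` ?C" by blast
  then show ?thesis using d by simp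
qed

lemma degree_eq: "D = {\<alpha>. \<forall>S. S \<notin> {S. S \<subseteq> {..<m} \<and> card S = 2} \<longrightarrow> \<alpha> S = 0}"
  by (auto simp: ext_degree_def ext_alg_def)

lemma has_dim_degree: "has_dim D (m choose 2)"
proof -
  have "finite {S. S \<subseteq> {..<m} \<and> card S = 2}" by (rule finite_subset[of _ "Pow {..<m}"]) auto
  from has_dim_coordinate_space[OF this] show ?thesis
    unfolding degree_eq by (simp add: n_subsets)
qed

lemma relation_comb_degree: "relation_comb ls c \<in> D"
proof -
  have "node_relation ls p S = 0" if "p \<in> T3" "\<not> (S \<subseteq> {..<m} \<and> card S = 2)" for p S
    using node_relation_support[OF dist, of p S] finite_through(2)[of ls p] that by (auto simp: triple_points_def)
  then show ?thesis unfolding degree_eq relation_comb_def by (auto intro!: sum.neutral)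
qed

lemma range_relation_comb_lin:
  assumes "\<rho> \<in> range (relation_comb ls)" "\<rho>' \<in> range (relation_comb ls)"
  shows "(\<lambda>U. a * \<rho> U + b * \<rho>' U) \<in> range (relation_comb ls)"
proof -
  have "cfun.subspace (range (relation_comb ls))" using has_dim_relations has_dim_subspace by blast
  then have add: "\<And>f g. f \<in> range (relation_comb ls) \<Longrightarrow> g \<in> range (relation_comb ls) \<Longrightarrow> (\<lambda>x. f x + g x) \<in> range (relation_comb ls)"
    and scale: "\<And>c f. f \<in> range (relation_comb ls) \<Longrightarrow> (\<lambda>x. c * f x) \<in> range (relation_comb ls)"
    unfolding subspace_iff by blast+
  show ?thesis by (rule add[OF scale[OF assms(1)] scale[OF assms(2)]])
qed

text \<open>An ideal that contains all relations and has a known degree two part: multiplication by an element with constant term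
  \<open>c\<close> acts on the lowest nonzero degree of an element as multiplication by \<open>c\<close>.\<close>

definition relation_ideal :: "ext set" where
  "relation_ideal = {\<alpha> \<in> carrier E. (\<forall>U. card U < 2 \<longrightarrow> \<alpha> U = 0) \<and> (\<exists>\<rho>\<in>range (relation_comb ls). \<forall>U. card U = 2 \<longrightarrow> \<alpha> U = \<rho> U)}"

lemma wedge_low:
  assumes \<alpha>: "\<And>U. card U < 2 \<Longrightarrow> \<alpha> U = 0"
  shows "card U < 2 \<Longrightarrow> wedge \<beta> \<alpha> U = 0" "card U < 2 \<Longrightarrow> wedge \<alpha> \<beta> U = 0"
    "card U = 2 \<Longrightarrow> wedge \<beta> \<alpha> U = \<beta> {} * \<alpha> U" "card U = 2 \<Longrightarrow> wedge \<alpha> \<beta> U = \<beta> {} * \<alpha> U"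
proof -
  have z: "\<alpha> S = 0" if "finite U" "S \<subseteq> U" "card U < 2" for S using \<alpha> card_mono[OF that(1,2)] that(3) by simp
  show "wedge \<beta> \<alpha> U = 0" if "card U < 2"
    using z[OF _ _ that] unfolding wedge_def by (cases "finite U") (auto intro!: sum.neutral)
  show "wedge \<alpha> \<beta> U = 0" if "card U < 2"
    using z[OF _ _ that] unfolding wedge_def by (cases "finite U") (auto intro!: sum.neutral)
  assume U: "card U = 2"
  then have fU: "finite U" using card.infinite by fastforce
  have z2: "\<alpha> S = 0" if "S \<subset> U" for S using \<alpha> psubset_card_mono[OF fU that] U by simp
  have "wedge \<beta> \<alpha> U = (\<Sum>S\<in>Pow U. if S = {} then \<beta> {} * \<alpha> U else 0)"
    unfolding wedge_def
  proof (rule sum.cong)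
    fix S assume S: "S \<in> Pow U"
    have "\<alpha> (U - S) = 0" if "S \<noteq> {}" using z2[of "U - S"] S that by blast
    then show "shuffle_sign S (U - S) * \<beta> S * \<alpha> (U - S) = (if S = {} then \<beta> {} * \<alpha> U else 0)" by auto
  qed simp
  then show "wedge \<beta> \<alpha> U = \<beta> {} * \<alpha> U" using fU by (simp add: sum.delta)
  have "wedge \<alpha> \<beta> U = (\<Sum>S\<in>Pow U. if S = U then \<beta> {} * \<alpha> U else 0)"
    unfolding wedge_def
  proof (rule sum.cong)
    fix S assume S: "S \<in> Pow U"
    have "\<alpha> S = 0" if "S \<noteq> U" using z2[of S] S that by blast
    then show "shuffle_sign S (U - S) * \<alpha> S * \<beta> (U - S) = (if S = U then \<beta> {} * \<alpha> U else 0)" by auto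
  qed simp
  then show "wedge \<alpha> \<beta> U = \<beta> {} * \<alpha> U" using fU by (simp add: sum.delta)
qed

lemma relation_ideal_lin:
  assumes "\<alpha> \<in> relation_ideal" "\<beta> \<in> relation_ideal"
  shows "(\<lambda>U. a * \<alpha> U + b * \<beta> U) \<in> relation_ideal"
proof -
  obtain \<rho> \<rho>' where "\<rho> \<in> range (relation_comb ls)" "\<forall>U. card U = 2 \<longrightarrow> \<alpha> U = \<rho> U"
    "\<rho>' \<in> range (relation_comb ls)" "\<forall>U. card U = 2 \<longrightarrow> \<beta> U = \<rho>' U" using assms by (auto simp: relation_ideal_def)
  then have "\<exists>\<rho>\<in>range (relation_comb ls). \<forall>U. card U = 2 \<longrightarrow> a * \<alpha> U + b * \<beta> U = \<rho> U"
    using range_relation_comb_lin[of \<rho> \<rho>' a b] by (intro bexI[of _ "\<lambda>U. a * \<rho> U + b * \<rho>' U"]) auto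
  then show ?thesis using assms by (auto simp: relation_ideal_def ext_alg_def)
qed

lemma ideal_relation_ideal: "ideal relation_ideal E"
proof (rule idealI)
  show "Ring.ring E" by (rule ext_alg_ring)
  have z: "(\<lambda>_. 0) \<in> relation_ideal"
  proof -
    have "(\<lambda>_. 0) \<in> range (relation_comb ls)" by (rule image_eqI[of _ _ "\<lambda>_. 0"]) (auto simp: relation_comb_def)
    then have "\<exists>\<rho>\<in>range (relation_comb ls). \<forall>U. card U = 2 \<longrightarrow> (0 :: complex) = \<rho> U"
      by (rule bexI[rotated]) simp
    then show ?thesis unfolding relation_ideal_def by (simp add: ext_alg_def)
  qed
  interpret E: Ring.ring E by (rule ext_alg_ring)
  show "subgroup relation_ideal (add_monoid E)"
  proof (rule E.add.subgroupI)
    show "relation_ideal \<subseteq> carrier E" by (auto simp: relation_ideal_def)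
    show "relation_ideal \<noteq> {}" using z by blast
    show "\<ominus>\<^bsub>E\<^esub> \<alpha> \<in> relation_ideal" if a: "\<alpha> \<in> relation_ideal" for \<alpha>
    proof -
      have n: "(\<lambda>U. - \<alpha> U) \<in> relation_ideal" using relation_ideal_lin[OF a a, of "-1" 0] by simp
      then have "(\<lambda>U. - \<alpha> U) \<in> carrier E" "\<alpha> \<in> carrier E" using a by (auto simp: relation_ideal_def)
      then have "\<ominus>\<^bsub>E\<^esub> \<alpha> = (\<lambda>U. - \<alpha> U)" by (intro E.minus_equality) (auto simp: ext_alg_def)
      then show ?thesis using n by simp
    qed
    show "\<alpha> \<oplus>\<^bsub>E\<^esub> \<beta> \<in> relation_ideal" if "\<alpha> \<in> relation_ideal" "\<beta> \<in> relation_ideal" for \<alpha> \<beta>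
      using relation_ideal_lin[OF that, of 1 1] by (simp add: ext_alg_def)
  qed
  have closed: "wedge \<beta> \<alpha> \<in> relation_ideal \<and> wedge \<alpha> \<beta> \<in> relation_ideal" if a: "\<alpha> \<in> relation_ideal" and b: "\<beta> \<in> carrier E" for \<alpha> \<beta>
  proof -
    have low: "\<And>U. card U < 2 \<Longrightarrow> \<alpha> U = 0" using a by (simp add: relation_ideal_def)
    obtain \<rho> where \<rho>: "\<rho> \<in> range (relation_comb ls)" "\<forall>U. card U = 2 \<longrightarrow> \<alpha> U = \<rho> U" using a by (auto simp: relation_ideal_def)
    have r: "(\<lambda>U. \<beta> {} * \<rho> U) \<in> range (relation_comb ls)" using range_relation_comb_lin[OF \<rho>(1) \<rho>(1), of "\<beta> {}" 0] by simp
    have "wedge \<beta> \<alpha> \<in> carrier E" "wedge \<alpha> \<beta> \<in> carrier E" using wedge_closed a b by (auto simp: relation_ideal_def)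
    moreover note wl = wedge_low[of \<alpha>, OF low]
    moreover have "\<exists>\<rho>\<in>range (relation_comb ls). \<forall>U. card U = 2 \<longrightarrow> wedge \<beta> \<alpha> U = \<rho> U"
      "\<exists>\<rho>\<in>range (relation_comb ls). \<forall>U. card U = 2 \<longrightarrow> wedge \<alpha> \<beta> U = \<rho> U"
      by (rule bexI[OF _ r]; simp add: wl \<rho>(2))+
    ultimately show ?thesis unfolding relation_ideal_def by blast
  qed
  show "\<beta> \<otimes>\<^bsub>E\<^esub> \<alpha> \<in> relation_ideal" "\<alpha> \<otimes>\<^bsub>E\<^esub> \<beta> \<in> relation_ideal" if "\<alpha> \<in> relation_ideal" "\<beta> \<in> carrier E" for \<alpha> \<beta>
    using closed[OF that] by (simp_all add: ext_alg_def)
qed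

lemma OS_relations_subset: "OS_relations ls \<subseteq> relation_ideal"
proof
  fix \<alpha> assume "\<alpha> \<in> OS_relations ls"
  then obtain p where p: "\<alpha> = node_relation ls p" "multiplicity_at (set ls) p \<ge> 3"
    unfolding OS_relations_eq by blast
  have c: "\<alpha> \<in> carrier E" using \<open>\<alpha> \<in> OS_relations ls\<close> OS_relations_closed by blast
  have low: "\<alpha> U = 0" if "card U < 2" for U
    using node_relation_support(2)[OF dist, of p U] p that by fastforce
  have "\<exists>\<rho>\<in>range (relation_comb ls). \<forall>U. card U = 2 \<longrightarrow> \<alpha> U = \<rho> U"
  proof (cases "p \<in> T3")
    case True
    have "relation_comb ls (\<lambda>q. if q = p then 1 else 0) = \<alpha>"
    proof
      fix U
      have "relation_comb ls (\<lambda>q. if q = p then 1 else 0) U = (\<Sum>q\<in>T3. if q = p then \<alpha> U else 0)"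
        unfolding relation_comb_def p(1) by (rule sum.cong) auto
      then show "relation_comb ls (\<lambda>q. if q = p then 1 else 0) U = \<alpha> U" using finite_T3 True by (simp add: sum.delta)
    qed
    then show ?thesis by (metis rangeI)
  next
    case False
    then have "\<alpha> U = 0" if "card U = 2" for U
      using node_relation_support(2)[OF dist, of p U] p that by (fastforce simp: triple_points_def)
    moreover have "(\<lambda>_. 0) \<in> range (relation_comb ls)" by (rule image_eqI[of _ _ "\<lambda>_. 0"]) (auto simp: relation_comb_def)
    ultimately show ?thesis by (intro bexI[of _ "\<lambda>_. 0"]) auto
  qed
  then show "\<alpha> \<in> relation_ideal" using c low by (simp add: relation_ideal_def)
qed

text \<open>Relations of nodes of multiplicity above three have degree above two, so only the triple points
  count.\<close>

lemma ideal_degree_two: "I \<inter> D = range (relation_comb ls)"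
proof (intro subset_antisym subsetI)
  fix \<alpha> assume \<alpha>: "\<alpha> \<in> I \<inter> D"
  have "I \<subseteq> relation_ideal" unfolding OS_ideal_def by (rule ring.genideal_minimal[OF ext_alg_ring ideal_relation_ideal OS_relations_subset])
  then obtain \<rho> where \<rho>: "\<rho> \<in> range (relation_comb ls)" "\<forall>U. card U = 2 \<longrightarrow> \<alpha> U = \<rho> U" using \<alpha> unfolding relation_ideal_def by blast
  then have "\<rho> \<in> D" using relation_comb_degree by blast
  have "\<alpha> = \<rho>"
  proof
    show "\<alpha> U = \<rho> U" for U
      using \<rho>(2) \<alpha> \<open>\<rho> \<in> D\<close> by (cases "card U = 2") (auto simp: ext_degree_def)
  qed
  then show "\<alpha> \<in> range (relation_comb ls)" using \<rho>(1) by simp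
next
  fix \<alpha> assume "\<alpha> \<in> range (relation_comb ls)"
  then obtain c where c: "\<alpha> = relation_comb ls c" by blast
  have rel: "node_relation ls p \<in> I" if "p \<in> T3" for p
  proof -
    have "node_relation ls p \<in> OS_relations ls" using that unfolding OS_relations_eq by (simp add: triple_points_def)
    then show ?thesis unfolding OS_ideal_def using ring.genideal_self[OF ext_alg_ring OS_relations_closed] by blast
  qed
  note sub = OS_ideal_submodule[of ls, unfolded submodule_def]
  have "(\<lambda>U. \<Sum>p\<in>F. c p * node_relation ls p U) \<in> I" if "F \<subseteq> T3" for F
    using finite_subset[OF that finite_T3] that
  proof (induction F)
    case empty
    then show ?case using sub by (simp add: ext_alg_def)
  next
    case (insert p F)
    have "(\<lambda>U. c p * node_relation ls p U) \<in> I" using sub rel[of p] insert.prems by (simp add: ext_alg_def)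
    then have "(\<lambda>U. c p * node_relation ls p U + (\<Sum>p\<in>F. c p * node_relation ls p U)) \<in> I"
      using sub insert by (simp add: ext_alg_def)
    then show ?case using insert.hyps by simp
  qed
  then have "\<alpha> \<in> I" unfolding c relation_comb_def by blast
  then show "\<alpha> \<in> I \<inter> D" using relation_comb_degree c by blast
qed

lemma dim_OS_part: "vectorspace.dim complex_field (OS_part ls 2) = (m choose 2) - card T3"
proof -
  have sub: "range (relation_comb ls) \<subseteq> D" using ideal_degree_two by blast
  obtain T :: "ext \<Rightarrow> ext" where T: "clinear T" "\<And>f. f \<in> D \<Longrightarrow> T f = (\<lambda>_. 0) \<longleftrightarrow> f \<in> range (relation_comb ls)"
    "has_dim (T ` D) ((m choose 2) - card T3)"
    by (rule quotient_coordinates[OF has_dim_degree has_dim_relations sub]) blast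
  show ?thesis
  proof (rule dim_space_of_cosets[OF ext_alg_vectorspace _ _ _ OS_ideal_submodule has_dim_subspace[OF has_dim_degree] _ T(1)])
    show "T f = (\<lambda>_. 0) \<longleftrightarrow> f \<in> I" if "f \<in> D" for f using T(2)[OF that] that ideal_degree_two by blast
    show "vectorspace complex_field (OS_part ls 2)" by (rule OS_part_vectorspace)
  qed (use T(3) in \<open>auto simp: ext_alg_def ext_degree_def OS_part_def OS_alg_def\<close>)
qed

lemma card_T3_le: "card T3 \<le> m choose 2"
proof -
  obtain k where "k \<le> m choose 2" "has_dim (range (relation_comb ls)) k"
    using has_dim_mono[OF has_dim_degree has_dim_subspace[OF has_dim_relations]] ideal_degree_two by auto
  then show ?thesis using has_dim_unique[OF has_dim_relations] by blast
qed

end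

section \<open>Arrangements of pairwise nonparallel lines\<close>

text \<open>For a line \<open>a x + b y = c\<close>, the coordinates are the values of \<open>a x + b y - c\<close> and of the linear form
  with the orthogonal coefficient vector, which has the nonzero determinant \<open>\<bar>a\<bar>\<^sup>2 + \<bar>b\<bar>\<^sup>2\<close>. A line not parallel to
  the first one has an equation in which the coefficient of the second form is nonzero, so that
  this form can be eliminated.\<close>

lemma line_coordinates:
  assumes "complex_line l0"
  obtains \<Phi> \<Psi> :: "cplane \<Rightarrow> cplane" where
    "continuous_on UNIV \<Phi>" "continuous_on UNIV \<Psi>" "\<And>z. \<Psi> (\<Phi> z) = z" "\<And>w. \<Phi> (\<Psi> w) = w"
    "l0 = {z. snd (\<Phi> z) = 0}"
    "\<And>l. complex_line l \<Longrightarrow> \<not> parallel_lines l0 l \<Longrightarrow> \<exists>p c. l = {z. fst (\<Phi> z) = p + c * snd (\<Phi> z)}"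
proof -
  obtain a b c where ab: "(a, b) \<noteq> (0, 0)" and l0: "l0 = {(x, y). a * x + b * y = c}"
    using assms by (auto simp: complex_line_def)
  define D where "D = a * cnj a + b * cnj b"
  have "D = of_real ((norm a)\<^sup>2 + (norm b)\<^sup>2)"
    unfolding D_def by (simp only: complex_norm_square of_real_add)
  moreover have "(norm a)\<^sup>2 + (norm b)\<^sup>2 \<noteq> 0" using ab by (simp add: sum_power2_eq_zero_iff)
  ultimately have D: "D \<noteq> 0" by (metis of_real_eq_0_iff)
  define \<Phi> where "\<Phi> z = (cnj a * snd z - cnj b * fst z, a * fst z + b * snd z - c)" for z
  define \<Psi> where "\<Psi> w = ((cnj a * (snd w + c) - b * fst w) / D, (cnj b * (snd w + c) + a * fst w) / D)" for w
  have "continuous_on UNIV \<Phi>" unfolding \<Phi>_def by (intro continuous_intros)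
  moreover have "continuous_on UNIV \<Psi>" unfolding \<Psi>_def using D by (intro continuous_intros) auto
  moreover have "\<Psi> (\<Phi> z) = z" for z
  proof -
    have "cnj a * (a * fst z + b * snd z - c + c) - b * (cnj a * snd z - cnj b * fst z) = D * fst z"
      "cnj b * (a * fst z + b * snd z - c + c) + a * (cnj a * snd z - cnj b * fst z) = D * snd z"
      by (simp_all add: D_def algebra_simps)
    then show ?thesis using D by (simp add: \<Phi>_def \<Psi>_def)
  qed
  moreover have "\<Phi> (\<Psi> w) = w" for w
  proof -
    have "cnj a * (cnj b * (snd w + c) + a * fst w) - cnj b * (cnj a * (snd w + c) - b * fst w) = D * fst w"
      "a * (cnj a * (snd w + c) - b * fst w) + b * (cnj b * (snd w + c) + a * fst w) = D * (snd w + c)"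
      by (simp_all add: D_def algebra_simps)
    then have "(cnj a * (cnj b * (snd w + c) + a * fst w) - cnj b * (cnj a * (snd w + c) - b * fst w)) / D = fst w"
      "(a * (cnj a * (snd w + c) - b * fst w) + b * (cnj b * (snd w + c) + a * fst w)) / D = snd w + c"
      using D by simp_all
    then have "cnj a * ((cnj b * (snd w + c) + a * fst w) / D) - cnj b * ((cnj a * (snd w + c) - b * fst w) / D) = fst w"
      "a * ((cnj a * (snd w + c) - b * fst w) / D) + b * ((cnj b * (snd w + c) + a * fst w) / D) = snd w + c"
      by (simp_all only: times_divide_eq_right diff_divide_distrib[symmetric] add_divide_distrib[symmetric])
    then show ?thesis by (simp add: \<Phi>_def \<Psi>_def)
  qed
  moreover have "l0 = {z. snd (\<Phi> z) = 0}" by (auto simp: l0 \<Phi>_def)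
  moreover have "\<exists>p k. l = {z. fst (\<Phi> z) = p + k * snd (\<Phi> z)}" if l: "complex_line l" and np: "\<not> parallel_lines l0 l" for l
  proof -
    obtain a' b' c' where ab': "(a', b') \<noteq> (0, 0)" and l': "l = {(x, y). a' * x + b' * y = c'}"
      using l by (auto simp: complex_line_def)
    define \<beta> where "\<beta> = a' * cnj a + b' * cnj b"
    define \<alpha> where "\<alpha> = a * b' - a' * b"
    have eq: "D * (a' * x + b' * y) = \<alpha> * (cnj a * y - cnj b * x) + \<beta> * (a * x + b * y)" for x y
      by (simp add: D_def \<alpha>_def \<beta>_def algebra_simps)
    have "\<alpha> \<noteq> 0"
    proof
      assume \<alpha>: "\<alpha> = 0"
      then have eq0: "D * (a' * x + b' * y) = \<beta> * (a * x + b * y)" for x y using eq[of x y] by simp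
      have "\<beta> \<noteq> 0"
      proof
        assume "\<beta> = 0"
        then have "a' * x + b' * y = 0" for x y using eq0[of x y] D by simp
        from this[of 1 0] this[of 0 1] show False using ab' by simp
      qed
      \<comment> \<open>Translating by this multiple of the conjugate normal vector maps one line onto the other.\<close>
      define r where "r = (D * c' / \<beta> - c) / D"
      have memb: "z \<in> l \<longleftrightarrow> a * fst z + b * snd z = D * c' / \<beta>" for z
      proof -
        have "z \<in> l \<longleftrightarrow> D * (a' * fst z + b' * snd z) = D * c'" using D by (cases z) (simp add: l')
        also have "\<dots> \<longleftrightarrow> a * fst z + b * snd z = D * c' / \<beta>"
          unfolding eq0 using \<open>\<beta> \<noteq> 0\<close> by (simp add: field_simps)
        finally show ?thesis .
      qed
      have v: "a * (r * cnj a) + b * (r * cnj b) = D * c' / \<beta> - c"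
      proof -
        have "a * (r * cnj a) + b * (r * cnj b) = r * D" by (simp add: D_def algebra_simps)
        then show ?thesis using D by (simp add: r_def)
      qed
      have "l = (\<lambda>p. p + (r * cnj a, r * cnj b)) ` l0"
      proof (intro subset_antisym subsetI)
        fix z assume z: "z \<in> l"
        let ?p = "z - (r * cnj a, r * cnj b)"
        have "a * fst ?p + b * snd ?p = a * fst z + b * snd z - (a * (r * cnj a) + b * (r * cnj b))"
          by (simp add: algebra_simps)
        also have "\<dots> = c" using z memb[of z] v by simp
        finally have "?p \<in> l0" by (cases z) (simp add: l0)
        then show "z \<in> (\<lambda>p. p + (r * cnj a, r * cnj b)) ` l0" by (rule image_eqI[rotated]) simp
      next
        fix z assume "z \<in> (\<lambda>p. p + (r * cnj a, r * cnj b)) ` l0"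
        then obtain p where p: "p \<in> l0" "z = p + (r * cnj a, r * cnj b)" by blast
        have "a * fst z + b * snd z = (a * fst p + b * snd p) + (a * (r * cnj a) + b * (r * cnj b))"
          by (simp add: p(2) algebra_simps)
        also have "\<dots> = D * c' / \<beta>" using p(1) v by (cases p) (simp add: l0)
        finally show "z \<in> l" unfolding memb .
      qed
      then show False using np unfolding parallel_lines_def by blast
    qed
    have "z \<in> l \<longleftrightarrow> fst (\<Phi> z) = (D * c' - \<beta> * c) / \<alpha> + (- \<beta> / \<alpha>) * snd (\<Phi> z)" for z
    proof -
      have "z \<in> l \<longleftrightarrow> D * (a' * fst z + b' * snd z) = D * c'" using D by (cases z) (simp add: l')
      also have "\<dots> \<longleftrightarrow> \<alpha> * fst (\<Phi> z) = (D * c' - \<beta> * c) - \<beta> * snd (\<Phi> z)"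
        unfolding eq by (auto simp: \<Phi>_def algebra_simps)
      also have "\<dots> \<longleftrightarrow> fst (\<Phi> z) = (D * c' - \<beta> * c) / \<alpha> + (- \<beta> / \<alpha>) * snd (\<Phi> z)"
      proof -
        have e: "(D * c' - \<beta> * c) / \<alpha> + (- \<beta> / \<alpha>) * snd (\<Phi> z) = ((D * c' - \<beta> * c) - \<beta> * snd (\<Phi> z)) / \<alpha>"
          by (simp add: diff_divide_distrib)
        show ?thesis unfolding e eq_divide_eq using \<open>\<alpha> \<noteq> 0\<close> by (simp add: mult.commute)
      qed
      finally show ?thesis .
    qed
    then show ?thesis by blast
  qed
  ultimately show ?thesis by (rule that)
qed

lemma nonparallel_lines_meet:
  assumes "complex_line l0" "complex_line l" "\<not> parallel_lines l0 l"
  shows "\<exists>!z. z \<in> l0 \<and> z \<in> l"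
proof -
  obtain \<Phi> \<Psi> :: "cplane \<Rightarrow> cplane" where c: "\<And>z. \<Psi> (\<Phi> z) = z" "\<And>w. \<Phi> (\<Psi> w) = w"
    "l0 = {z. snd (\<Phi> z) = 0}"
    "\<And>l. complex_line l \<Longrightarrow> \<not> parallel_lines l0 l \<Longrightarrow> \<exists>p c. l = {z. fst (\<Phi> z) = p + c * snd (\<Phi> z)}"
    by (rule line_coordinates[OF assms(1)]) blast
  obtain p k where l: "l = {z. fst (\<Phi> z) = p + k * snd (\<Phi> z)}" using c(4) assms by blast
  have "z \<in> l0 \<and> z \<in> l \<longleftrightarrow> z = \<Psi> (p, 0)" for z
  proof
    assume "z \<in> l0 \<and> z \<in> l"
    then have "\<Phi> z = (p, 0)" using c(3) l by (auto simp: prod_eq_iff)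
    then show "z = \<Psi> (p, 0)" using c(1)[of z] by simp
  next
    assume "z = \<Psi> (p, 0)"
    then have "\<Phi> z = (p, 0)" using c(2) by simp
    then show "z \<in> l0 \<and> z \<in> l" using c(3) l by simp
  qed
  then show ?thesis by (intro ex1I[of _ "\<Psi> (p, 0)"]) simp_all
qed

definition nonparallel_arrangement :: "cplane set set \<Rightarrow> bool" where
  "nonparallel_arrangement A \<longleftrightarrow> finite A \<and> (\<forall>l\<in>A. complex_line l)
     \<and> (\<forall>l\<in>A. \<forall>l'\<in>A. l \<noteq> l' \<longrightarrow> \<not> parallel_lines l l')"

definition nodes_on :: "cplane set set \<Rightarrow> cplane set \<Rightarrow> cplane set" where
  "nodes_on A l0 = {z \<in> l0. \<exists>l\<in>A. z \<in> l}"

lemma HH_add_line: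
  assumes A: "nonparallel_arrangement (insert l0 A)" and l0: "l0 \<notin> A"
    and n: "has_dim (HH 2 (UNIV - \<Union>A)) n" and h3: "has_dim (HH 3 (UNIV - \<Union>A)) 0"
  shows "has_dim (HH 2 (UNIV - \<Union>(insert l0 A))) (n + card (nodes_on A l0))"
    and "has_dim (HH 3 (UNIV - \<Union>(insert l0 A))) 0"
proof -
  have "complex_line l0" using A by (simp add: nonparallel_arrangement_def)
  then obtain \<Phi> \<Psi> :: "cplane \<Rightarrow> cplane" where
    cont: "continuous_on UNIV \<Phi>" "continuous_on UNIV \<Psi>" and inv: "\<And>z. \<Psi> (\<Phi> z) = z" "\<And>w. \<Phi> (\<Psi> w) = w"
    and axis: "l0 = {z. snd (\<Phi> z) = 0}"
    and ex: "\<And>l. complex_line l \<Longrightarrow> \<not> parallel_lines l0 l \<Longrightarrow> \<exists>p c. l = {z. fst (\<Phi> z) = p + c * snd (\<Phi> z)}"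
    by (rule line_coordinates) blast
  have "\<forall>l\<in>A. \<exists>i. l = {z. fst (\<Phi> z) = fst i + snd i * snd (\<Phi> z)}"
  proof
    fix l assume l: "l \<in> A"
    then have "complex_line l" "\<not> parallel_lines l0 l" using A l0 by (auto simp: nonparallel_arrangement_def)
    then show "\<exists>i. l = {z. fst (\<Phi> z) = fst i + snd i * snd (\<Phi> z)}" using ex[of l] by (metis fst_conv snd_conv)
  qed
  then obtain i where i: "\<And>l. l \<in> A \<Longrightarrow> l = {z. fst (\<Phi> z) = fst (i l) + snd (i l) * snd (\<Phi> z)}" by metis
  define I where "I = i ` A"
  have I: "finite I" using A by (simp add: I_def nonparallel_arrangement_def)
  have memb: "z \<in> l \<longleftrightarrow> fst (\<Phi> z) = fst (i l) + snd (i l) * snd (\<Phi> z)" if "l \<in> A" for z l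
    using i[OF that] by blast
  have m1: "z \<in> UNIV - \<Union>A \<longleftrightarrow> \<Phi> z \<in> lines_compl I" for z
    using memb by (auto simp: lines_compl_def I_def)
  have m2: "z \<in> UNIV - \<Union>(insert l0 A) \<longleftrightarrow> \<Phi> z \<in> axis_compl I" for z
    using memb by (auto simp: lines_compl_def axis_compl_def I_def axis)
  have equiv: "has_dim (HH q S) d \<longleftrightarrow> has_dim (HH q T) d" if ST: "\<And>z. z \<in> S \<longleftrightarrow> \<Phi> z \<in> T" for q S T d
  proof (rule HH_linear_homotopy_equivalence(2)[where f = \<Phi> and k = \<Psi>])
    show "continuous_on S \<Phi>" "continuous_on T \<Psi>" using cont continuous_on_subset by blast+
    show "\<Phi> ` S \<subseteq> T" using ST by blast
    show "\<Psi> ` T \<subseteq> S" using ST inv by (metis image_subsetI)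
  qed (simp_all add: inv)
  have e: "has_dim (HH q (UNIV - \<Union>A)) d \<longleftrightarrow> has_dim (HH q (lines_compl I)) d"
    "has_dim (HH q (UNIV - \<Union>(insert l0 A))) d \<longleftrightarrow> has_dim (HH q (axis_compl I)) d" for q d
    by (rule equiv[OF m1] equiv[OF m2])+
  have "bij_betw (\<lambda>z. fst (\<Phi> z)) (nodes_on A l0) (fst ` I)"
  proof (rule bij_betw_imageI)
    show "inj_on (\<lambda>z. fst (\<Phi> z)) (nodes_on A l0)"
    proof (rule inj_onI)
      fix z w assume "z \<in> nodes_on A l0" "w \<in> nodes_on A l0" "fst (\<Phi> z) = fst (\<Phi> w)"
      then have "\<Phi> z = \<Phi> w" by (auto simp: nodes_on_def axis prod_eq_iff)
      then have "\<Psi> (\<Phi> z) = \<Psi> (\<Phi> w)" by (rule arg_cong)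
      then show "z = w" by (simp only: inv(1))
    qed
    show "(\<lambda>z. fst (\<Phi> z)) ` nodes_on A l0 = fst ` I"
    proof (intro subset_antisym subsetI)
      fix p assume "p \<in> (\<lambda>z. fst (\<Phi> z)) ` nodes_on A l0"
      then obtain z l where "p = fst (\<Phi> z)" "snd (\<Phi> z) = 0" "l \<in> A" "z \<in> l" by (auto simp: nodes_on_def axis)
      then show "p \<in> fst ` I" using memb[of l z] by (simp add: I_def)
    next
      fix p assume "p \<in> fst ` I"
      then obtain l where l: "l \<in> A" "p = fst (i l)" by (auto simp: I_def)
      have "\<Psi> (p, 0) \<in> nodes_on A l0" using l memb[OF l(1), of "\<Psi> (p, 0)"] by (auto simp: nodes_on_def axis inv)
      moreover have "p = fst (\<Phi> (\<Psi> (p, 0)))" by (simp add: inv)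
      ultimately show "p \<in> (\<lambda>z. fst (\<Phi> z)) ` nodes_on A l0" by blast
    qed
  qed
  then have "card (nodes_on A l0) = card (fst ` I)" by (rule bij_betw_same_card)
  then show "has_dim (HH 2 (UNIV - \<Union>(insert l0 A))) (n + card (nodes_on A l0))"
    "has_dim (HH 3 (UNIV - \<Union>(insert l0 A))) 0"
    using HH_remove_line[OF I n[unfolded e(1)] h3[unfolded e(1)]] unfolding e(2) by simp_all
qed

text \<open>Removing the lines one at a time from the contractible plane.\<close>

lemma HH_arrangement:
  assumes "finite A" "nonparallel_arrangement A"
  shows "(\<exists>n. has_dim (HH 2 (UNIV - \<Union>A)) n) \<and> has_dim (HH 3 (UNIV - \<Union>A)) 0"
  using assms
proof (induction A)
  case empty
  then show ?case using HH_plane(2)[where 'a = cplane, of 2] HH_plane(2)[where 'a = cplane, of 3] by auto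
next
  case (insert l A)
  have "nonparallel_arrangement A" using insert.prems by (auto simp: nonparallel_arrangement_def)
  then obtain n where "has_dim (HH 2 (UNIV - \<Union>A)) n" "has_dim (HH 3 (UNIV - \<Union>A)) 0" using insert.IH by blast
  from HH_add_line[OF insert.prems insert.hyps(2) this] show ?case by blast
qed

lemma dim_H2_add_line:
  assumes A: "nonparallel_arrangement (insert l0 A)" and l0: "l0 \<notin> A"
  shows "vectorspace.dim complex_field (cohomology_space 2 (arr_complement (insert l0 A)))
    = vectorspace.dim complex_field (cohomology_space 2 (arr_complement A)) + card (nodes_on A l0)"
proof -
  have "nonparallel_arrangement A" using A by (auto simp: nonparallel_arrangement_def)
  then obtain n where n: "has_dim (HH 2 (UNIV - \<Union>A)) n" "has_dim (HH 3 (UNIV - \<Union>A)) 0"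
    using HH_arrangement[of A] by (auto simp: nonparallel_arrangement_def)
  show ?thesis
    using dim_cohomology_space[OF n(1)] dim_cohomology_space[OF HH_add_line(1)[OF A l0 n]]
    by (simp add: arr_complement_def)
qed

section \<open>Counting nodes\<close>

lemma multiplicity_insert:
  assumes "finite A" "l0 \<notin> A"
  shows "multiplicity_at (insert l0 A) p = multiplicity_at A p + (if p \<in> l0 then 1 else 0)"
proof -
  have "{l \<in> insert l0 A. p \<in> l} = (if p \<in> l0 then insert l0 {l \<in> A. p \<in> l} else {l \<in> A. p \<in> l})" by auto
  then show ?thesis using assms by (simp add: multiplicity_at_def)
qed

text \<open>On the new line all multiplicities go up by one, elsewhere they stay the same.\<close>

lemma card_triple_points_insert:
  assumes A: "finite A" "l0 \<notin> A"
    and fin: "finite (triple_points (insert l0 A))" "finite (triple_points A)"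
  shows "card (triple_points (insert l0 A)) + card {p \<in> l0. multiplicity_at (insert l0 A) p = 4}
    = card (triple_points A) + card {p \<in> l0. multiplicity_at (insert l0 A) p = 3}"
proof -
  note m = multiplicity_insert[OF A]
  have 1: "triple_points (insert l0 A) = (triple_points A - l0) \<union> {p \<in> l0. multiplicity_at (insert l0 A) p = 3}"
    by (auto simp: triple_points_def m)
  have 2: "triple_points A = (triple_points A - l0) \<union> {p \<in> l0. multiplicity_at (insert l0 A) p = 4}"
    by (auto simp: triple_points_def m)
  have "card (triple_points (insert l0 A)) = card (triple_points A - l0) + card {p \<in> l0. multiplicity_at (insert l0 A) p = 3}"
    using fin(1) unfolding 1 by (intro card_Un_disjoint) auto
  moreover have "card (triple_points A) = card (triple_points A - l0) + card {p \<in> l0. multiplicity_at (insert l0 A) p = 4}"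
    using fin(2) by (subst 2, subst (asm) 2, intro card_Un_disjoint) auto
  ultimately show ?thesis by simp
qed

text \<open>Every other line meets \<open>l0\<close> exactly once; the lines are counted by their intersection with \<open>l0\<close>.\<close>

lemma card_eq_sum_nodes:
  assumes A: "nonparallel_arrangement (insert l0 A)" and l0: "l0 \<notin> A"
  shows "finite (nodes_on A l0)" "card A = (\<Sum>p\<in>nodes_on A l0. multiplicity_at (insert l0 A) p - 1)"
proof -
  have fA: "finite A" using A by (simp add: nonparallel_arrangement_def)
  have "\<exists>!z. z \<in> l0 \<and> z \<in> l" if "l \<in> A" for l
    using that A l0 by (intro nonparallel_lines_meet) (auto simp: nonparallel_arrangement_def)
  then obtain \<pi> where \<pi>: "\<And>l z. l \<in> A \<Longrightarrow> z \<in> l0 \<and> z \<in> l \<longleftrightarrow> z = \<pi> l" by metis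
  have N: "nodes_on A l0 = \<pi> ` A" using \<pi> by (auto simp: nodes_on_def)
  then show fin: "finite (nodes_on A l0)" using fA by simp
  have "card A = (\<Sum>p\<in>nodes_on A l0. \<Sum>l\<in>{l \<in> A. \<pi> l = p}. 1)"
    using sum.group[OF fA fin, of \<pi> "\<lambda>_. 1 :: nat"] N by simp
  also have "\<dots> = (\<Sum>p\<in>nodes_on A l0. multiplicity_at (insert l0 A) p - 1)"
  proof (rule sum.cong)
    fix p assume p: "p \<in> nodes_on A l0"
    then have "p \<in> l0" by (simp add: nodes_on_def)
    then have "\<pi> l = p \<longleftrightarrow> p \<in> l" if "l \<in> A" for l using \<pi>[OF that, of p] by auto
    then have "{l \<in> A. \<pi> l = p} = {l \<in> A. p \<in> l}" by blast
    then show "(\<Sum>l\<in>{l \<in> A. \<pi> l = p}. 1) = multiplicity_at (insert l0 A) p - 1"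
      using multiplicity_insert[OF fA l0, of p] \<open>p \<in> l0\<close> by (simp add: multiplicity_at_def)
  qed simp
  finally show "card A = (\<Sum>p\<in>nodes_on A l0. multiplicity_at (insert l0 A) p - 1)" .
qed

lemma nodes_on_eq:
  assumes "finite A" "l0 \<notin> A"
  shows "nodes_on A l0 = {p \<in> l0. is_node (insert l0 A) p}"
proof -
  have pos: "multiplicity_at A p > 0 \<longleftrightarrow> (\<exists>l\<in>A. p \<in> l)" for p
    using assms(1) by (auto simp: multiplicity_at_def card_gt_0_iff)
  have "is_node (insert l0 A) p \<longleftrightarrow> (\<exists>l\<in>A. p \<in> l)" if "p \<in> l0" for p
    unfolding pos[symmetric] is_node_def multiplicity_insert[OF assms] using that by auto
  then show ?thesis unfolding nodes_on_def by blast
qed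

lemma multiplicity_le: "finite A \<Longrightarrow> multiplicity_at A p \<le> card A"
  unfolding multiplicity_at_def by (rule card_mono) auto

lemma sum_nodes_by_multiplicity:
  assumes A: "nonparallel_arrangement (insert l0 A)" and l0: "l0 \<notin> A"
  shows "(\<Sum>p\<in>nodes_on A l0. int (multiplicity_at (insert l0 A) p) - 2)
    = int (num_nodes_on (insert l0 A) l0 3) + 2 * int (num_nodes_on (insert l0 A) l0 4)
      + (\<Sum>j = 5..card (insert l0 A). (int j - 2) * int (num_nodes_on (insert l0 A) l0 j))"
proof -
  let ?A = "insert l0 A" and ?N = "nodes_on A l0" and ?n = "card (insert l0 A)"
  let ?m = "multiplicity_at ?A" and ?a = "num_nodes_on ?A l0"
  have fA: "finite A" using A by (simp add: nonparallel_arrangement_def)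
  have fN: "finite ?N" using card_eq_sum_nodes(1)[OF A l0] .
  have a: "?a j = card {p \<in> ?N. ?m p = j}" for j
    unfolding num_nodes_on_def nodes_on_eq[OF fA l0] by (rule arg_cong[where f = card]) auto
  have m: "?m p \<in> {2..?n}" if "p \<in> ?N" for p
    using that nodes_on_eq[OF fA l0] multiplicity_le[of ?A p] fA by (auto simp: is_node_def)
  have big: "?a j = 0" if "j > ?n" for j
  proof -
    have "{p \<in> ?N. ?m p = j} = {}" using m that by force
    then show ?thesis unfolding a by (simp only: card.empty)
  qed
  \<comment> \<open>The range is enlarged to contain \<open>2\<close>, \<open>3\<close> and \<open>4\<close> for every \<open>n\<close>; the additional terms vanish.\<close>
  have "(\<Sum>p\<in>?N. int (?m p) - 2) = (\<Sum>j\<in>{2..?n + 4}. \<Sum>p\<in>{p \<in> ?N. ?m p = j}. int (?m p) - 2)"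
  proof (rule sum.group[symmetric, OF fN])
    show "?m ` ?N \<subseteq> {2..?n + 4}"
    proof
      fix j assume "j \<in> ?m ` ?N"
      then obtain p where "p \<in> ?N" "j = ?m p" by blast
      then show "j \<in> {2..?n + 4}" using m[of p] by simp
    qed
  qed simp
  also have "\<dots> = (\<Sum>j\<in>{2..?n + 4}. (int j - 2) * int (?a j))"
    by (rule sum.cong) (auto simp: a)
  also have "\<dots> = int (?a 3) + 2 * int (?a 4) + (\<Sum>j = 5..?n + 4. (int j - 2) * int (?a j))"
  proof -
    have "{2..?n + 4} = insert 2 (insert 3 (insert 4 {5..?n + 4}))" by auto
    then show ?thesis by simp
  qed
  also have "(\<Sum>j = 5..?n + 4. (int j - 2) * int (?a j)) = (\<Sum>j = 5..?n. (int j - 2) * int (?a j))"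
    by (rule sum.mono_neutral_right) (auto simp: big)
  finally show ?thesis .
qed

lemma linear_arrangementI:
  assumes "distinct ls" "nonparallel_arrangement (set ls)"
  shows "linear_arrangement ls"
proof
  fix l l' p q
  assume l: "l \<in> set ls" "l' \<in> set ls" "l \<noteq> l'" "p \<in> l \<inter> l'" "q \<in> l \<inter> l'"
  then have "\<exists>!z. z \<in> l \<and> z \<in> l'"
    using assms(2) by (intro nonparallel_lines_meet) (auto simp: nonparallel_arrangement_def)
  then show "p = q" using l by blast
qed (rule assms(1))

text \<open>Each node on \<open>l0\<close> adds its multiplicity minus two to the defect, from the number of lines on the one hand
  and the second Betti number on the other. Triple points on \<open>l0\<close> are new and
  subtract one, nodes of multiplicity four were triple points before and add one.\<close>

theorem defect_add_line:
  assumes A: "nonparallel_arrangement (set ls)" and d: "distinct ls" "distinct ls'"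
    and l0: "l0 \<in> set ls" "set ls' = set ls - {l0}"
  shows "defect ls = defect ls' + 3 * int (num_nodes_on (set ls) l0 4)
     + (\<Sum>j = 5..length ls. (int j - 2) * int (num_nodes_on (set ls) l0 j))"
proof -
  let ?A = "set ls'"
  have S: "set ls = insert l0 ?A" and n0: "l0 \<notin> ?A" using l0 by auto
  have A': "nonparallel_arrangement ?A" using A by (auto simp: nonparallel_arrangement_def S)
  note A1 = A[unfolded S]
  interpret L: linear_arrangement ls by (rule linear_arrangementI[OF d(1) A])
  interpret L': linear_arrangement ls' by (rule linear_arrangementI[OF d(2) A'])
  have len: "length ls = Suc (length ls')"
    using distinct_card[OF d(1)] distinct_card[OF d(2)] S n0 by simp
  have cA: "card ?A = length ls'" "card (insert l0 ?A) = length ls"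
    using distinct_card[OF d(1)] distinct_card[OF d(2)] S by simp_all
  let ?N = "nodes_on ?A l0"
  let ?a = "num_nodes_on (set ls) l0"
  have a: "?a j = card {p \<in> l0. multiplicity_at (set ls) p = j}" if "j \<ge> 2" for j
    unfolding num_nodes_on_def is_node_def using that by (intro arg_cong[where f = card]) auto
  have t: "card L.T3 + ?a 4 = card L'.T3 + ?a 3"
    using card_triple_points_insert[OF finite_set n0] L.finite_T3 L'.finite_T3 a[of 3] a[of 4] by (simp add: S)
  have h: "vectorspace.dim complex_field (cohomology_space 2 (arr_complement (set ls)))
    = vectorspace.dim complex_field (cohomology_space 2 (arr_complement ?A)) + card ?N"
    unfolding S by (rule dim_H2_add_line[OF A1 n0])
  have ch: "length ls choose 2 = (length ls' choose 2) + length ls'"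
    by (simp add: len numeral_2_eq_2)
  have lin: "int (length ls') - int (card ?N) = (\<Sum>p\<in>?N. int (multiplicity_at (set ls) p) - 2)"
  proof -
    have ge: "multiplicity_at (set ls) p \<ge> 2" if "p \<in> ?N" for p
      using that nodes_on_eq[OF finite_set n0] by (simp add: is_node_def S)
    have "int (length ls') = (\<Sum>p\<in>?N. int (multiplicity_at (set ls) p - 1))"
      using card_eq_sum_nodes(2)[OF A1 n0] cA(1) unfolding S by simp
    also have "\<dots> = (\<Sum>p\<in>?N. (int (multiplicity_at (set ls) p) - 2) + 1)"
    proof (rule sum.cong)
      fix p assume "p \<in> ?N"
      from ge[OF this] show "int (multiplicity_at (set ls) p - 1) = (int (multiplicity_at (set ls) p) - 2) + 1"
        by (simp add: of_nat_diff)
    qed simp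
    also have "\<dots> = (\<Sum>p\<in>?N. int (multiplicity_at (set ls) p) - 2) + int (card ?N)"
      by (simp only: sum.distrib) simp
    finally show ?thesis by simp
  qed
  have "defect ls - defect ls'
    = (int (length ls choose 2) - int (card L.T3)) - (int (length ls' choose 2) - int (card L'.T3)) - int (card ?N)"
    unfolding defect_def L.dim_OS_part L'.dim_OS_part h using L.card_T3_le L'.card_T3_le by (simp add: of_nat_diff)
  also have "\<dots> = (int (length ls') - int (card ?N)) - int (?a 3) + int (?a 4)"
    using t ch by simp
  also have "\<dots> = 3 * int (?a 4) + (\<Sum>j = 5..length ls. (int j - 2) * int (?a j))"
    unfolding lin using sum_nodes_by_multiplicity[OF A1 n0] unfolding S[symmetric] cA(2) by (simp add: S[symmetric] cA(2)[folded S])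
  finally show ?thesis by simp
qed

theorem proposition8p25:
  fixes ls ls' :: "cplane set list" and l0 :: "cplane set"
  assumes "length ls \<ge> 3"
    and "distinct ls"
    and "\<forall>l\<in>set ls. complex_line l"
    and "\<forall>l\<in>set ls. \<forall>l'\<in>set ls. l \<noteq> l' \<longrightarrow> \<not> parallel_lines l l'"
    and "l0 \<in> set ls"
    and "distinct ls'"
    and "set ls' = set ls - {l0}"
  shows "defect ls = defect ls' + 3 * int (num_nodes_on (set ls) l0 4)
           + (\<Sum>j = 5..length ls. (int j - 2) * int (num_nodes_on (set ls) l0 j)) \<and>
         ((\<forall>p\<in>l0. is_node (set ls) p \<longrightarrow> \<not> multiplicity_at (set ls) p \<ge> 4) \<longrightarrow>
           defect ls = defect ls')"
proof -
  have "nonparallel_arrangement (set ls)" using assms(3,4) by (simp add: nonparallel_arrangement_def)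
  note main = defect_add_line[OF this assms(2,6,5,7)]
  have "defect ls = defect ls'"
    if none: "\<forall>p\<in>l0. is_node (set ls) p \<longrightarrow> \<not> multiplicity_at (set ls) p \<ge> 4"
  proof -
    have "num_nodes_on (set ls) l0 j = 0" if "j \<ge> 4" for j
    proof -
      have "{p \<in> l0. is_node (set ls) p \<and> multiplicity_at (set ls) p = j} = {}" using none that by blast
      then show ?thesis unfolding num_nodes_on_def by (simp only: card.empty)
    qed
    then show ?thesis using main by simp
  qed
  then show ?thesis using main by blast
qed

end
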